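(* Let $l>0$, $a_1,a_2,b_1,b_2>0$, $c_1,c_2\ge 0$, $p_1\ge 0$, $p_2\le 0$, $q_1\le 0$, $q_2\ge 0$ be constants. Assume that (i) $d_1,d_2\in C^1(\mathbb{R}_{\ge 0};L^2(0,l))$; (ii) $d_3,d_4\in C^2(\mathbb{R}_{\ge 0})\cap L^\infty(\mathbb{R}_{\ge 0})$; (iii) with $K_m=\max\Big\{\frac{1}{\sqrt{a_1}},\frac{1}{\sqrt{a_2}},\frac{l^2}{2\sqrt{a_2}},\frac{l^4}{4\sqrt{a_1}}\Big\}$, all of the following hold: $$l^2\sqrt{2l}\,\|d_3\|_{L^\infty(\mathbb{R}_{\ge 0})}<2a_1,$$ $$\sqrt{2l}\,(1+l\sqrt{l})(1+K_m)\big(1+c_1+c_2-p_2+q_2+\|d_4\|_{L^\infty(\mathbb{R}_{\ge 0})}\big)<a_2,$$ $$l^2\sqrt{2l}\,(1+l^3)\big(c_1+p_1-q_1+q_2+\|d_3\|_{L^\infty(\mathbb{R}_{\ge 0})}\big)<2b_1,$$ $$\sqrt{2l}\,(1+l^3)\big(1+p_1+c_2-p_2+q_2+\|d_4\|_{L^\infty(\mathbb{R}_{\ge 0})}\big)<b_2.$$ Then the beam-string system (S) described in the context is EISS and EiISS. More precisely, there exist constants $C>0$ and $\mu_m>0$, independent of $t$ and of the initial datum, such that for every admissible initial datum $X_0$ (i.e. $X_0\in D(\mathcal{A}_{1,d})$ with $\mathcal{B}X_0=(d_3(0),d_4(0))$), the corresponding solution $X=(w,w_t,\phi,\phi_t)$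 satisfies, for all $t\ge 0$, $$\|X(\cdot,t)\|_{\mathcal{H}}\le C e^{-\frac{\mu_m}{4}t}\|X_0\|_{\mathcal{H}}+C\Big(\|d_1\|_{L^\infty(0,t;L^2(0,l))}+\|d_2\|_{L^\infty(0,t;L^2(0,l))}+\|d_3\|^{1/2}_{L^\infty(0,t)}+\|d_4\|^{1/2}_{L^\infty(0,t)}\Big)$$ and $$\|X(\cdot,t)\|_{\mathcal{H}}\le C e^{-\frac{\mu_m}{4}t}\|X_0\|_{\mathcal{H}}+C\Big(\int_0^t\|d_1(\cdot,s)\|_{L^2(0,l)}^2\,ds\Big)^{1/2}+C\Big(\int_0^t\|d_2(\cdot,s)\|_{L^2(0,l)}^2\,ds\Big)^{1/2}+C\Big(\int_0^t|d_3(s)|\,ds\Big)^{1/2}+C\Big(\int_0^t|d_4(s)|\,ds\Big)^{1/2}.$$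
   Context: Notation: $\mathbb{R}_{\ge 0}=[0,\infty)$; subscripts $y,t$ denote partial derivatives; $\mathrm{AC}[0,l]$ is the set of absolutely continuous functions on $[0,l]$; $\|f\|_{L^\infty(0,t;L^2(0,l))}=\operatorname{ess\,sup}_{0<s<t}\|f(\cdot,s)\|_{L^2(0,l)}$. System (S): for $(y,t)\in(0,l)\times\mathbb{R}_{\ge 0}$, $$w_{tt}+(a_1w_{yy}+b_1w_{tyy})_{yy}=c_1\phi+p_1\phi_t+q_1w_t+d_1,\qquad \phi_{tt}-(a_2\phi_y+b_2\phi_{ty})_y=c_2\phi+p_2\phi_t+q_2w_t+d_2,$$ with $w(0,t)=w_y(0,t)=\phi(0,t)=0$, $(a_1w_{yy}+b_1w_{tyy})_y(l,t)=d_3(t)$, $(a_2\phi_y+b_2\phi_{ty})(l,t)=d_4(t)$, and initial data $X_0=(w,w_t,\phi,\phi_t)|_{t=0}$. Here $d_1,d_2$ are in-domain disturbances (functions of $(y,t)$) and $d_3,d_4$ boundary disturbances (functions of $t$). State space: $\mathcal{H}=\{(f,g,h,z)\in H^2(0,l)\times L^2(0,l)\times H^1(0,l)\times L^2(0,l): f(0)=f_y(0)=h(0)=0,\ f,f_y,h\in\mathrm{AC}[0,l]\}$ with norm $\|(f,g,h,z)\|_{\mathcal H}^2=\int_0^l(a_1f_{yy}^2+g^2+a_2h_y^2+z^2)\,dy$. $D(\mathcal{A}_{1,d})$ is the set of $(f,g,h,z)\in\mathcal{H}$ such that $g\in H^2(0,l)$, $z\in H^1(0,l)$, $a_1f_{yy}+b_1g_{yy}\in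 H^2(0,l)$, $a_2h_y+b_2z_y\in H^1(0,l)$, $f(0)=f_y(0)=g(0)=g_y(0)=h(0)=z(0)=0$, $(a_1f_{yy}+b_1g_{yy})(l)=0$, and $f,f_y,g,g_y,h,z,\ a_1f_{yy}+b_1g_{yy},\ (a_1f_{yy}+b_1g_{yy})_y,\ a_2h_y+b_2z_y\in\mathrm{AC}[0,l]$. On it, $\mathcal{A}_{1,d}(f,g,h,z)=(g,-(a_1f_{yy}+b_1g_{yy})_{yy},z,(a_2h_y+b_2z_y)_y)$ and $\mathcal{B}(f,g,h,z)=((a_1f_{yy}+b_1g_{yy})_y(l),(a_2h_y+b_2z_y)(l))\in\mathbb{R}^2$. Solution: for $X_0\in D(\mathcal{A}_{1,d})$ with $\mathcal{B}X_0=(d_3(0),d_4(0))$, the solution of (S) is the unique $X=(w,w_t,\phi,\phi_t)\in C^0(\mathbb{R}_{\ge 0};D(\mathcal{A}_{1,d}))\cap C^1(\mathbb{R}_{\ge 0};\mathcal{H})$ (with $D(\mathcal{A}_{1,d})$ carrying the graph norm) satisfying $X(0)=X_0$, the evolution equations of (S), and $\mathcal{B}X(t)=(d_3(t),d_4(t))$ for all $t\ge 0$. $\mathcal{K}$: continuous strictly increasing $\gamma:\mathbb{R}_{\ge 0}\to\mathbb{R}_{\ge 0}$ with $\gamma(0)=0$; $\mathcal{K}_\infty$: those $\gamma\in\mathcal{K}$ with $\gamma(s)\to\infty$ as $s\to\infty$. (S) is EISS (exponentially input-to-state stable) with respect to $d_1,\dots,d_4$ if there exist $\beta'\in\mathcal{K}_\infty$,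 $\lambda>0$, $\gamma_1,\dots,\gamma_4\in\mathcal{K}$ such that solutions satisfy, for all $t\ge0$, $\|X(\cdot,t)\|_{\mathcal H}\le\beta'(\|X_0\|_{\mathcal H})e^{-\lambda t}+\sum_{i=1}^2\gamma_i(\|d_i\|_{L^\infty(0,t;L^2(0,l))})+\sum_{i=3}^4\gamma_i(\|d_i\|_{L^\infty(0,t)})$. (S) is EiISS (exponentially integral input-to-state stable) if there exist $\beta'\in\mathcal{K}_\infty$, $\lambda>0$, $\theta_1,\dots,\theta_4\in\mathcal{K}_\infty$, $\gamma_1,\dots,\gamma_4\in\mathcal{K}$ such that solutions satisfy, for all $t\ge0$, $\|X(\cdot,t)\|_{\mathcal H}\le\beta'(\|X_0\|_{\mathcal H})e^{-\lambda t}+\sum_{i=1}^2\theta_i\big(\int_0^t\gamma_i(\|d_i(\cdot,s)\|_{L^2(0,l)})ds\big)+\sum_{i=3}^4\theta_i\big(\int_0^t\gamma_i(|d_i(s)|)ds\big)$. *)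

theory Defs
  imports "HOL-Probability.Essential_Supremum" "HOL-Library.Function_Algebras"
begin

section \<open>Function spaces on an interval\<close>

text \<open>
  Elements of \<open>L\<^sup>2(0,l)\<close> and of the Sobolev spaces are represented by functions
  \<open>real \<Rightarrow> real\<close> that are only relevant up to equality almost everywhere on \<open>(0,l)\<close>; all notions
  below are invariant under such a change of representative. Membership in \<open>AC[0,l]\<close> accordingly
  means that there is an absolutely continuous representative, and point values are those of this
  (for \<open>l > 0\<close> unique on \<open>[0,l]\<close>) representative.
\<close>

instantiation "fun" :: (type, real_vector) real_vector
begin

definition scaleR_fun :: "real \<Rightarrow> ('a \<Rightarrow> 'b) \<Rightarrow> 'a \<Rightarrow> 'b"
  where "scaleR_fun r f = (\<lambda>x. r *\<^sub>R f x)"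

instance
  by standard (auto simp: scaleR_fun_def fun_eq_iff scaleR_add_right scaleR_add_left)

end

definition ae_eq :: "real \<Rightarrow> (real \<Rightarrow> real) \<Rightarrow> (real \<Rightarrow> real) \<Rightarrow> bool"
  where "ae_eq l f g \<longleftrightarrow> (AE y in lebesgue_on {0<..<l}. f y = g y)"

definition L2_space :: "real \<Rightarrow> (real \<Rightarrow> real) set"
  where "L2_space l = {f. f \<in> borel_measurable (lebesgue_on {0<..<l}) \<and>
                          integrable (lebesgue_on {0<..<l}) (\<lambda>y. (f y)\<^sup>2)}"

definition L2_norm :: "real \<Rightarrow> (real \<Rightarrow> real) \<Rightarrow> real"
  where "L2_norm l f = sqrt (LINT y|lebesgue_on {0<..<l}. (f y)\<^sup>2)"

definition test_function :: "real \<Rightarrow> (real \<Rightarrow> real) \<Rightarrow> bool"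
  where "test_function l \<phi> \<longleftrightarrow>
     (\<forall>n x. (deriv ^^ n) \<phi> field_differentiable at x) \<and> closure {x. \<phi> x \<noteq> 0} \<subseteq> {0<..<l}"

definition locally_integrable :: "real \<Rightarrow> (real \<Rightarrow> real) \<Rightarrow> bool"
  where "locally_integrable l f \<longleftrightarrow> (\<forall>a b. 0 < a \<and> b < l \<longrightarrow> integrable (lebesgue_on {a..b}) f)"

definition has_weak_derivative :: "real \<Rightarrow> (real \<Rightarrow> real) \<Rightarrow> (real \<Rightarrow> real) \<Rightarrow> bool"
  where "has_weak_derivative l f g \<longleftrightarrow> locally_integrable l f \<and> locally_integrable l g \<and>
     (\<forall>\<phi>. test_function l \<phi> \<longrightarrow>
        (LINT y|lebesgue_on {0<..<l}. f y * deriv \<phi> y) =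
        - (LINT y|lebesgue_on {0<..<l}. g y * \<phi> y))"

definition weak_deriv :: "real \<Rightarrow> (real \<Rightarrow> real) \<Rightarrow> real \<Rightarrow> real"
  where "weak_deriv l f = (SOME g. has_weak_derivative l f g)"

primrec Sobolev :: "real \<Rightarrow> nat \<Rightarrow> (real \<Rightarrow> real) set"
  where
    "Sobolev l 0 = L2_space l"
  | "Sobolev l (Suc k) = {f \<in> L2_space l. \<exists>g. has_weak_derivative l f g \<and> g \<in> Sobolev l k}"

definition abs_continuous :: "real \<Rightarrow> (real \<Rightarrow> real) \<Rightarrow> bool"
  where "abs_continuous l u \<longleftrightarrow>
     (\<forall>\<epsilon>>0. \<exists>\<delta>>0. \<forall>(n::nat) a b.
        (\<forall>i<n. 0 \<le> a i \<and> a i \<le> b i \<and> b i \<le> l) \<and>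
        disjoint_family_on (\<lambda>i. {a i<..<b i}) {..<n} \<and>
        (\<Sum>i<n. b i - a i) < \<delta> \<longrightarrow>
        (\<Sum>i<n. \<bar>u (b i) - u (a i)\<bar>) < \<epsilon>)"

definition AC_space :: "real \<Rightarrow> (real \<Rightarrow> real) set"
  where "AC_space l = {f. \<exists>u. abs_continuous l u \<and> ae_eq l f u}"

definition pt_val :: "real \<Rightarrow> (real \<Rightarrow> real) \<Rightarrow> real \<Rightarrow> real"
  where "pt_val l f = (SOME u. abs_continuous l u \<and> ae_eq l f u)"

section \<open>Curves on \<open>[0,\<infinity>)\<close>\<close>

text \<open>\<open>C0_curve N S X\<close>: the curve \<open>X\<close> is continuous from \<open>[0,\<infinity>)\<close> to \<open>S\<close> with the norm \<open>N\<close>;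
  \<open>C1_curve N S X X'\<close>: it is moreover continuously differentiable with derivative \<open>X'\<close>.\<close>

definition C0_curve :: "('v::real_vector \<Rightarrow> real) \<Rightarrow> 'v set \<Rightarrow> (real \<Rightarrow> 'v) \<Rightarrow> bool"
  where "C0_curve N S X \<longleftrightarrow> (\<forall>t\<ge>0. X t \<in> S) \<and>
     (\<forall>t\<ge>0. ((\<lambda>s. N (X s - X t)) \<longlongrightarrow> 0) (at t within {0..}))"

definition C1_curve ::
  "('v::real_vector \<Rightarrow> real) \<Rightarrow> 'v set \<Rightarrow> (real \<Rightarrow> 'v) \<Rightarrow> (real \<Rightarrow> 'v) \<Rightarrow> bool"
  where "C1_curve N S X X' \<longleftrightarrow> C0_curve N S X \<and> C0_curve N S X' \<and>
     (\<forall>t\<ge>0. ((\<lambda>s. N ((X s - X t) /\<^sub>R (s - t) - X' t)) \<longlongrightarrow> 0) (at t within {0..}))"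

definition C2_halfline :: "(real \<Rightarrow> real) \<Rightarrow> bool"
  where "C2_halfline d \<longleftrightarrow> (\<exists>d' d''.
     (\<forall>t\<ge>0. (d has_real_derivative d' t) (at t within {0..})) \<and>
     (\<forall>t\<ge>0. (d' has_real_derivative d'' t) (at t within {0..})) \<and>
     continuous_on {0..} d'')"

definition Linf_space :: "real set \<Rightarrow> (real \<Rightarrow> real) set"
  where "Linf_space I = {f. f \<in> borel_measurable (lebesgue_on I) \<and>
                            esssup (lebesgue_on I) (\<lambda>s. ennreal \<bar>f s\<bar>) < \<infinity>}"

text \<open>The value is only meaningful on \<^const>\<open>Linf_space\<close> (\<^const>\<open>enn2real\<close> maps \<open>\<infinity>\<close> to \<open>0\<close>); on an
  empty interval it is \<open>0\<close>.\<close>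

definition Linf_norm :: "real set \<Rightarrow> (real \<Rightarrow> real) \<Rightarrow> real"
  where "Linf_norm I f = enn2real (esssup (lebesgue_on I) (\<lambda>s. ennreal \<bar>f s\<bar>))"

section \<open>The beam-string system\<close>

type_synonym state = "(real \<Rightarrow> real) \<times> (real \<Rightarrow> real) \<times> (real \<Rightarrow> real) \<times> (real \<Rightarrow> real)"

definition state_space :: "real \<Rightarrow> state set"
  where "state_space l = {(f, g, h, z).
     f \<in> Sobolev l 2 \<and> g \<in> L2_space l \<and> h \<in> Sobolev l 1 \<and> z \<in> L2_space l \<and>
     f \<in> AC_space l \<and> weak_deriv l f \<in> AC_space l \<and> h \<in> AC_space l \<and>
     pt_val l f 0 = 0 \<and> pt_val l (weak_deriv l f) 0 = 0 \<and> pt_val l h 0 = 0}"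

definition state_norm :: "real \<Rightarrow> real \<Rightarrow> real \<Rightarrow> state \<Rightarrow> real"
  where "state_norm l a1 a2 = (\<lambda>(f, g, h, z). sqrt (LINT y|lebesgue_on {0<..<l}.
     a1 * (weak_deriv l (weak_deriv l f) y)\<^sup>2 + (g y)\<^sup>2 + a2 * (weak_deriv l h y)\<^sup>2 + (z y)\<^sup>2))"

definition moment :: "real \<Rightarrow> real \<Rightarrow> real \<Rightarrow> (real \<Rightarrow> real) \<Rightarrow> (real \<Rightarrow> real) \<Rightarrow> real \<Rightarrow> real"
  where "moment l a1 b1 f g =
     (\<lambda>y. a1 * weak_deriv l (weak_deriv l f) y + b1 * weak_deriv l (weak_deriv l g) y)"

definition tension :: "real \<Rightarrow> real \<Rightarrow> real \<Rightarrow> (real \<Rightarrow> real) \<Rightarrow> (real \<Rightarrow> real) \<Rightarrow> real \<Rightarrow> real"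
  where "tension l a2 b2 h z = (\<lambda>y. a2 * weak_deriv l h y + b2 * weak_deriv l z y)"

definition A_domain :: "real \<Rightarrow> real \<Rightarrow> real \<Rightarrow> real \<Rightarrow> real \<Rightarrow> state set"
  where "A_domain l a1 a2 b1 b2 = {(f, g, h, z). (f, g, h, z) \<in> state_space l \<and>
     g \<in> Sobolev l 2 \<and> z \<in> Sobolev l 1 \<and>
     moment l a1 b1 f g \<in> Sobolev l 2 \<and> tension l a2 b2 h z \<in> Sobolev l 1 \<and>
     f \<in> AC_space l \<and> weak_deriv l f \<in> AC_space l \<and>
     g \<in> AC_space l \<and> weak_deriv l g \<in> AC_space l \<and>
     h \<in> AC_space l \<and> z \<in> AC_space l \<and>
     moment l a1 b1 f g \<in> AC_space l \<and> weak_deriv l (moment l a1 b1 f g) \<in> AC_space l \<and>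
     tension l a2 b2 h z \<in> AC_space l \<and>
     pt_val l f 0 = 0 \<and> pt_val l (weak_deriv l f) 0 = 0 \<and>
     pt_val l g 0 = 0 \<and> pt_val l (weak_deriv l g) 0 = 0 \<and>
     pt_val l h 0 = 0 \<and> pt_val l z 0 = 0 \<and>
     pt_val l (moment l a1 b1 f g) l = 0}"

definition A_op :: "real \<Rightarrow> real \<Rightarrow> real \<Rightarrow> real \<Rightarrow> real \<Rightarrow> state \<Rightarrow> state"
  where "A_op l a1 a2 b1 b2 = (\<lambda>(f, g, h, z).
     (g, - weak_deriv l (weak_deriv l (moment l a1 b1 f g)), z, weak_deriv l (tension l a2 b2 h z)))"

definition B_op :: "real \<Rightarrow> real \<Rightarrow> real \<Rightarrow> real \<Rightarrow> real \<Rightarrow> state \<Rightarrow> real \<times> real"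
  where "B_op l a1 a2 b1 b2 = (\<lambda>(f, g, h, z).
     (pt_val l (weak_deriv l (moment l a1 b1 f g)) l, pt_val l (tension l a2 b2 h z) l))"

definition graph_norm :: "real \<Rightarrow> real \<Rightarrow> real \<Rightarrow> real \<Rightarrow> real \<Rightarrow> state \<Rightarrow> real"
  where "graph_norm l a1 a2 b1 b2 X =
     state_norm l a1 a2 X + state_norm l a1 a2 (A_op l a1 a2 b1 b2 X)"

definition state_eq :: "real \<Rightarrow> state \<Rightarrow> state \<Rightarrow> bool"
  where "state_eq l = (\<lambda>(f, g, h, z) (f', g', h', z').
     ae_eq l f f' \<and> ae_eq l g g' \<and> ae_eq l h h' \<and> ae_eq l z z')"

definition admissible_init ::
  "real \<Rightarrow> real \<Rightarrow> real \<Rightarrow> real \<Rightarrow> real \<Rightarrow> (real \<Rightarrow> real) \<Rightarrow> (real \<Rightarrow> real) \<Rightarrow> state \<Rightarrow> bool"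
  where "admissible_init l a1 a2 b1 b2 d3 d4 X0 \<longleftrightarrow>
     X0 \<in> A_domain l a1 a2 b1 b2 \<and> B_op l a1 a2 b1 b2 X0 = (d3 0, d4 0)"

text \<open>In the equations, \<open>(w, v, \<phi>, \<psi>)\<close> is the state at time \<open>t\<close> and \<open>(w', v', \<phi>', \<psi>')\<close> its time
  derivative in the state space, so that \<open>v = w\<^sub>t\<close>, \<open>v' = w\<^sub>t\<^sub>t\<close>, \<open>\<psi> = \<phi>\<^sub>t\<close> and \<open>\<psi>' = \<phi>\<^sub>t\<^sub>t\<close>.\<close>

definition evolution_eqs ::
  "real \<Rightarrow> real \<Rightarrow> real \<Rightarrow> real \<Rightarrow> real \<Rightarrow> real \<Rightarrow> real \<Rightarrow> real \<Rightarrow> real \<Rightarrow> real \<Rightarrow> real \<Rightarrow>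
   (real \<Rightarrow> real) \<Rightarrow> (real \<Rightarrow> real) \<Rightarrow> state \<Rightarrow> state \<Rightarrow> bool"
  where "evolution_eqs l a1 a2 b1 b2 c1 c2 p1 p2 q1 q2 e1 e2 =
    (\<lambda>(w, v, \<phi>, \<psi>) (w', v', \<phi>', \<psi>').
      ae_eq l w' v \<and>
      ae_eq l (\<lambda>y. v' y + weak_deriv l (weak_deriv l (moment l a1 b1 w v)) y)
              (\<lambda>y. c1 * \<phi> y + p1 * \<psi> y + q1 * v y + e1 y) \<and>
      ae_eq l \<phi>' \<psi> \<and>
      ae_eq l (\<lambda>y. \<psi>' y - weak_deriv l (tension l a2 b2 \<phi> \<psi>) y)
              (\<lambda>y. c2 * \<phi> y + p2 * \<psi> y + q2 * v y + e2 y))"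

text \<open>The in-domain disturbances, functions of \<open>(y,t)\<close>, take the time argument first: \<open>d1 t y\<close>.\<close>

definition is_solution ::
  "real \<Rightarrow> real \<Rightarrow> real \<Rightarrow> real \<Rightarrow> real \<Rightarrow> real \<Rightarrow> real \<Rightarrow> real \<Rightarrow> real \<Rightarrow> real \<Rightarrow> real \<Rightarrow>
   (real \<Rightarrow> real \<Rightarrow> real) \<Rightarrow> (real \<Rightarrow> real \<Rightarrow> real) \<Rightarrow> (real \<Rightarrow> real) \<Rightarrow> (real \<Rightarrow> real) \<Rightarrow>
   state \<Rightarrow> (real \<Rightarrow> state) \<Rightarrow> bool"
  where "is_solution l a1 a2 b1 b2 c1 c2 p1 p2 q1 q2 d1 d2 d3 d4 X0 X \<longleftrightarrow>
     C0_curve (graph_norm l a1 a2 b1 b2) (A_domain l a1 a2 b1 b2) X \<and>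
     state_eq l (X 0) X0 \<and>
     (\<exists>X'. C1_curve (state_norm l a1 a2) (state_space l) X X' \<and>
        (\<forall>t\<ge>0. evolution_eqs l a1 a2 b1 b2 c1 c2 p1 p2 q1 q2 (d1 t) (d2 t) (X t) (X' t))) \<and>
     (\<forall>t\<ge>0. B_op l a1 a2 b1 b2 (X t) = (d3 t, d4 t))"

section \<open>Input-to-state stability\<close>

definition class_K :: "(real \<Rightarrow> real) \<Rightarrow> bool"
  where "class_K \<gamma> \<longleftrightarrow> continuous_on {0..} \<gamma> \<and> strict_mono_on {0..} \<gamma> \<and> \<gamma> 0 = 0"

definition class_K_inf :: "(real \<Rightarrow> real) \<Rightarrow> bool"
  where "class_K_inf \<gamma> \<longleftrightarrow> class_K \<gamma> \<and> filterlim \<gamma> at_top at_top"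

definition EISS ::
  "real \<Rightarrow> real \<Rightarrow> real \<Rightarrow> real \<Rightarrow> real \<Rightarrow> real \<Rightarrow> real \<Rightarrow> real \<Rightarrow> real \<Rightarrow> real \<Rightarrow> real \<Rightarrow>
   (real \<Rightarrow> real \<Rightarrow> real) \<Rightarrow> (real \<Rightarrow> real \<Rightarrow> real) \<Rightarrow> (real \<Rightarrow> real) \<Rightarrow> (real \<Rightarrow> real) \<Rightarrow> bool"
  where "EISS l a1 a2 b1 b2 c1 c2 p1 p2 q1 q2 d1 d2 d3 d4 \<longleftrightarrow>
    (\<exists>\<beta> \<kappa> \<gamma>1 \<gamma>2 \<gamma>3 \<gamma>4. class_K_inf \<beta> \<and> \<kappa> > 0 \<and>
       class_K \<gamma>1 \<and> class_K \<gamma>2 \<and> class_K \<gamma>3 \<and> class_K \<gamma>4 \<and>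
       (\<forall>X0 X. admissible_init l a1 a2 b1 b2 d3 d4 X0 \<longrightarrow>
          is_solution l a1 a2 b1 b2 c1 c2 p1 p2 q1 q2 d1 d2 d3 d4 X0 X \<longrightarrow>
          (\<forall>t\<ge>0. state_norm l a1 a2 (X t) \<le>
             \<beta> (state_norm l a1 a2 X0) * exp (- \<kappa> * t)
             + \<gamma>1 (Linf_norm {0<..<t} (\<lambda>s. L2_norm l (d1 s)))
             + \<gamma>2 (Linf_norm {0<..<t} (\<lambda>s. L2_norm l (d2 s)))
             + \<gamma>3 (Linf_norm {0<..<t} d3)
             + \<gamma>4 (Linf_norm {0<..<t} d4))))"

definition EiISS ::
  "real \<Rightarrow> real \<Rightarrow> real \<Rightarrow> real \<Rightarrow> real \<Rightarrow> real \<Rightarrow> real \<Rightarrow> real \<Rightarrow> real \<Rightarrow> real \<Rightarrow> real \<Rightarrow>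
   (real \<Rightarrow> real \<Rightarrow> real) \<Rightarrow> (real \<Rightarrow> real \<Rightarrow> real) \<Rightarrow> (real \<Rightarrow> real) \<Rightarrow> (real \<Rightarrow> real) \<Rightarrow> bool"
  where "EiISS l a1 a2 b1 b2 c1 c2 p1 p2 q1 q2 d1 d2 d3 d4 \<longleftrightarrow>
    (\<exists>\<beta> \<kappa> \<theta>1 \<theta>2 \<theta>3 \<theta>4 \<gamma>1 \<gamma>2 \<gamma>3 \<gamma>4. class_K_inf \<beta> \<and> \<kappa> > 0 \<and>
       class_K_inf \<theta>1 \<and> class_K_inf \<theta>2 \<and> class_K_inf \<theta>3 \<and> class_K_inf \<theta>4 \<and>
       class_K \<gamma>1 \<and> class_K \<gamma>2 \<and> class_K \<gamma>3 \<and> class_K \<gamma>4 \<and>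
       (\<forall>X0 X. admissible_init l a1 a2 b1 b2 d3 d4 X0 \<longrightarrow>
          is_solution l a1 a2 b1 b2 c1 c2 p1 p2 q1 q2 d1 d2 d3 d4 X0 X \<longrightarrow>
          (\<forall>t\<ge>0. state_norm l a1 a2 (X t) \<le>
             \<beta> (state_norm l a1 a2 X0) * exp (- \<kappa> * t)
             + \<theta>1 (LINT s|lebesgue_on {0..t}. \<gamma>1 (L2_norm l (d1 s)))
             + \<theta>2 (LINT s|lebesgue_on {0..t}. \<gamma>2 (L2_norm l (d2 s)))
             + \<theta>3 (LINT s|lebesgue_on {0..t}. \<gamma>3 \<bar>d3 s\<bar>)
             + \<theta>4 (LINT s|lebesgue_on {0..t}. \<gamma>4 \<bar>d4 s\<bar>))))"

end

theory Submission
  imports Defs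
begin

text \<open>
  By du Bois-Reymond, a function with a square integrable weak derivative is a primitive of it, so
  that states, boundary values and integrations by parts become statements about primitives. The energy
  plus the multiplier terms \<open>\<epsilon> \<langle>w, w\<^sub>t\<rangle>\<close> and \<open>\<langle>\<phi>, \<phi>\<^sub>t\<rangle>\<close>, corrected by quadratic terms that absorb the
  products of positions and velocities, is a Lyapunov function \<open>V\<close> equivalent to the squared state norm,
  and hypothesis (iii) makes the dissipation dominate the coupling terms:
  \<open>V' \<le> - \<mu> V + C (\<parallel>d1\<parallel>\<^sup>2 + \<parallel>d2\<parallel>\<^sup>2 + d3\<^sup>2 + d4\<^sup>2)\<close>. Gronwall's lemma then gives both estimates; the square
  roots of the norms of \<open>d3\<close> and \<open>d4\<close> arise from \<open>d3\<^sup>2 \<le> M \<bar>d3\<bar>\<close> for bounded \<open>d3\<close>.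
\<close>

section \<open>Smooth bump functions\<close>

text \<open>A state in the domain has only the combination \<open>a1 w_yy + b1 v_yy\<close> in H^2,
  not its two parts separately (and likewise for the string). Hence derivatives are always moved off
  the whole moment or tension, never off one summand. The damping is of Kelvin-Voigt type: the plain
  energy dissipates only through \<open>w_tyy\<close> and \<open>\<phi>_ty\<close>. By Poincare's
  inequality these control the velocities, but the elastic energy in \<open>w_yy\<close> and
  \<open>\<phi>_y\<close> decays only through the multiplier terms, and each multiplier creates in
  return the square of a velocity and new couplings. The coupling of \<open>\<phi>\<close> with
  \<open>w_t\<close> is not the time derivative of a quadratic term, so no correction of the
  functional removes it; it has to be bounded by \<open>w_tyy\<close> and \<open>\<phi>_y\<close>.
  The functional analysis is lengthy because weak derivatives and point values are picked by choice
  operators: each has to be shown independent of the choice, up to null sets or on [0,l]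
  respectively, before it can be computed with.\<close>

definition smooth :: "(real \<Rightarrow> real) \<Rightarrow> bool"
  where "smooth f \<longleftrightarrow> (\<forall>n x. (deriv ^^ n) f field_differentiable at x)"

text \<open>Iterating \<open>deriv\<close> never leaves a set that contains a derivative of each of
  its members. Smoothness thus reduces to exhibiting such a set, without any formula for n-th
  derivatives.\<close>

lemma smooth_coinduct:
  assumes "f \<in> S" and step: "\<And>f x. f \<in> S \<Longrightarrow> \<exists>f' \<in> S. \<forall>x. (f has_real_derivative f' x) (at x)"
  shows "smooth f"
proof -
  have der: "deriv f \<in> S \<and> (\<forall>x. (f has_real_derivative deriv f x) (at x))" if f: "f \<in> S" for f
  proof -
    obtain f' where f': "f' \<in> S" "\<And>x. (f has_real_derivative f' x) (at x)"
      using step f by blast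
    then have "deriv f = f'"
      by (auto simp: fun_eq_iff intro: DERIV_imp_deriv)
    with f' show ?thesis by simp
  qed
  have "(deriv ^^ n) f \<in> S" for n
    by (induction n) (use \<open>f \<in> S\<close> der in auto)
  then show ?thesis
    unfolding smooth_def field_differentiable_def using der by blast
qed

lemma smooth_DERIV: "smooth f \<Longrightarrow> (f has_real_derivative deriv f x) (at x)"
  unfolding smooth_def by (metis DERIV_deriv_iff_field_differentiable funpow_0)

lemma smooth_deriv: "smooth f \<Longrightarrow> smooth (deriv f)"
  unfolding smooth_def by (metis comp_apply funpow_Suc_right)

lemma smooth_continuous: "smooth f \<Longrightarrow> continuous_on A f"
  by (meson DERIV_isCont continuous_at_imp_continuous_on smooth_DERIV)

lemma smooth_antideriv:
  assumes "smooth g" "\<And>x. (f has_real_derivative g x) (at x)"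
  shows "smooth f"
  by (rule smooth_coinduct[of f "insert f (Collect smooth)"])
     (use assms smooth_DERIV smooth_deriv in \<open>auto, blast+\<close>)

lemma smooth_const: "smooth (\<lambda>_. c)"
  by (rule smooth_coinduct[of _ "range (\<lambda>c _. c)"]) (auto intro!: derivative_eq_intros)

text \<open>The closed class carries a constant factor \<open>c\<close>, because each use of the
  chain rule produces one more factor \<open>a\<close>.\<close>

lemma smooth_affine: "smooth f \<Longrightarrow> smooth (\<lambda>x. f (a * x + b))"
proof (rule smooth_coinduct[of _ "{\<lambda>x. c * f (a * x + b) | f c. smooth f}"])
  fix g assume "g \<in> {\<lambda>x. c * f (a * x + b) | f c. smooth f}"
  then obtain f c where g: "g = (\<lambda>x. c * f (a * x + b))" and f: "smooth f" by blast
  have "(g has_real_derivative c * a * deriv f (a * x + b)) (at x)" for x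
    unfolding g
    by (rule derivative_eq_intros DERIV_chain'[OF _ smooth_DERIV[OF f]] | simp)+
  then show "\<exists>f'\<in>{\<lambda>x. c * f (a * x + b) | f c. smooth f}. \<forall>x. (g has_real_derivative f' x) (at x)"
    using smooth_deriv[OF f] by (intro bexI[of _ "\<lambda>x. c * a * deriv f (a * x + b)"]) auto
next
  assume "smooth f"
  then show "(\<lambda>x. f (a * x + b)) \<in> {\<lambda>x. c * f (a * x + b) | f c. smooth f}"
    by (auto intro!: exI[of _ 1] exI[of _ f])
qed

text \<open>Products alone are not closed under differentiation, but Leibniz' rule turns a product
  into a sum of two products, so finite sums of products are.\<close>

inductive_set smooth_sums :: "(real \<Rightarrow> real) set" where
  prod: "smooth f \<Longrightarrow> smooth g \<Longrightarrow> (\<lambda>x. f x * g x) \<in> smooth_sums"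
| sum: "f \<in> smooth_sums \<Longrightarrow> g \<in> smooth_sums \<Longrightarrow> (\<lambda>x. f x + g x) \<in> smooth_sums"

lemma smooth_sums_smooth: "f \<in> smooth_sums \<Longrightarrow> smooth f"
proof (erule smooth_coinduct)
  fix f :: "real \<Rightarrow> real" assume "f \<in> smooth_sums"
  then show "\<exists>f'\<in>smooth_sums. \<forall>x. (f has_real_derivative f' x) (at x)"
  proof induction
    case (prod f g)
    then show ?case
      by (intro bexI[of _ "\<lambda>x. deriv f x * g x + deriv g x * f x"] allI DERIV_mult smooth_DERIV
            smooth_sums.intros smooth_deriv)
  next
    case (sum f g)
    then obtain f' g' where "f' \<in> smooth_sums" "\<And>x. (f has_real_derivative f' x) (at x)"
       "g' \<in> smooth_sums" "\<And>x. (g has_real_derivative g' x) (at x)" by blast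
    then show ?case
      by (intro bexI[of _ "\<lambda>x. f' x + g' x"] allI DERIV_add smooth_sums.intros)
  qed
qed

lemma smooth_mult: "smooth f \<Longrightarrow> smooth g \<Longrightarrow> smooth (\<lambda>x. f x * g x)"
  by (rule smooth_sums_smooth[OF smooth_sums.prod])

lemma smooth_add: "smooth f \<Longrightarrow> smooth g \<Longrightarrow> smooth (\<lambda>x. f x + g x)"
proof -
  assume "smooth f" "smooth g"
  \<comment> \<open>The factors 1 put both summands into the form of products.\<close>
  then have "smooth (\<lambda>x. f x * 1 + g x * 1)"
    by (intro smooth_sums_smooth[OF smooth_sums.sum] smooth_sums.prod smooth_const)
  then show ?thesis by simp
qed

section \<open>The flat exponential and the bumps built from it\<close>

definition flat_exp :: "real \<Rightarrow> real"
  where "flat_exp x = (if x > 0 then exp (- (1 / x)) else 0)"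

text \<open>Under \<open>u = 1 / x\<close> this is the fact that the exponential beats every
  polynomial at infinity. It supplies the limits of difference quotients at 0.\<close>

lemma flat_exp_poly_tendsto:
  "((\<lambda>x. poly p (1 / x) * exp (- (1 / x))) \<longlongrightarrow> 0) (at_right (0::real))"
proof -
  have "((\<lambda>u. poly p u * exp (- u)) \<longlongrightarrow> 0) (at_top :: real filter)"
  proof -
    have "((\<lambda>u. \<Sum>i\<le>degree p. coeff p i * (u ^ i / exp u)) \<longlongrightarrow> (\<Sum>i\<le>degree p. coeff p i * 0)) (at_top :: real filter)"
      by (intro tendsto_intros tendsto_power_div_exp_0)
    then show ?thesis
      by (simp add: poly_altdef exp_minus divide_inverse sum_distrib_right mult.assoc)
  qed
  then show ?thesis
    by (rule filterlim_compose[of _ _ _ "\<lambda>x. 1 / x"])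
       (simp add: filterlim_inverse_at_top_right flip: inverse_eq_divide)
qed

text \<open>The functions that are \<open>poly p (1 / x) * exp (- (1 / x))\<close> on the positive
  half-line and 0 elsewhere form a family closed under differentiation, at the origin too.\<close>

lemma smooth_flat_exp: "smooth flat_exp"
proof (rule smooth_coinduct)
  let ?S = "range (\<lambda>(p::real poly) x. if x > 0 then poly p (1 / x) * exp (- (1 / x)) else 0)"
  show "flat_exp \<in> ?S"
    by (auto simp: flat_exp_def fun_eq_iff intro!: image_eqI[of _ _ "[:1:]"])
  fix f assume "f \<in> ?S"
  then obtain p :: "real poly"
    where f: "f = (\<lambda>x. if x > 0 then poly p (1 / x) * exp (- (1 / x)) else 0)" by blast
  \<comment> \<open>For \<open>u = 1 / x\<close> the derivative of \<open>u\<close> is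
    \<open>- u^2\<close>, so that of \<open>poly p u * exp (- u)\<close> is
    \<open>u^2 * (poly p u - poly (pderiv p) u) * exp (- u)\<close>.\<close>
  define q where "q = [:0, 0, 1:] * (p - pderiv p)"
  let ?g = "\<lambda>x::real. if x > 0 then poly q (1 / x) * exp (- (1 / x)) else 0"
  have "(f has_real_derivative ?g x) (at x)" for x
  proof -
    consider "x > 0" | "x < 0" | "x = 0" by linarith
    then show ?thesis
    proof cases
      case 1
      have "((\<lambda>x. poly p (1 / x) * exp (- (1 / x))) has_real_derivative ?g x) (at x)"
        using 1 by (auto intro!: derivative_eq_intros DERIV_chain'[OF _ poly_DERIV]
            simp: q_def field_simps power2_eq_square)
      then show ?thesis
        by (rule has_field_derivative_transform_within_open[of _ _ _ "{0<..}"]) (use 1 f in auto)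
    next
      case 2
      have "((\<lambda>x. 0) has_real_derivative ?g x) (at x)"
        using 2 by simp
      then show ?thesis
        by (rule has_field_derivative_transform_within_open[of _ _ _ "{..<0}"]) (use 2 f in auto)
    next
      case 3
      have "((\<lambda>y. (f y - f 0) / (y - 0)) \<longlongrightarrow> 0) (at 0)"
      proof (rule filterlim_split_at)
        show "((\<lambda>y. (f y - f 0) / (y - 0)) \<longlongrightarrow> 0) (at_left 0)"
          by (rule tendsto_eventually)
             (auto simp: f eventually_at_filter)
        \<comment> \<open>Dividing by \<open>y\<close> is one more factor \<open>1 / y\<close>, that
          is, one more factor \<open>[:0,1:]\<close> in the polynomial.\<close>
        have "eventually (\<lambda>y. poly ([:0,1:] * p) (1 / y) * exp (- (1 / y)) = (f y - f 0) / (y - 0)) (at_right 0)"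
          by (auto simp: f eventually_at_filter)
        with flat_exp_poly_tendsto[of "[:0,1:] * p"]
        show "((\<lambda>y. (f y - f 0) / (y - 0)) \<longlongrightarrow> 0) (at_right 0)"
          by (rule Lim_transform_eventually)
      qed
      then show ?thesis
        using 3 by (simp add: has_field_derivative_iff f)
    qed
  qed
  then show "\<exists>f'\<in>?S. \<forall>x. (f has_real_derivative f' x) (at x)"
    by (intro bexI[of _ ?g]) auto
qed

text \<open>The factor \<open>n\<close> steepens the flanks but does not move the support: the bumps
  lie between 0 and 1, vanish off one fixed interval and tend pointwise to its indicator, as
  dominated convergence requires. For \<open>n = 0\<close> the function is identically 0.\<close>

definition bump :: "real \<Rightarrow> real \<Rightarrow> nat \<Rightarrow> real \<Rightarrow> real"
  where "bump a b n x = flat_exp (n * (x - a)) * flat_exp (n * (b - x))"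

lemma flat_exp_bounds: "0 \<le> flat_exp x" "flat_exp x \<le> 1"
  by (auto simp: flat_exp_def)

lemma bump_bounds: "0 \<le> bump a b n x" "bump a b n x \<le> 1"
  using flat_exp_bounds by (auto simp: bump_def intro: mult_le_one)

lemma bump_outside: "x \<notin> {a<..<b} \<Longrightarrow> bump a b n x = 0"
  by (auto simp: bump_def flat_exp_def zero_less_mult_iff)

lemma bump_pos: "x \<in> {a<..<b} \<Longrightarrow> n > 0 \<Longrightarrow> bump a b n x > 0"
  by (auto simp: bump_def flat_exp_def)

lemma bump_tendsto: "(\<lambda>n. bump a b n x) \<longlonglongrightarrow> indicator {a<..<b} x"
proof (cases "x \<in> {a<..<b}")
  case True
  have *: "(\<lambda>n. flat_exp (real n * c)) \<longlonglongrightarrow> 1" if "c > 0" for c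
  proof -
    have "(\<lambda>n. exp (- (1 / c / real n))) \<longlonglongrightarrow> exp (- 0)"
      by (intro tendsto_intros lim_const_over_n)
    moreover have "\<forall>\<^sub>F n in sequentially. exp (- (1 / c / real n)) = flat_exp (real n * c)"
      using eventually_gt_at_top[of 0] by eventually_elim (use that in \<open>simp add: flat_exp_def mult.commute\<close>)
    ultimately show ?thesis
      by (simp add: Lim_transform_eventually)
  qed
  have "(\<lambda>n. bump a b n x) \<longlonglongrightarrow> 1 * 1"
    unfolding bump_def by (intro tendsto_mult *) (use True in auto)
  then show ?thesis using True by simp
qed (simp add: bump_outside)

lemma smooth_bump: "smooth (bump a b n)"
proof -
  have "bump a b n = (\<lambda>x. flat_exp (real n * x + (- real n * a)) * flat_exp (- real n * x + real n * b))"
    by (simp add: fun_eq_iff bump_def algebra_simps)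
  then show ?thesis
    by (simp only:) (intro smooth_mult smooth_affine smooth_flat_exp)
qed

section \<open>Test functions and their antiderivatives\<close>

lemma test_functionI:
  assumes "smooth \<phi>" "0 < a" "b < l" "\<And>x. x \<notin> {a..b} \<Longrightarrow> \<phi> x = 0"
  shows "test_function l \<phi>"
proof -
  have "closure {x. \<phi> x \<noteq> 0} \<subseteq> {a..b}"
    by (rule closure_minimal) (use assms(4) in \<open>force+\<close>)
  then show ?thesis
    using assms by (auto simp: test_function_def smooth_def)
qed

lemma test_function_smooth: "test_function l \<phi> \<Longrightarrow> smooth \<phi>"
  by (simp add: test_function_def smooth_def)

lemma test_function_support:
  assumes "test_function l \<phi>" "l > 0"
  obtains a b where "0 < a" "a < b" "b < l" "\<And>x. x \<notin> {a..b} \<Longrightarrow> \<phi> x = 0"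
proof -
  let ?K = "closure {x. \<phi> x \<noteq> 0}"
  have K: "?K \<subseteq> {0<..<l}" using assms by (simp add: test_function_def)
  have "bounded {x. \<phi> x \<noteq> 0}"
    by (rule bounded_subset[OF bounded_closed_interval])
       (rule order_trans[OF closure_subset order_trans[OF K greaterThanLessThan_subseteq_atLeastAtMost_iff[THEN iffD2, of _ _ 0 l]]], simp)
  then have c: "compact ?K" by simp
  \<comment> \<open>The two extra points make the set non-empty and force \<open>a < b\<close>, even
    if the function is identically zero.\<close>
  define K' where "K' = insert (l/3) (insert (l/2) ?K)"
  have "compact K'" unfolding K'_def by (intro compact_insert c)
  moreover have "K' \<noteq> {}" by (simp add: K'_def)
  ultimately obtain a b where ab: "a \<in> K'" "\<And>x. x \<in> K' \<Longrightarrow> a \<le> x" "b \<in> K'" "\<And>x. x \<in> K' \<Longrightarrow> x \<le> b"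
    by (metis compact_attains_inf compact_attains_sup)
  have "K' \<subseteq> {0<..<l}" using K assms(2) by (auto simp: K'_def)
  then have "0 < a" "b < l" using ab(1,3) by auto
  moreover have "a \<le> l/3" by (rule ab) (simp add: K'_def)
  moreover have "l/2 \<le> b" by (rule ab) (simp add: K'_def)
  moreover have "\<phi> x = 0" if "x \<notin> {a..b}" for x
    using that ab(2,4) closure_subset[of "{x. \<phi> x \<noteq> 0}"] by (auto simp: K'_def)
  ultimately show ?thesis using assms(2) by (intro that[of a b]) auto
qed

lemma test_function_bump: "0 < a \<Longrightarrow> b < l \<Longrightarrow> test_function l (bump a b n)"
  by (rule test_functionI[OF smooth_bump, of a b]) (auto intro!: bump_outside)

text \<open>The antiderivative that vanishes at 0 is constant on either side of the support of
  \<open>\<theta>\<close>. On the left this constant is 0, and on the right it is the integral of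
  \<open>\<theta>\<close>, again 0; so the support stays compact.\<close>

lemma test_function_antideriv:
  assumes "test_function l \<theta>" "l > 0" "integral {0..l} \<theta> = 0"
  obtains \<phi> where "test_function l \<phi>" "deriv \<phi> = \<theta>"
proof -
  obtain a b where ab: "0 < a" "a < b" "b < l" "\<And>x. x \<notin> {a..b} \<Longrightarrow> \<theta> x = 0"
    using test_function_support[OF assms(1,2)] by blast
  have sm: "smooth \<theta>" using assms(1) by (rule test_function_smooth)
  have "\<exists>F. \<forall>x :: real. -\<infinity> < ereal x \<longrightarrow> ereal x < \<infinity> \<longrightarrow> (F has_vector_derivative \<theta> x) (at x)"
    by (rule einterval_antiderivative) (auto intro: DERIV_isCont smooth_DERIV sm)
  then obtain F where F: "\<And>x. (F has_real_derivative \<theta> x) (at x)"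
    by (auto simp: has_real_derivative_iff_has_vector_derivative)
  define \<phi> where "\<phi> x = F x - F 0" for x
  have \<phi>: "(\<phi> has_real_derivative \<theta> x) (at x)" for x
    unfolding \<phi>_def[abs_def] using F by (auto intro!: derivative_eq_intros)
  have ftc: "(\<theta> has_integral (\<phi> y - \<phi> x)) {x..y}" if "x \<le> y" for x y
    by (rule fundamental_theorem_of_calculus[OF that])
       (use \<phi> in \<open>auto simp: has_real_derivative_iff_has_vector_derivative has_vector_derivative_at_within\<close>)
  have flat: "\<phi> y = \<phi> x" if "x \<le> y" "{x<..<y} \<inter> {a..b} = {}" for x y
  proof (cases "x = y")
    case False
    then have "x < y" using that by simp
    then show ?thesis
      by (rule DERIV_isconst_end[of x y \<phi>])
         (use \<phi> that ab(4) in \<open>auto intro!: DERIV_continuous_on[of _ \<phi> \<theta>] simp: has_field_derivative_at_within\<close>,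
          metis Int_iff \<phi> ab(4) empty_iff greaterThanLessThan_iff)
  qed simp
  have "\<phi> l = 0"
    using integral_unique[OF ftc[of 0 l]] assms by (simp add: \<phi>_def)
  have "\<phi> x = 0" if x: "x \<notin> {a..b}" for x
  proof (cases "x < a")
    case True
    then show ?thesis
      using flat[of x 0] flat[of 0 x] ab(1-3) by (cases "x \<le> 0") (auto simp: \<phi>_def disjoint_iff)
  next
    case False
    then have "x > b" using x by auto
    then show ?thesis
      using flat[of x l] flat[of l x] ab(1-3) \<open>\<phi> l = 0\<close> by (cases "x \<le> l") (auto simp: disjoint_iff)
  qed
  then have "test_function l \<phi>"
    using ab by (intro test_functionI[OF smooth_antideriv[OF sm \<phi>], of a b]) auto
  moreover have "deriv \<phi> = \<theta>" using \<phi> by (auto simp: fun_eq_iff intro: DERIV_imp_deriv)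
  ultimately show ?thesis using that by blast
qed

section \<open>Weak derivatives and primitives\<close>

lemma finite_measure_interval: "finite_measure (lebesgue_on {0<..<l::real})"
  by (rule finite_measureI) (cases "0 \<le> l"; simp add: space_restrict_space emeasure_restrict_space)

lemma measure_interval: "0 \<le> l \<Longrightarrow> measure (lebesgue_on {0<..<l::real}) (space (lebesgue_on {0<..<l})) = l"
  by (simp add: measure_restrict_space space_restrict_space)

lemma borel_measurable_lebesgue_on: "f \<in> borel_measurable borel \<Longrightarrow> f \<in> borel_measurable (lebesgue_on S)"
  by (intro measurable_restrict_space1 measurable_completion) simp

lemma borel_set_lebesgue_on:
  assumes "A \<in> sets borel" shows "{x \<in> space (lebesgue_on S). x \<in> A} \<in> sets (lebesgue_on S)"
proof -
  have "(\<lambda>x. x) \<in> measurable (lebesgue_on S) borel"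
    by (rule borel_measurable_lebesgue_on) simp
  from measurable_sets[OF this assms] show ?thesis
    by (simp add: vimage_def Int_def conj_commute)
qed

text \<open>Open intervals are stable under intersection and generate the Borel sets, so the
  integral of \<open>h\<close> vanishes over every Borel set, and then over every Lebesgue set,
  which differs from a Borel set by a null set. The bounded support of \<open>h\<close> makes the
  integral over the whole line one of the given integrals; this starts the step to
  complements.\<close>

lemma AE_zero_of_interval_integrals:
  fixes h :: "real \<Rightarrow> real"
  assumes h: "integrable lebesgue h" and out: "\<And>x. x \<notin> {a<..<b} \<Longrightarrow> h x = 0"
    and zero: "\<And>c d. set_lebesgue_integral lebesgue {c<..<d} h = 0"
  shows "AE x in lebesgue. h x = 0"
proof (rule sigma_finite_measure.density_zero[OF _ h])
  have si: "set_integrable lebesgue A h" if "A \<in> sets lebesgue" for A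
    using integrable_mult_indicator[OF that h] by (simp add: set_integrable_def)
  have "integral\<^sup>L lebesgue h = set_lebesgue_integral lebesgue {a<..<b} h"
    unfolding set_lebesgue_integral_def by (rule Bochner_Integration.integral_cong) (use out in \<open>auto simp: indicator_def\<close>)
  then have total: "integral\<^sup>L lebesgue h = 0" using zero by simp
  let ?G = "range (\<lambda>(a::real, b). {a<..<b})"
  have sig: "sigma_sets UNIV ?G = sets borel"
    unfolding borel_eq_box by (simp add: sets_measure_of_conv box_real case_prod_unfold)
  have borel_zero: "set_lebesgue_integral lebesgue A h = 0" if "A \<in> sets borel" for A
  proof -
    have "Int_stable ?G"
    proof (rule Int_stableI)
      fix A B assume "A \<in> ?G" "B \<in> ?G"
      then obtain a b c d where "A = {a<..<b}" "B = {c<..<d}" by auto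
      then have "A \<inter> B = {max a c<..<min b d}" by auto
      then show "A \<inter> B \<in> ?G" by auto
    qed
    moreover have "?G \<subseteq> Pow UNIV" by simp
    moreover have "A \<in> sigma_sets UNIV ?G"
      using that sig by simp
    ultimately show ?thesis
    proof (induction rule: sigma_sets_induct_disjoint)
      case (basic A) then show ?case using zero by auto
    next
      case empty then show ?case by (simp add: set_lebesgue_integral_def)
    next
      case (compl A)
      have A: "A \<in> sets lebesgue"
        using compl.hyps unfolding sig by simp
      have "set_lebesgue_integral lebesgue (UNIV - A) h =
          integral\<^sup>L lebesgue (\<lambda>x. h x - indicator A x *\<^sub>R h x)"
        unfolding set_lebesgue_integral_def
        by (rule Bochner_Integration.integral_cong) (auto simp: indicator_def)
      also have "\<dots> = 0"
        using h si[OF A] total compl.IH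
        by (subst Bochner_Integration.integral_diff) (auto simp: set_integrable_def set_lebesgue_integral_def)
      finally show ?case .
    next
      case (union A)
      have A: "A i \<in> sets lebesgue" for i
        using union.hyps(2) unfolding sig by auto
      have "set_lebesgue_integral lebesgue (\<Union>i. A i) h = (\<Sum>i. set_lebesgue_integral lebesgue (A i) h)"
        by (rule lebesgue_integral_countable_add[OF A])
           (use A union.hyps(1) in \<open>auto intro!: si simp: disjoint_family_on_def\<close>)
      then show ?case using union.IH by simp
    qed
  qed
  show "sigma_finite_measure (lebesgue :: real measure)"
  proof
    let ?B = "range (\<lambda>n::nat. {- real n..real n})"
    have "\<Union>?B = UNIV"
    proof (intro equalityI subsetI)
      fix x :: real
      obtain n :: nat where "\<bar>x\<bar> \<le> n" using real_arch_simple by blast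
      then show "x \<in> \<Union>?B" by (auto intro!: exI[of _ n])
    qed simp
    then show "\<exists>B. countable B \<and> B \<subseteq> sets lebesgue \<and> \<Union>B = space lebesgue \<and>
        (\<forall>b\<in>B. emeasure lebesgue (b :: real set) \<noteq> \<infinity>)"
      by (intro exI[of _ ?B]) auto
  qed
  fix A :: "real set" assume "A \<in> sets lebesgue"
  then obtain S N N' where A: "A = S \<union> N" "N \<subseteq> N'" "N' \<in> null_sets lborel" "S \<in> sets lborel"
    by (rule sets_completionE)
  have "AE x in lebesgue. x \<notin> N'"
    by (rule AE_not_in) (use A(3) null_sets_completionI in blast)
  then have "AE x in lebesgue. indicator A x *\<^sub>R h x = indicator S x *\<^sub>R h x"
    by eventually_elim (use A in \<open>auto simp: indicator_def\<close>)
  then have "set_lebesgue_integral lebesgue A h = set_lebesgue_integral lebesgue S h"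
    unfolding set_lebesgue_integral_def
    by (intro integral_cong_AE borel_measurable_integrable si[unfolded set_integrable_def])
       (use \<open>A \<in> sets lebesgue\<close> A(4) in simp_all)
  then show "set_lebesgue_integral lebesgue A h = 0" using borel_zero A(4) by simp
qed

lemma integrable_lebesgue_on_iff:
  fixes f :: "real \<Rightarrow> real"
  shows "S \<in> sets lebesgue \<Longrightarrow> integrable (lebesgue_on S) f \<longleftrightarrow> integrable lebesgue (\<lambda>x. indicator S x * f x)"
  using integrable_restrict_space[of S lebesgue f] by simp

lemma lint_lebesgue_on:
  fixes f :: "real \<Rightarrow> real"
  shows "S \<in> sets lebesgue \<Longrightarrow> (LINT x|lebesgue_on S. f x) = (LINT x|lebesgue. indicator S x * f x)"
  using integral_restrict_space[of S lebesgue f] by simp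

text \<open>Near the endpoints 0 and \<open>l\<close> the function \<open>f\<close> may fail to be
  integrable. The test function is confined to a compact subinterval, on which it is bounded and
  \<open>f\<close> is integrable.\<close>

lemma integrable_mult_test_function:
  assumes "locally_integrable l f" "test_function l \<phi>" "l > 0"
  shows "integrable (lebesgue_on {0<..<l}) (\<lambda>y. f y * \<phi> y)"
proof -
  obtain a b where ab: "0 < a" "a < b" "b < l" "\<And>x. x \<notin> {a..b} \<Longrightarrow> \<phi> x = 0"
    using test_function_support[OF assms(2,3)] by blast
  have cont: "continuous_on A \<phi>" for A
    using assms(2) by (intro smooth_continuous test_function_smooth)
  have "compact (\<phi> ` {a..b})" by (intro compact_continuous_image cont) simp
  then obtain B where B: "\<And>x. x \<in> {a..b} \<Longrightarrow> \<bar>\<phi> x\<bar> \<le> B"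
    using compact_imp_bounded bounded_real by (metis (no_types, lifting) imageI)
  have int: "integrable lebesgue (\<lambda>x. indicator {a..b} x * f x)"
    using assms(1) ab by (simp add: locally_integrable_def integrable_lebesgue_on_iff)
  have m: "\<phi> \<in> borel_measurable lebesgue"
    using borel_measurable_continuous_onI[OF cont] by (simp add: measurable_completion)
  have "integrable lebesgue (\<lambda>x. (indicator {a..b} x * f x) * \<phi> x)"
  proof (rule Bochner_Integration.integrable_bound)
    show "integrable lebesgue (\<lambda>x. B * (indicator {a..b} x * f x))" using int by simp
    show "AE x in lebesgue. norm ((indicator {a..b} x * f x) * \<phi> x) \<le> norm (B * (indicator {a..b} x * f x))"
    proof (rule AE_I2)
      fix x
      show "norm ((indicator {a..b} x * f x) * \<phi> x) \<le> norm (B * (indicator {a..b} x * f x))"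
        using order_trans[OF B[of x] abs_ge_self]
        by (cases "x \<in> {a..b}") (simp_all add: abs_mult mult.commute mult_right_mono)
    qed
  qed (use borel_measurable_integrable[OF int] m in measurable)
  also have "(\<lambda>x. (indicator {a..b} x * f x) * \<phi> x) = (\<lambda>x. indicator {0<..<l} x * (f x * \<phi> x))"
    using ab by (force simp: fun_eq_iff indicator_def)
  finally show ?thesis by (simp add: integrable_lebesgue_on_iff)
qed

text \<open>Bumps converge boundedly to indicators, so testing with them shows that \<open>g\<close>
  has integral 0 over every open interval well inside (0,l).\<close>

lemma AE_zero_of_test_integrals:
  assumes g: "locally_integrable l g" and "l > 0"
    and zero: "\<And>\<phi>. test_function l \<phi> \<Longrightarrow> (LINT y|lebesgue_on {0<..<l}. g y * \<phi> y) = 0"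
  shows "AE y in lebesgue_on {0<..<l}. g y = 0"
proof -
  have inner: "AE x in lebesgue. x \<in> {a<..<b} \<longrightarrow> g x = 0" if ab: "0 < a" "b < l" for a b
  proof -
    define h where "h x = indicator {a<..<b} x * g x" for x
    have gint: "integrable lebesgue (\<lambda>x. indicator {a..b} x * g x)"
      using g ab by (simp add: locally_integrable_def integrable_lebesgue_on_iff)
    have "integrable lebesgue (\<lambda>x. indicator {a<..<b} x *\<^sub>R (indicator {a..b} x * g x))"
      by (rule integrable_mult_indicator[OF _ gint]) simp
    also have "(\<lambda>x. indicator {a<..<b} x *\<^sub>R (indicator {a..b} x * g x)) = h"
      by (auto simp: fun_eq_iff h_def indicator_def)
    finally have hint: "integrable lebesgue h" .
    have "AE x in lebesgue. h x = 0"
    proof (rule AE_zero_of_interval_integrals[OF hint])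
      show "h x = 0" if "x \<notin> {a<..<b}" for x using that by (simp add: h_def)
      fix c d
      \<comment> \<open>Cutting the given interval down to the inside of \<open>(a, b)\<close> makes
        its bumps admissible as test functions.\<close>
      let ?a = "max a c" and ?b = "min b d"
      have "(\<lambda>n. LINT y|lebesgue. (indicator {a..b} y * g y) * bump ?a ?b n y) \<longlonglongrightarrow>
            (LINT y|lebesgue. (indicator {a..b} y * g y) * indicator {?a<..<?b} y)"
      proof (rule integral_dominated_convergence)
        have "bump ?a ?b n \<in> borel_measurable lebesgue" for n
          using borel_measurable_continuous_onI[OF smooth_continuous[OF smooth_bump]]
          by (simp add: measurable_completion)
        then show "(\<lambda>y. (indicator {a..b} y * g y) * bump ?a ?b n y) \<in> borel_measurable lebesgue" for n
          using borel_measurable_integrable[OF gint] by measurable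
        show "(\<lambda>y. (indicator {a..b} y * g y) * indicator {?a<..<?b} y) \<in> borel_measurable lebesgue"
          by (intro borel_measurable_times borel_measurable_integrable[OF gint] borel_measurable_indicator) simp
        show "integrable lebesgue (\<lambda>y. \<bar>indicator {a..b} y * g y\<bar>)" using gint by simp
        show "AE y in lebesgue. (\<lambda>n. (indicator {a..b} y * g y) * bump ?a ?b n y)
            \<longlonglongrightarrow> (indicator {a..b} y * g y) * indicator {?a<..<?b} y"
          by (intro AE_I2 tendsto_intros bump_tendsto)
        show "AE y in lebesgue. norm ((indicator {a..b} y * g y) * bump ?a ?b n y) \<le> \<bar>indicator {a..b} y * g y\<bar>" for n
          using bump_bounds[of ?a ?b n] by (intro AE_I2) (simp add: abs_mult mult_left_le)
      qed
      moreover have "(LINT y|lebesgue. (indicator {a..b} y * g y) * bump ?a ?b n y) = 0" for n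
      proof -
        have "(\<lambda>y. (indicator {a..b} y * g y) * bump ?a ?b n y) = (\<lambda>y. indicator {0<..<l} y * (g y * bump ?a ?b n y))"
        proof
          fix y
          show "(indicator {a..b} y * g y) * bump ?a ?b n y = indicator {0<..<l} y * (g y * bump ?a ?b n y)"
            using ab by (cases "y \<in> {?a<..<?b}") (auto simp: bump_outside)
        qed
        then show ?thesis
          using zero[of "bump ?a ?b n"] ab by (simp add: lint_lebesgue_on test_function_bump)
      qed
      ultimately have "(LINT y|lebesgue. (indicator {a..b} y * g y) * indicator {?a<..<?b} y) = 0"
        by (simp add: LIMSEQ_const_iff)
      moreover have "(\<lambda>y. (indicator {a..b} y * g y) * indicator {?a<..<?b} y) = (\<lambda>y. indicator {c<..<d} y *\<^sub>R h y)"
        by (auto simp: fun_eq_iff indicator_def h_def)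
      ultimately show "set_lebesgue_integral lebesgue {c<..<d} h = 0"
        by (simp add: set_lebesgue_integral_def)
    qed
    then show ?thesis by eventually_elim (auto simp: h_def)
  qed
  \<comment> \<open>Countably many subintervals exhaust (0,l), so their exceptional null sets can be
    united.\<close>
  have "AE x in lebesgue. \<forall>n::nat. x \<in> {1 / Suc n<..<l - 1 / Suc n} \<longrightarrow> g x = 0"
    unfolding AE_all_countable by (intro allI inner) simp_all
  then have "AE x in lebesgue. x \<in> {0<..<l} \<longrightarrow> g x = 0"
  proof eventually_elim
    case (elim x)
    show ?case
    proof
      assume x: "x \<in> {0<..<l}"
      then obtain n where "inverse (real (Suc n)) < min x (l - x)"
        using reals_Archimedean[of "min x (l - x)"] by auto
      then show "g x = 0" using elim[rule_format, of n] by (simp add: inverse_eq_divide)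
    qed
  qed
  then show ?thesis by (simp add: AE_restrict_space_iff)
qed

text \<open>The integral of \<open>g\<close> from 0 to \<open>y\<close>. Expressing the upper limit
  by an indicator keeps the domain of integration fixed, which suits Fubini's theorem; the value is
  0 for \<open>y \<le> 0\<close> and the full integral for \<open>y \<ge> l\<close>.\<close>

definition prim :: "real \<Rightarrow> (real \<Rightarrow> real) \<Rightarrow> real \<Rightarrow> real"
  where "prim l g y = (LINT s|lebesgue_on {0<..<l}. indicator {..<y} s * g s)"

lemma integrable_indicator_mult:
  fixes g :: "real \<Rightarrow> real"
  assumes "integrable (lebesgue_on S) g" "A \<in> sets borel"
  shows "integrable (lebesgue_on S) (\<lambda>s. indicator A s * g s)"
proof -
  have "integrable (lebesgue_on S) (\<lambda>s. indicator {s \<in> space (lebesgue_on S). s \<in> A} s *\<^sub>R g s)"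
    by (rule integrable_mult_indicator[OF borel_set_lebesgue_on assms(1)]) (rule assms)
  then show ?thesis
    by (rule Bochner_Integration.integrable_cong[THEN iffD1, rotated 2]) (auto simp: indicator_def)
qed

lemma prim_0: "prim l g 0 = 0"
  unfolding prim_def by (rule integral_eq_zero_AE) (auto simp: indicator_def space_restrict_space)

lemma prim_l: "prim l g l = (LINT s|lebesgue_on {0<..<l}. g s)"
  unfolding prim_def by (rule Bochner_Integration.integral_cong) (auto simp: space_restrict_space)

lemma prim_cong_AE:
  assumes "AE y in lebesgue_on {0<..<l}. f y = g y"
    "f \<in> borel_measurable (lebesgue_on {0<..<l})" "g \<in> borel_measurable (lebesgue_on {0<..<l})"
  shows "prim l f y = prim l g y"
proof -
  have [measurable]: "{..<y} \<inter> {0<..<l} \<in> sets (lebesgue_on {0<..<l})"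
    using borel_set_lebesgue_on[of "{..<y}" "{0<..<l}"] by (simp add: space_restrict_space Int_def conj_commute)
  have ind: "indicator {..<y} \<in> borel_measurable (lebesgue_on {0<..<l})"
    by (rule borel_measurable_lebesgue_on) simp
  show ?thesis unfolding prim_def
    by (rule integral_cong_AE) (use assms ind in \<open>auto intro: borel_measurable_times\<close>)
qed

lemma prim_linear:
  assumes "integrable (lebesgue_on {0<..<l}) f" "integrable (lebesgue_on {0<..<l}) g"
  shows "prim l (\<lambda>y. \<alpha> * f y + \<beta> * g y) y = \<alpha> * prim l f y + \<beta> * prim l g y"
proof -
  have "prim l (\<lambda>y. \<alpha> * f y + \<beta> * g y) y = (LINT s|lebesgue_on {0<..<l}.
      \<alpha> * (indicator {..<y} s * f s) + \<beta> * (indicator {..<y} s * g s))"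
    unfolding prim_def by (simp add: algebra_simps)
  then show ?thesis unfolding prim_def
    by (simp add: integrable_indicator_mult assms)
qed

lemma prim_diff:
  assumes g: "integrable (lebesgue_on {0<..<l}) g" and "x \<le> y"
  shows "prim l g y - prim l g x = (LINT s|lebesgue_on {0<..<l}. indicator {x..<y} s * g s)"
proof -
  have "prim l g y - prim l g x =
     (LINT s|lebesgue_on {0<..<l}. indicator {..<y} s * g s - indicator {..<x} s * g s)"
    unfolding prim_def by (simp add: integrable_indicator_mult g)
  also have "\<dots> = (LINT s|lebesgue_on {0<..<l}. indicator {x..<y} s * g s)"
    by (rule Bochner_Integration.integral_cong) (use \<open>x \<le> y\<close> in \<open>auto simp: indicator_def\<close>)
  finally show ?thesis .
qed

text \<open>Integration by parts for primitives is Fubini's theorem on the two triangles of the square.\<close>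

lemma prim_by_parts:
  assumes f: "integrable (lebesgue_on {0<..<l}) f" and g: "integrable (lebesgue_on {0<..<l}) g"
  shows "integrable (lebesgue_on {0<..<l}) (\<lambda>y. prim l f y * g y)"
    and "(LINT y|lebesgue_on {0<..<l}. prim l f y * g y) + (LINT y|lebesgue_on {0<..<l}. f y * prim l g y)
       = prim l f l * prim l g l"
proof -
  let ?M = "lebesgue_on {0<..<l}"
  interpret finite_measure ?M by (rule finite_measure_interval)
  interpret pair_sigma_finite ?M ?M ..
  note [measurable] = borel_measurable_integrable[OF f] borel_measurable_integrable[OF g]
  have id [measurable]: "(\<lambda>x. x) \<in> borel_measurable ?M"
    by (rule borel_measurable_lebesgue_on) simp
  have fst_b[measurable]: "fst \<in> borel_measurable (?M \<Otimes>\<^sub>M ?M)" and snd_b[measurable]: "snd \<in> borel_measurable (?M \<Otimes>\<^sub>M ?M)"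
    using measurable_compose[OF measurable_fst id] measurable_compose[OF measurable_snd id] by simp_all
  have fm[measurable]: "(\<lambda>p. f (fst p)) \<in> borel_measurable (?M \<Otimes>\<^sub>M ?M)"
    by (rule measurable_compose[OF measurable_fst]) measurable
  have gm[measurable]: "(\<lambda>p. g (snd p)) \<in> borel_measurable (?M \<Otimes>\<^sub>M ?M)"
    by (rule measurable_compose[OF measurable_snd]) measurable
  have prod: "integrable (?M \<Otimes>\<^sub>M ?M) (\<lambda>p. f (fst p) * g (snd p))"
  proof (rule Fubini_integrable)
    show "integrable ?M (\<lambda>x. LINT y|?M. norm (f (fst (x, y)) * g (snd (x, y))))"
      using f by (simp add: abs_mult)
    show "AE x in ?M. integrable ?M (\<lambda>y. f (fst (x, y)) * g (snd (x, y)))"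
      using g by simp
  qed measurable
  \<comment> \<open>The half \<open>s < y\<close> of the square. Integrating over \<open>s\<close>
    first gives the primitive of \<open>f\<close> at \<open>y\<close>; integrating over
    \<open>y\<close> first gives the increment of the primitive of \<open>g\<close> from
    \<open>s\<close> to \<open>l\<close>.\<close>
  have tri: "integrable (?M \<Otimes>\<^sub>M ?M) (\<lambda>(s, y). indicator {..<y} s * f s * g y)"
  proof (rule Bochner_Integration.integrable_bound[OF prod])
    have "(\<lambda>(s, y). indicator {..<y} s * f s * g y) =
        (\<lambda>p. (if fst p < snd p then 1 else 0) * f (fst p) * g (snd p))"
      by (auto simp: fun_eq_iff indicator_def)
    also have "\<dots> \<in> borel_measurable (?M \<Otimes>\<^sub>M ?M)" by measurable
    finally show "(\<lambda>(s, y). indicator {..<y} s * f s * g y) \<in> borel_measurable (?M \<Otimes>\<^sub>M ?M)" .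
  qed (auto simp: indicator_def)
  have inner: "(LINT s|?M. indicator {..<y} s * f s * g y) = prim l f y * g y" for y
    unfolding prim_def by (subst integral_mult_left_zero[symmetric]) simp
  show "integrable ?M (\<lambda>y. prim l f y * g y)"
    using integrable_snd[OF tri] by (simp only: inner)
  have upper: "(LINT y|?M. indicator {..<y} s * f s * g y) = f s * (prim l g l - prim l g s)" for s
  proof -
    have "(LINT y|?M. indicator {..<y} s * f s * g y) = (LINT y|?M. f s * (g y - indicator {..<s} y * g y))"
    proof (rule integral_cong_AE)
      \<comment> \<open>The two integrands differ at most at the diagonal point
        \<open>y = s\<close>.\<close>
      have "AE y in lebesgue. y \<noteq> s"
        using AE_not_in[of "{s}" lebesgue] by simp
      then have "AE y in ?M. y \<noteq> s" by (auto simp: AE_restrict_space_iff elim: eventually_mono)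
      then show "AE y in ?M. indicator {..<y} s * f s * g y = f s * (g y - indicator {..<s} y * g y)"
        by eventually_elim (auto simp: indicator_def)
      have "(\<lambda>y. indicator {..<y} s * f s * g y) = (\<lambda>y. (if s < y then 1 else 0) * f s * g y)"
        by (auto simp: indicator_def)
      also have "\<dots> \<in> borel_measurable ?M" by measurable
      finally show "(\<lambda>y. indicator {..<y} s * f s * g y) \<in> borel_measurable ?M" .
      show "(\<lambda>y. f s * (g y - indicator {..<s} y * g y)) \<in> borel_measurable ?M"
        by (intro borel_measurable_times borel_measurable_diff borel_measurable_integrable[OF g]
            borel_measurable_integrable[OF integrable_indicator_mult[OF g]] borel_measurable_const) simp
    qed
    then show ?thesis unfolding prim_l by (simp add: integrable_indicator_mult g prim_def)
  qed
  have fg: "integrable ?M (\<lambda>s. f s * (prim l g l - prim l g s))"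
    using integrable_fst[OF tri] by (simp add: upper)
  have fgi: "integrable ?M (\<lambda>s. f s * prim l g s)"
    using Bochner_Integration.integrable_diff[OF integrable_mult_left[OF f, of "prim l g l"] fg]
    by (simp add: algebra_simps)
  have "(LINT y|?M. prim l f y * g y) = (LINT s|?M. f s * (prim l g l - prim l g s))"
    using Fubini_integral[OF tri] by (simp only: inner upper)
  also have "\<dots> = (LINT s|?M. f s * prim l g l - f s * prim l g s)"
    by (simp add: algebra_simps)
  also have "\<dots> = prim l f l * prim l g l - (LINT s|?M. f s * prim l g s)"
    using f fgi by (simp add: prim_l)
  finally show "(LINT y|?M. prim l f y * g y) + (LINT y|?M. f y * prim l g y) = prim l f l * prim l g l"
    by simp
qed

section \<open>The inner product of \<open>L\<^sup>2(0,l)\<close>\<close>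

definition L2_inner :: "real \<Rightarrow> (real \<Rightarrow> real) \<Rightarrow> (real \<Rightarrow> real) \<Rightarrow> real"
  where "L2_inner l f g = (LINT y|lebesgue_on {0<..<l}. f y * g y)"

lemma L2_measurable: "f \<in> L2_space l \<Longrightarrow> f \<in> borel_measurable (lebesgue_on {0<..<l})"
  by (simp add: L2_space_def)

lemma L2_mult_integrable:
  assumes "f \<in> L2_space l" "g \<in> L2_space l"
  shows "integrable (lebesgue_on {0<..<l}) (\<lambda>y. f y * g y)"
proof (rule Bochner_Integration.integrable_bound)
  show "integrable (lebesgue_on {0<..<l}) (\<lambda>y. (f y)\<^sup>2 + (g y)\<^sup>2)"
    using assms by (simp add: L2_space_def)
  have "\<bar>x * y\<bar> \<le> x\<^sup>2 + y\<^sup>2" for x y :: real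
    using sum_squares_bound[of "\<bar>x\<bar>" "\<bar>y\<bar>"] abs_ge_zero[of "x * y"]
    by (simp only: abs_mult mult.assoc power2_abs)
  then show "AE y in lebesgue_on {0<..<l}. norm (f y * g y) \<le> norm ((f y)\<^sup>2 + (g y)\<^sup>2)"
    by (simp add: order_trans[OF _ abs_ge_self])
qed (intro borel_measurable_times L2_measurable assms)

lemma L2_const: "(\<lambda>_. c) \<in> L2_space l"
  using finite_measure.integrable_const[OF finite_measure_interval] by (simp add: L2_space_def)

lemma L2_integrable: "f \<in> L2_space l \<Longrightarrow> integrable (lebesgue_on {0<..<l}) f"
  using L2_mult_integrable[OF _ L2_const[of 1], of f l] by simp

lemma L2_lincomb:
  assumes "f \<in> L2_space l" "g \<in> L2_space l"
  shows "(\<lambda>y. \<alpha> * f y + \<beta> * g y) \<in> L2_space l"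
proof -
  have "integrable (lebesgue_on {0<..<l})
      (\<lambda>y. \<alpha>\<^sup>2 * (f y * f y) + 2 * \<alpha> * \<beta> * (f y * g y) + \<beta>\<^sup>2 * (g y * g y))"
    using assms by (simp add: L2_mult_integrable)
  then have "integrable (lebesgue_on {0<..<l}) (\<lambda>y. (\<alpha> * f y + \<beta> * g y)\<^sup>2)"
    by (simp add: power2_eq_square algebra_simps)
  moreover have "(\<lambda>y. \<alpha> * f y + \<beta> * g y) \<in> borel_measurable (lebesgue_on {0<..<l})"
    using assms[THEN L2_measurable] by measurable
  ultimately show ?thesis by (simp add: L2_space_def)
qed

lemma L2_add: "f \<in> L2_space l \<Longrightarrow> g \<in> L2_space l \<Longrightarrow> (\<lambda>y. f y + g y) \<in> L2_space l"
  using L2_lincomb[of f l g 1 1] by simp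

lemma L2_diff: "f \<in> L2_space l \<Longrightarrow> g \<in> L2_space l \<Longrightarrow> (\<lambda>y. f y - g y) \<in> L2_space l"
  using L2_lincomb[of f l g 1 "-1"] by simp

lemma L2_scale: "f \<in> L2_space l \<Longrightarrow> (\<lambda>y. c * f y) \<in> L2_space l"
  using L2_lincomb[of f l f c 0] by simp

section \<open>Change of representative on null sets\<close>

lemma ae_eq_refl: "ae_eq l f f" by (simp add: ae_eq_def)

lemma ae_eq_sym: "ae_eq l f g \<Longrightarrow> ae_eq l g f"
  unfolding ae_eq_def by (auto elim: eventually_mono)

lemma ae_eq_trans: "ae_eq l f g \<Longrightarrow> ae_eq l g h \<Longrightarrow> ae_eq l f h"
  unfolding ae_eq_def by (elim eventually_rev_mp) (auto elim: eventually_mono)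

lemma ae_eq_lincomb:
  assumes "ae_eq l f f'" "ae_eq l g g'"
  shows "ae_eq l (\<lambda>y. \<alpha> * f y + \<beta> * g y) (\<lambda>y. \<alpha> * f' y + \<beta> * g' y)"
  using assms unfolding ae_eq_def by eventually_elim simp

text \<open>Completeness of Lebesgue measure. It allows membership in \<open>L2_space\<close> and
  local integrability to be transferred to any other representative.\<close>

lemma measurable_ae_eq:
  assumes "AE y in lebesgue_on S. f y = (g y :: real)" "f \<in> borel_measurable (lebesgue_on S)"
    "S \<in> sets lebesgue"
  shows "g \<in> borel_measurable (lebesgue_on S)"
proof -
  have "(\<lambda>y. indicator S y *\<^sub>R f y) \<in> borel_measurable lebesgue"
    using assms(2,3) by (simp add: borel_measurable_restrict_space_iff)
  moreover have "AE y in lebesgue. indicator S y *\<^sub>R f y = indicator S y *\<^sub>R g y"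
    using assms(1,3) by (auto simp: AE_restrict_space_iff indicator_def elim: eventually_mono)
  ultimately have "(\<lambda>y. indicator S y *\<^sub>R g y) \<in> borel_measurable lebesgue"
    by (rule borel_measurable_AE)
  then show ?thesis using assms(3) by (simp add: borel_measurable_restrict_space_iff)
qed

lemma measurable_interval_ae_eq:
  "ae_eq l f g \<Longrightarrow> f \<in> borel_measurable (lebesgue_on {0<..<l}) \<Longrightarrow> g \<in> borel_measurable (lebesgue_on {0<..<l})"
  unfolding ae_eq_def by (erule measurable_ae_eq) auto

lemma integrable_ae_eq:
  assumes "ae_eq l f g" "integrable (lebesgue_on {0<..<l}) f"
  shows "integrable (lebesgue_on {0<..<l}) g"
proof -
  note m = borel_measurable_integrable[OF assms(2)]
  show ?thesis
    using integrable_cong_AE[OF m measurable_interval_ae_eq[OF assms(1) m]] assms by (simp add: ae_eq_def)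
qed

lemma L2_ae_eq:
  assumes "ae_eq l f g" "f \<in> L2_space l" shows "g \<in> L2_space l"
proof -
  have "ae_eq l (\<lambda>y. (f y)\<^sup>2) (\<lambda>y. (g y)\<^sup>2)"
    using assms(1) unfolding ae_eq_def by eventually_elim simp
  then show ?thesis
    using assms integrable_ae_eq measurable_interval_ae_eq by (auto simp: L2_space_def)
qed

lemma L2_inner_ae_eq:
  assumes "ae_eq l f f'" "ae_eq l g g'" "f \<in> L2_space l" "g \<in> L2_space l"
  shows "L2_inner l f g = L2_inner l f' g'"
  unfolding L2_inner_def
proof (rule integral_cong_AE)
  show "AE y in lebesgue_on {0<..<l}. f y * g y = f' y * g' y"
    using assms(1,2) unfolding ae_eq_def by eventually_elim simp
qed (use assms L2_ae_eq L2_measurable in \<open>auto intro!: borel_measurable_times\<close>)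

lemma L2_inner_commute: "L2_inner l f g = L2_inner l g f"
  by (simp add: L2_inner_def mult.commute)

lemma L2_inner_lincomb_left:
  assumes "f \<in> L2_space l" "g \<in> L2_space l" "h \<in> L2_space l"
  shows "L2_inner l (\<lambda>y. \<alpha> * f y + \<beta> * g y) h = \<alpha> * L2_inner l f h + \<beta> * L2_inner l g h"
proof -
  have "L2_inner l (\<lambda>y. \<alpha> * f y + \<beta> * g y) h =
      (LINT y|lebesgue_on {0<..<l}. \<alpha> * (f y * h y) + \<beta> * (g y * h y))"
    by (simp add: L2_inner_def algebra_simps)
  then show ?thesis
    using assms by (simp add: L2_mult_integrable L2_inner_def)
qed

lemma L2_inner_lincomb_right:
  assumes "f \<in> L2_space l" "g \<in> L2_space l" "h \<in> L2_space l"
  shows "L2_inner l h (\<lambda>y. \<alpha> * f y + \<beta> * g y) = \<alpha> * L2_inner l h f + \<beta> * L2_inner l h g"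
  using L2_inner_lincomb_left[OF assms] by (simp add: L2_inner_commute)

lemma L2_inner_add_right:
  "f \<in> L2_space l \<Longrightarrow> g \<in> L2_space l \<Longrightarrow> h \<in> L2_space l \<Longrightarrow>
    L2_inner l h (\<lambda>y. f y + g y) = L2_inner l h f + L2_inner l h g"
  using L2_inner_lincomb_right[of f l g h 1 1] by simp

lemma L2_inner_diff_right:
  "f \<in> L2_space l \<Longrightarrow> g \<in> L2_space l \<Longrightarrow> h \<in> L2_space l \<Longrightarrow>
    L2_inner l h (\<lambda>y. f y - g y) = L2_inner l h f - L2_inner l h g"
  using L2_inner_lincomb_right[of f l g h 1 "-1"] by simp

lemma L2_inner_scale_right:
  "L2_inner l h (\<lambda>y. c * f y) = c * L2_inner l h f"
  by (simp add: L2_inner_def mult.left_commute)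

lemma L2_norm_nonneg: "0 \<le> L2_norm l f"
  by (simp add: L2_norm_def)

lemma L2_norm_sq: "(L2_norm l f)\<^sup>2 = L2_inner l f f"
  by (simp add: L2_norm_def L2_inner_def power2_eq_square[symmetric])

lemma L2_norm_ae_eq:
  "ae_eq l f g \<Longrightarrow> f \<in> L2_space l \<Longrightarrow> L2_norm l f = L2_norm l g"
  using L2_inner_ae_eq[of l f g f g] by (simp add: L2_norm_def L2_inner_def power2_eq_square)

lemma L2_Cauchy_Schwarz:
  assumes "f \<in> L2_space l" "g \<in> L2_space l"
  shows "\<bar>L2_inner l f g\<bar> \<le> L2_norm l f * L2_norm l g"
proof -
  let ?a = "L2_inner l g g" and ?b = "L2_inner l f g" and ?c = "L2_inner l f f"
  have q: "0 \<le> t\<^sup>2 * ?a + 2 * s * t * ?b + s\<^sup>2 * ?c" for s t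
  proof -
    have "0 \<le> (L2_norm l (\<lambda>y. s * f y + t * g y))\<^sup>2" by simp
    also have "\<dots> = t\<^sup>2 * ?a + 2 * s * t * ?b + s\<^sup>2 * ?c"
      unfolding L2_norm_sq using assms
      by (simp add: L2_inner_lincomb_left L2_inner_lincomb_right L2_lincomb L2_inner_commute[of l g f]
          power2_eq_square algebra_simps)
    finally show ?thesis .
  qed
  have nn: "?a \<ge> 0" "?c \<ge> 0" by (simp_all flip: L2_norm_sq)
  have "?b\<^sup>2 \<le> ?a * ?c"
  proof (cases "?a = 0")
    case True
    \<comment> \<open>\<open>L2_norm\<close> is only a seminorm on functions, so this degenerate
      case is a genuine one. For \<open>s = 1\<close> the form is affine in \<open>t\<close>, and an
      affine function bounded below has slope 0.\<close>
    have "?b = 0"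
    proof (rule ccontr)
      assume "?b \<noteq> 0"
      have "0 \<le> 2 * (- (?c + 1) / (2 * ?b)) * ?b + ?c"
        using q[of "- (?c + 1) / (2 * ?b)" 1] True by (simp only: mult_zero_right power_one mult_1 mult_1_right add_0)
      then show False using \<open>?b \<noteq> 0\<close> by (simp add: field_simps)
    qed
    then show ?thesis using nn by simp
  next
    case False
    then have "0 \<le> ?a * (?a * ?c - ?b\<^sup>2)"
      using q[of "- ?b" ?a] by (simp add: power2_eq_square algebra_simps)
    then show ?thesis using False nn by (simp add: zero_le_mult_iff)
  qed
  then have "?b\<^sup>2 \<le> (L2_norm l f * L2_norm l g)\<^sup>2"
    by (simp add: power_mult_distrib L2_norm_sq mult.commute)
  then show ?thesis
    by (simp add: abs_le_square_iff[symmetric] L2_norm_nonneg)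
qed

lemma L2_norm_triangle:
  assumes "f \<in> L2_space l" "g \<in> L2_space l"
  shows "L2_norm l (\<lambda>y. f y + g y) \<le> L2_norm l f + L2_norm l g"
proof (rule power2_le_imp_le)
  have "(L2_norm l (\<lambda>y. f y + g y))\<^sup>2 = (L2_norm l f)\<^sup>2 + 2 * L2_inner l f g + (L2_norm l g)\<^sup>2"
    unfolding L2_norm_sq using assms L2_inner_lincomb_left[of f l g _ 1 1]
    by (simp add: L2_inner_add_right L2_add L2_inner_commute[of l g f])
  also have "\<dots> \<le> (L2_norm l f + L2_norm l g)\<^sup>2"
    using L2_Cauchy_Schwarz[OF assms] by (simp add: power2_sum)
  finally show "(L2_norm l (\<lambda>y. f y + g y))\<^sup>2 \<le> (L2_norm l f + L2_norm l g)\<^sup>2" .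
qed (simp add: L2_norm_nonneg)

section \<open>Sobolev functions as primitives\<close>

lemma test_function_deriv: "test_function l \<phi> \<Longrightarrow> l > 0 \<Longrightarrow> test_function l (deriv \<phi>)"
proof -
  assume t: "test_function l \<phi>" and "l > 0"
  then obtain a b where ab: "0 < a" "a < b" "b < l" "\<And>x. x \<notin> {a..b} \<Longrightarrow> \<phi> x = 0"
    using test_function_support by blast
  have "deriv \<phi> x = 0" if "x \<notin> {a..b}" for x
  proof -
    have "((\<lambda>_. 0) has_real_derivative 0) (at x)" by simp
    then have "(\<phi> has_real_derivative 0) (at x)"
      by (rule has_field_derivative_transform_within_open[of _ _ _ "- {a..b}"]) (use that ab(4) in auto)
    then show ?thesis by (rule DERIV_imp_deriv)
  qed
  then show ?thesis
    using ab(1,3) by (intro test_functionI[OF smooth_deriv[OF test_function_smooth[OF t]], of a b])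
qed

lemma integrable_imp_locally_integrable:
  assumes "integrable (lebesgue_on {0<..<l}) f" shows "locally_integrable l f"
  unfolding locally_integrable_def
proof (intro allI impI)
  fix a b :: real assume ab: "0 < a \<and> b < l"
  have "integrable lebesgue (\<lambda>x. indicator {a..b} x *\<^sub>R (indicator {0<..<l} x * f x))"
    using assms by (intro integrable_mult_indicator) (simp_all add: integrable_lebesgue_on_iff)
  also have "(\<lambda>x. indicator {a..b} x *\<^sub>R (indicator {0<..<l} x * f x)) = (\<lambda>x. indicator {a..b} x * f x)"
    using ab by (auto simp: fun_eq_iff indicator_def)
  finally show "integrable (lebesgue_on {a..b}) f" by (simp add: integrable_lebesgue_on_iff)
qed

lemma integrable_one_interval: "integrable (lebesgue_on {0<..<l::real}) (\<lambda>_. c::real)"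
  by (rule finite_measure.integrable_const[OF finite_measure_interval])

lemma integrable_test_function:
  "test_function l \<phi> \<Longrightarrow> l > 0 \<Longrightarrow> integrable (lebesgue_on {0<..<l}) \<phi>"
  using integrable_mult_test_function[of l "\<lambda>_. 1" \<phi>]
    integrable_imp_locally_integrable[OF integrable_one_interval[of l 1]] by simp

lemma prim_deriv_test_function:
  assumes "test_function l \<phi>" "l > 0" "0 \<le> y" "y \<le> l"
  shows "prim l (deriv \<phi>) y = \<phi> y"
proof -
  have sm: "smooth \<phi>" using assms(1) by (rule test_function_smooth)
  have "\<phi> 0 = 0" by (rule test_function_support[OF assms(1,2)]) auto
  have hi: "(deriv \<phi> has_integral (\<phi> y - \<phi> 0)) {0..y}"
    by (rule fundamental_theorem_of_calculus[OF assms(3)])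
       (rule has_vector_derivative_at_within[OF smooth_DERIV[OF sm, unfolded has_real_derivative_iff_has_vector_derivative]])
  have "set_integrable lborel {0..y} (deriv \<phi>)"
    by (rule borel_integrable_atLeastAtMost') (intro smooth_continuous smooth_deriv sm)
  then have si: "set_integrable lebesgue {0..y} (deriv \<phi>)"
    unfolding set_integrable_def
    by (subst integrable_completion) (auto dest: borel_measurable_integrable)
  have "prim l (deriv \<phi>) y = (LINT s|lebesgue. indicator {0<..<l} s * (indicator {..<y} s * deriv \<phi> s))"
    by (simp add: prim_def lint_lebesgue_on)
  also have "\<dots> = (LINT s|lebesgue. indicator {0..y} s *\<^sub>R deriv \<phi> s)"
  proof (rule integral_cong_AE)
    have "AE s in lebesgue. s \<noteq> 0" "AE s in lebesgue. s \<noteq> y"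
      using AE_not_in[of "{0}" lebesgue] AE_not_in[of "{y}" lebesgue] by simp_all
    then show "AE s in lebesgue. indicator {0<..<l} s * (indicator {..<y} s * deriv \<phi> s) = indicator {0..y} s *\<^sub>R deriv \<phi> s"
      by eventually_elim (use assms(4) in \<open>auto simp: indicator_def\<close>)
    have "integrable (lebesgue_on {0<..<l}) (\<lambda>s. indicator {..<y} s * deriv \<phi> s)"
      by (intro integrable_indicator_mult integrable_test_function test_function_deriv assms) simp
    then show "(\<lambda>s. indicator {0<..<l} s * (indicator {..<y} s * deriv \<phi> s)) \<in> borel_measurable lebesgue"
      by (intro borel_measurable_integrable) (simp add: integrable_lebesgue_on_iff)
  qed (use si in \<open>auto simp: set_integrable_def\<close>)
  also have "\<dots> = \<phi> y - \<phi> 0"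
    using set_lebesgue_integral_eq_integral(2)[OF si] integral_unique[OF hi]
    by (simp add: set_lebesgue_integral_def)
  finally show ?thesis using \<open>\<phi> 0 = 0\<close> by simp
qed

lemma integrable_prim:
  "integrable (lebesgue_on {0<..<l}) g \<Longrightarrow> integrable (lebesgue_on {0<..<l}) (prim l g)"
  using prim_by_parts(1)[OF _ integrable_one_interval[of l 1]] by simp

text \<open>Integration by parts without boundary terms: the primitive vanishes at 0, the test
  function at \<open>l\<close>.\<close>

lemma integral_prim_mult_deriv:
  assumes "integrable (lebesgue_on {0<..<l}) g" "test_function l \<phi>" "l > 0"
  shows "(LINT y|lebesgue_on {0<..<l}. prim l g y * deriv \<phi> y) = - (LINT y|lebesgue_on {0<..<l}. g y * \<phi> y)"
proof -
  have "\<phi> l = 0" by (rule test_function_support[OF assms(2,3)]) auto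
  have "(LINT y|lebesgue_on {0<..<l}. g y * prim l (deriv \<phi>) y) = (LINT y|lebesgue_on {0<..<l}. g y * \<phi> y)"
    by (rule Bochner_Integration.integral_cong)
       (use assms in \<open>auto simp: space_restrict_space prim_deriv_test_function\<close>)
  moreover have "prim l (deriv \<phi>) l = 0"
    using assms \<open>\<phi> l = 0\<close> by (simp add: prim_deriv_test_function)
  ultimately show ?thesis
    using prim_by_parts(2)[OF assms(1) integrable_test_function[OF test_function_deriv[OF assms(2,3)] assms(3)]]
    by simp
qed

lemma locally_integrable_diff:
  "locally_integrable l f \<Longrightarrow> locally_integrable l g \<Longrightarrow> locally_integrable l (\<lambda>y. f y - g y)"
  by (simp add: locally_integrable_def)

text \<open>The hypothesis speaks only about compact subintervals; cutting \<open>f\<close> off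
  along an exhaustion of (0,l) writes it as a pointwise limit of measurable functions.\<close>

lemma locally_integrable_measurable:
  assumes f: "locally_integrable l f"
  shows "f \<in> borel_measurable (lebesgue_on {0<..<l})"
proof -
  let ?J = "\<lambda>n. {1 / real (Suc n)..l - 1 / real (Suc n)}"
  have "(\<lambda>x. indicator {0<..<l} x * f x) \<in> borel_measurable lebesgue"
  proof (rule borel_measurable_LIMSEQ_real)
    fix x
    show "(\<lambda>n. indicator (?J n) x * f x) \<longlonglongrightarrow> indicator {0<..<l} x * f x"
    proof (cases "x \<in> {0<..<l}")
      case True
      have "\<forall>\<^sub>F n in sequentially. 1 / real (Suc n) < min x (l - x)"
        by (rule order_tendstoD(2)[OF LIMSEQ_Suc[OF lim_1_over_n]]) (use True in auto)
      then have "\<forall>\<^sub>F n in sequentially. indicator (?J n) x * f x = indicator {0<..<l} x * f x"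
        by eventually_elim (use True in \<open>auto simp: indicator_def\<close>)
      then show ?thesis by (rule tendsto_eventually)
    next
      case False
      have "0 < 1 / real (Suc n)" for n by simp
      then have "x \<notin> ?J n" for n using False by (smt (verit) atLeastAtMost_iff greaterThanLessThan_iff)
      then show ?thesis using False by simp
    qed
  next
    fix n
    have "integrable (lebesgue_on (?J n)) f"
      using f unfolding locally_integrable_def by (auto intro!: divide_pos_pos)
    then show "(\<lambda>x. indicator (?J n) x * f x) \<in> borel_measurable lebesgue"
      by (intro borel_measurable_integrable) (simp add: integrable_lebesgue_on_iff)
  qed
  then show ?thesis by (simp add: borel_measurable_restrict_space_iff)
qed

lemma weak_derivative_unique:
  assumes "has_weak_derivative l f g" "has_weak_derivative l f h" "l > 0"
  shows "ae_eq l g h"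
proof -
  have "AE y in lebesgue_on {0<..<l}. g y - h y = 0"
  proof (rule AE_zero_of_test_integrals)
    show "locally_integrable l (\<lambda>y. g y - h y)"
      using assms by (simp add: has_weak_derivative_def locally_integrable_diff)
    fix \<phi> assume t: "test_function l \<phi>"
    have "(LINT y|lebesgue_on {0<..<l}. g y * \<phi> y) = (LINT y|lebesgue_on {0<..<l}. h y * \<phi> y)"
      using assms(1,2) t by (simp add: has_weak_derivative_def)
    then show "(LINT y|lebesgue_on {0<..<l}. (g y - h y) * \<phi> y) = 0"
      using assms t by (simp add: left_diff_distrib integrable_mult_test_function has_weak_derivative_def)
  qed (rule assms)
  then show ?thesis by (simp add: ae_eq_def)
qed

lemma locally_integrable_ae_eq:
  assumes "ae_eq l f g" "locally_integrable l f"
  shows "locally_integrable l g"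
  unfolding locally_integrable_def
proof (intro allI impI)
  fix a b :: real assume ab: "0 < a \<and> b < l"
  have int: "integrable (lebesgue_on {a..b}) f"
    using assms(2) ab by (simp add: locally_integrable_def)
  have ae: "AE x in lebesgue_on {a..b}. f x = g x"
    using assms(1) ab by (auto simp: ae_eq_def AE_restrict_space_iff elim: eventually_mono)
  show "integrable (lebesgue_on {a..b}) g"
    using integrable_cong_AE[OF borel_measurable_integrable[OF int]
        measurable_ae_eq[OF ae borel_measurable_integrable[OF int]] ae] int by simp
qed

lemma has_weak_derivative_ae_eq:
  assumes "ae_eq l f f'" "ae_eq l g g'" "has_weak_derivative l f g"
  shows "has_weak_derivative l f' g'"
  unfolding has_weak_derivative_def
proof (intro conjI allI impI)
  show f': "locally_integrable l f'" and g': "locally_integrable l g'"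
    using assms locally_integrable_ae_eq by (auto simp: has_weak_derivative_def)
  have cong: "(LINT y|lebesgue_on {0<..<l}. u y * \<theta> y) = (LINT y|lebesgue_on {0<..<l}. u' y * \<theta> y)"
    if "ae_eq l u u'" "locally_integrable l u" "locally_integrable l u'" "test_function l \<phi>" "smooth \<theta>" for u u' \<theta> \<phi>
  proof (rule integral_cong_AE)
    show "AE y in lebesgue_on {0<..<l}. u y * \<theta> y = u' y * \<theta> y"
      using that(1) unfolding ae_eq_def by eventually_elim simp
    have "\<theta> \<in> borel_measurable (lebesgue_on {0<..<l})"
      by (intro borel_measurable_lebesgue_on borel_measurable_continuous_onI smooth_continuous that)
    then show "(\<lambda>y. u y * \<theta> y) \<in> borel_measurable (lebesgue_on {0<..<l})"
      "(\<lambda>y. u' y * \<theta> y) \<in> borel_measurable (lebesgue_on {0<..<l})"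
      using that locally_integrable_measurable by (auto intro!: borel_measurable_times)
  qed
  fix \<phi> assume t: "test_function l \<phi>"
  show "(LINT y|lebesgue_on {0<..<l}. f' y * deriv \<phi> y) = - (LINT y|lebesgue_on {0<..<l}. g' y * \<phi> y)"
    using assms f' g' t cong[of f f' \<phi> "deriv \<phi>"] cong[of g g' \<phi> \<phi>]
      test_function_smooth[OF t] smooth_deriv[OF test_function_smooth[OF t]]
    by (simp add: has_weak_derivative_def)
qed

text \<open>Equality on the nose, not just almost everywhere: both sides apply \<open>SOME\<close>
  to the same predicate. It permits plain rewriting under further derivatives.\<close>

lemma weak_deriv_ae_eq:
  assumes "ae_eq l f f'" shows "weak_deriv l f = weak_deriv l f'"
proof -
  have "has_weak_derivative l f = has_weak_derivative l f'"
    using has_weak_derivative_ae_eq[OF assms ae_eq_refl]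
      has_weak_derivative_ae_eq[OF ae_eq_sym[OF assms] ae_eq_refl] by blast
  then show ?thesis by (simp add: weak_deriv_def)
qed

lemma weak_deriv_eq:
  assumes "has_weak_derivative l f g" "l > 0" shows "ae_eq l (weak_deriv l f) g"
proof -
  have "has_weak_derivative l f (weak_deriv l f)"
    unfolding weak_deriv_def by (rule someI[of _ g]) (rule assms(1))
  then show ?thesis using weak_derivative_unique assms by blast
qed

text \<open>du Bois-Reymond: subtract the primitive, and test against mean-zero functions, which are
  exactly the derivatives of test functions.\<close>

lemma weak_derivative_imp_prim:
  assumes w: "has_weak_derivative l f g" and g: "integrable (lebesgue_on {0<..<l}) g" and "l > 0"
  shows "\<exists>c. ae_eq l f (\<lambda>y. c + prim l g y)"
proof -
  let ?M = "lebesgue_on {0<..<l}"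
  let ?I = "\<lambda>\<psi>. LINT y|?M. \<psi> y"
  define h where "h y = f y - prim l g y" for y
  have fl: "locally_integrable l f" using w by (simp add: has_weak_derivative_def)
  have pl: "locally_integrable l (prim l g)"
    by (intro integrable_imp_locally_integrable integrable_prim g)
  have hl: "locally_integrable l h"
    unfolding h_def[abs_def] by (rule locally_integrable_diff[OF fl pl])
  have hd: "(LINT y|?M. h y * deriv \<phi> y) = 0" if t: "test_function l \<phi>" for \<phi>
  proof -
    have t': "test_function l (deriv \<phi>)" by (rule test_function_deriv[OF t \<open>l > 0\<close>])
    have "(LINT y|?M. h y * deriv \<phi> y) = (LINT y|?M. f y * deriv \<phi> y) - (LINT y|?M. prim l g y * deriv \<phi> y)"
      using integrable_mult_test_function[OF fl t' \<open>l > 0\<close>] integrable_mult_test_function[OF pl t' \<open>l > 0\<close>]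
      by (simp add: h_def left_diff_distrib)
    also have "\<dots> = 0"
      using w t integral_prim_mult_deriv[OF g t \<open>l > 0\<close>] by (simp add: has_weak_derivative_def)
    finally show ?thesis .
  qed
  \<comment> \<open>A reference test function with non-zero integral; multiples of it adjust the
    mean of any other test function.\<close>
  define \<eta> where "\<eta> = bump (l/3) (2*l/3) 1"
  have \<eta>: "test_function l \<eta>" unfolding \<eta>_def by (rule test_function_bump) (use \<open>l > 0\<close> in auto)
  have "?I \<eta> \<noteq> 0"
  proof
    assume "?I \<eta> = 0"
    then have "AE y in ?M. \<eta> y = 0"
      using integral_nonneg_eq_0_iff_AE[of ?M \<eta>] integrable_test_function[OF \<eta> \<open>l > 0\<close>] bump_bounds(1)
      by (simp add: \<eta>_def)
    moreover have "\<eta> y \<noteq> 0" if "y \<in> {l/3<..<2*l/3}" for y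
      using bump_pos[OF that, of 1] by (simp add: \<eta>_def)
    ultimately have "AE y in lebesgue. y \<notin> {l/3<..<2*l/3}"
      using \<open>l > 0\<close> by (auto simp: AE_restrict_space_iff elim!: eventually_mono)
    then have "{l/3<..<2*l/3} \<in> null_sets lebesgue"
      by (subst (asm) AE_iff_null_sets[symmetric]) auto
    then show False using \<open>l > 0\<close> by (auto simp: null_sets_def)
  qed
  \<comment> \<open>If \<open>h\<close> is constant almost everywhere, testing with
    \<open>\<eta>\<close> shows that this is the constant.\<close>
  define c where "c = (LINT y|?M. h y * \<eta> y) / ?I \<eta>"
  have "AE y in ?M. h y - c = 0"
  proof (rule AE_zero_of_test_integrals)
    have cl: "locally_integrable l (\<lambda>_. c)"
      by (rule integrable_imp_locally_integrable[OF integrable_one_interval])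
    show "locally_integrable l (\<lambda>y. h y - c)"
      by (rule locally_integrable_diff[OF hl cl])
    fix \<psi> assume \<psi>: "test_function l \<psi>"
    define r where "r = ?I \<psi> / ?I \<eta>"
    \<comment> \<open>The mean of \<open>\<theta>\<close> is zero, so \<open>\<theta>\<close> is the
      derivative of a test function and \<open>hd\<close> applies to it.\<close>
    define \<theta> where "\<theta> y = \<psi> y + (- r) * \<eta> y" for y
    obtain a b where ab: "0 < a" "a < b" "b < l" "\<And>x. x \<notin> {a..b} \<Longrightarrow> \<psi> x = 0"
      using test_function_support[OF \<psi> \<open>l > 0\<close>] by blast
    have \<theta>: "test_function l \<theta>"
    proof (rule test_functionI)
      show "smooth \<theta>" unfolding \<theta>_def[abs_def]
        by (intro smooth_add smooth_mult smooth_const test_function_smooth[OF \<psi>] test_function_smooth[OF \<eta>])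
      show "0 < min a (l/3)" "max b (2*l/3) < l" using ab \<open>l > 0\<close> by auto
      show "\<theta> x = 0" if "x \<notin> {min a (l/3)..max b (2*l/3)}" for x
        using that ab(4)[of x] bump_outside[of x "l/3" "2*l/3" 1]
        by (cases "x \<in> {a..b}"; cases "x \<in> {l/3<..<2*l/3}") (auto simp: \<theta>_def \<eta>_def)
    qed
    note int = integrable_test_function[OF \<psi> \<open>l > 0\<close>] integrable_test_function[OF \<eta> \<open>l > 0\<close>]
    have "?I \<theta> = ?I \<psi> - r * ?I \<eta>"
      unfolding \<theta>_def using int by simp
    then have I0: "?I \<theta> = 0" using \<open>?I \<eta> \<noteq> 0\<close> by (simp add: r_def)
    have "integral {0..l} \<theta> = ?I \<theta>"
    proof -
      have "integral {0..l} \<theta> = integral {0<..<l} \<theta>"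
        using integral_open_interval_real[of 0 l \<theta>] by simp
      also have "\<dots> = ?I \<theta>"
        by (rule lebesgue_integral_eq_integral[symmetric]) (use integrable_test_function[OF \<theta> \<open>l > 0\<close>] in auto)
      finally show ?thesis .
    qed
    then obtain \<phi> where "test_function l \<phi>" "deriv \<phi> = \<theta>"
      using test_function_antideriv[OF \<theta> \<open>l > 0\<close>] I0 by metis
    then have "(LINT y|?M. h y * \<theta> y) = 0" using hd by metis
    moreover have "(LINT y|?M. h y * \<theta> y) = (LINT y|?M. h y * \<psi> y - r * (h y * \<eta> y))"
      by (simp add: \<theta>_def algebra_simps)
    ultimately have "(LINT y|?M. h y * \<psi> y) = r * (LINT y|?M. h y * \<eta> y)"
      using integrable_mult_test_function[OF hl \<psi> \<open>l > 0\<close>] integrable_mult_test_function[OF hl \<eta> \<open>l > 0\<close>]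
      by simp
    then have "(LINT y|?M. h y * \<psi> y) = c * ?I \<psi>" by (simp add: r_def c_def)
    moreover have "(LINT y|?M. (h y - c) * \<psi> y) = (LINT y|?M. h y * \<psi> y) - c * ?I \<psi>"
      using integrable_mult_test_function[OF hl \<psi> \<open>l > 0\<close>] int by (simp add: left_diff_distrib)
    ultimately show "(LINT y|?M. (h y - c) * \<psi> y) = 0" by simp
  qed (rule \<open>l > 0\<close>)
  then have "ae_eq l f (\<lambda>y. c + prim l g y)"
    unfolding ae_eq_def by eventually_elim (simp add: h_def)
  then show ?thesis by blast
qed

text \<open>The constant \<open>c\<close> contributes nothing, since derivatives of test functions
  have mean zero.\<close>

lemma prim_imp_weak_derivative:
  assumes "ae_eq l f (\<lambda>y. c + prim l g y)" "integrable (lebesgue_on {0<..<l}) g" "l > 0"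
  shows "has_weak_derivative l f g"
proof (rule has_weak_derivative_ae_eq[OF ae_eq_sym[OF assms(1)] ae_eq_refl])
  have p: "integrable (lebesgue_on {0<..<l}) (\<lambda>y. c + prim l g y)"
    using integrable_prim[OF assms(2)] integrable_one_interval[of l c] by simp
  show "has_weak_derivative l (\<lambda>y. c + prim l g y) g"
    unfolding has_weak_derivative_def
  proof (intro conjI allI impI)
    fix \<phi> assume t: "test_function l \<phi>"
    have t': "test_function l (deriv \<phi>)" by (rule test_function_deriv[OF t \<open>l > 0\<close>])
    have "\<phi> l = 0" by (rule test_function_support[OF t \<open>l > 0\<close>]) auto
    then have "(LINT y|lebesgue_on {0<..<l}. deriv \<phi> y) = 0"
      using prim_deriv_test_function[OF t \<open>l > 0\<close>, of l] \<open>l > 0\<close> by (simp add: prim_l)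
    then show "(LINT y|lebesgue_on {0<..<l}. (c + prim l g y) * deriv \<phi> y)
        = - (LINT y|lebesgue_on {0<..<l}. g y * \<phi> y)"
      using integral_prim_mult_deriv[OF assms(2) t \<open>l > 0\<close>] integrable_test_function[OF t' \<open>l > 0\<close>]
        integrable_mult_test_function[OF integrable_imp_locally_integrable[OF integrable_prim[OF assms(2)]] t' \<open>l > 0\<close>]
      by (simp add: distrib_right)
  qed (intro integrable_imp_locally_integrable p assms(2))+
qed

text \<open>\<open>H1 l c f g\<close>: \<open>f\<close> is the function in \<open>H\<^sup>1(0,l)\<close> with initial value \<open>c\<close> and derivative \<open>g\<close>; its
  continuous representative takes the value \<open>c + prim l g l\<close> at \<open>l\<close>.\<close>

definition H1 :: "real \<Rightarrow> real \<Rightarrow> (real \<Rightarrow> real) \<Rightarrow> (real \<Rightarrow> real) \<Rightarrow> bool"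
  where "H1 l c f g \<longleftrightarrow> g \<in> L2_space l \<and> ae_eq l f (\<lambda>y. c + prim l g y)"

lemma H1_L2_deriv: "H1 l c f g \<Longrightarrow> g \<in> L2_space l"
  by (simp add: H1_def)

text \<open>Cauchy-Schwarz against the indicator of the interval up to \<open>y\<close>, whose norm
  is at most \<open>sqrt l\<close>. At \<open>y = l\<close> it becomes the trace inequality that
  controls the boundary disturbances.\<close>

lemma prim_L2_deriv_bound:
  assumes "g \<in> L2_space l" "l > 0"
  shows "\<bar>prim l g y\<bar> \<le> sqrt l * L2_norm l g"
proof -
  let ?i = "indicator {..<y} :: real \<Rightarrow> real"
  have int: "integrable (lebesgue_on {0<..<l}) (\<lambda>s. ?i s * 1)"
    by (rule integrable_indicator_mult[OF integrable_one_interval]) simp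
  then have i: "?i \<in> L2_space l"
    using borel_measurable_integrable[OF int] by (simp add: L2_space_def power2_eq_square flip: indicator_inter_arith)
  have "(LINT s|lebesgue_on {0<..<l}. ?i s * ?i s) \<le> (LINT s|lebesgue_on {0<..<l}. 1)"
    by (rule integral_mono[OF L2_mult_integrable[OF i i] integrable_one_interval]) (auto simp: indicator_def)
  also have "\<dots> = l" using measure_interval[of l] \<open>l > 0\<close> by simp
  finally have "(L2_norm l ?i)\<^sup>2 \<le> l" by (simp add: L2_norm_sq L2_inner_def)
  then have "L2_norm l ?i \<le> sqrt l" by (simp add: real_le_rsqrt)
  have "\<bar>prim l g y\<bar> = \<bar>L2_inner l ?i g\<bar>" by (simp add: prim_def L2_inner_def)
  also have "\<dots> \<le> L2_norm l ?i * L2_norm l g" by (rule L2_Cauchy_Schwarz[OF i assms(1)])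
  also have "\<dots> \<le> sqrt l * L2_norm l g"
    by (rule mult_right_mono) (use \<open>L2_norm l ?i \<le> sqrt l\<close> in \<open>auto simp: L2_norm_nonneg\<close>)
  finally show ?thesis .
qed

lemma prim_L2_deriv_bound_sq:
  "g \<in> L2_space l \<Longrightarrow> l > 0 \<Longrightarrow> (prim l g y)\<^sup>2 \<le> (sqrt l * L2_norm l g)\<^sup>2"
  using power_mono[OF prim_L2_deriv_bound abs_ge_zero, of g l y 2] by simp

lemma prim_L2:
  assumes "g \<in> L2_space l" "l > 0" shows "prim l g \<in> L2_space l"
proof -
  have m: "prim l g \<in> borel_measurable (lebesgue_on {0<..<l})"
    by (intro borel_measurable_integrable integrable_prim L2_integrable assms)
  have "integrable (lebesgue_on {0<..<l}) (\<lambda>y. (prim l g y)\<^sup>2)"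
  proof (rule Bochner_Integration.integrable_bound[OF integrable_one_interval])
    show "AE y in lebesgue_on {0<..<l}. norm ((prim l g y)\<^sup>2) \<le> norm ((sqrt l * L2_norm l g)\<^sup>2)"
      using prim_L2_deriv_bound_sq[OF assms] by (intro AE_I2) simp
  qed (use m in measurable)
  then show ?thesis using m by (simp add: L2_space_def)
qed

text \<open>Poincare's inequality with the simple constant \<open>l\<close>, obtained by squaring
  the uniform bound and integrating over an interval of length \<open>l\<close>.\<close>

lemma prim_L2_norm:
  assumes "g \<in> L2_space l" "l > 0" shows "L2_norm l (prim l g) \<le> l * L2_norm l g"
proof (rule power2_le_imp_le)
  have "(L2_norm l (prim l g))\<^sup>2 = (LINT y|lebesgue_on {0<..<l}. (prim l g y)\<^sup>2)"
    by (simp only: L2_norm_sq L2_inner_def power2_eq_square[of "prim l g _"])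
  also have "\<dots> \<le> (LINT y|lebesgue_on {0<..<l}. (sqrt l * L2_norm l g)\<^sup>2)"
    by (rule integral_mono[OF _ integrable_one_interval])
       (use prim_L2[OF assms] prim_L2_deriv_bound_sq[OF assms] in \<open>auto simp: L2_space_def\<close>)
  also have "\<dots> = (l * L2_norm l g)\<^sup>2"
    using measure_interval[of l] \<open>l > 0\<close> by (simp add: power_mult_distrib power2_eq_square)
  finally show "(L2_norm l (prim l g))\<^sup>2 \<le> (l * L2_norm l g)\<^sup>2" .
qed (use \<open>l > 0\<close> in \<open>simp add: L2_norm_nonneg\<close>)

lemma H1_L2: "H1 l c f g \<Longrightarrow> l > 0 \<Longrightarrow> f \<in> L2_space l"
  unfolding H1_def
  by (elim conjE, rule L2_ae_eq[OF ae_eq_sym], assumption) (intro L2_add L2_const prim_L2)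

lemma H1_0_norm: "H1 l 0 f g \<Longrightarrow> l > 0 \<Longrightarrow> L2_norm l f \<le> l * L2_norm l g"
  using prim_L2_norm[of g l] L2_norm_ae_eq[of l f "prim l g"] H1_L2[of l 0 f g] by (simp add: H1_def)

lemma H1_weak_derivative: "H1 l c f g \<Longrightarrow> l > 0 \<Longrightarrow> has_weak_derivative l f g"
  unfolding H1_def by (blast intro: prim_imp_weak_derivative L2_integrable)

lemma H1_weak_deriv: "H1 l c f g \<Longrightarrow> l > 0 \<Longrightarrow> ae_eq l (weak_deriv l f) g"
  by (blast intro: weak_deriv_eq H1_weak_derivative)

lemma H1_ae_eq:
  assumes "H1 l c f g" "ae_eq l f f'" "ae_eq l g g'"
  shows "H1 l c f' g'"
proof -
  have g: "g \<in> L2_space l" "g' \<in> L2_space l" using assms L2_ae_eq by (auto simp: H1_def)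
  have "prim l g = prim l g'"
    by (rule ext, rule prim_cong_AE) (use assms(3) g L2_measurable in \<open>auto simp: ae_eq_def\<close>)
  then show ?thesis
    using assms g ae_eq_trans[OF ae_eq_sym[OF assms(2)]] by (simp add: H1_def)
qed

lemma H1_lincomb:
  assumes "H1 l c f g" "H1 l c' f' g'"
  shows "H1 l (\<alpha> * c + \<beta> * c') (\<lambda>y. \<alpha> * f y + \<beta> * f' y) (\<lambda>y. \<alpha> * g y + \<beta> * g' y)"
proof -
  have "ae_eq l (\<lambda>y. \<alpha> * f y + \<beta> * f' y) (\<lambda>y. \<alpha> * (c + prim l g y) + \<beta> * (c' + prim l g' y))"
    using assms by (intro ae_eq_lincomb) (auto simp: H1_def)
  also have "(\<lambda>y. \<alpha> * (c + prim l g y) + \<beta> * (c' + prim l g' y)) =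
      (\<lambda>y. (\<alpha> * c + \<beta> * c') + prim l (\<lambda>y. \<alpha> * g y + \<beta> * g' y) y)"
    using assms by (simp add: prim_linear L2_integrable H1_def algebra_simps)
  finally show ?thesis using assms by (simp add: H1_def L2_lincomb)
qed

lemma H1_by_parts:
  assumes "H1 l c f f'" "H1 l d g g'" "l > 0"
  shows "L2_inner l f g' + L2_inner l f' g = (c + prim l f' l) * (d + prim l g' l) - c * d"
proof -
  have L: "f' \<in> L2_space l" "g' \<in> L2_space l" "prim l f' \<in> L2_space l" "prim l g' \<in> L2_space l"
    using assms by (auto simp: H1_def prim_L2)
  have "L2_inner l f g' = L2_inner l (\<lambda>y. c * 1 + 1 * prim l f' y) g'"
    using assms H1_L2 by (intro L2_inner_ae_eq) (auto simp: H1_def ae_eq_refl)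
  also have "\<dots> = c * L2_inner l (\<lambda>_. 1) g' + L2_inner l (prim l f') g'"
    using L2_inner_lincomb_left[of "\<lambda>_. 1" l "prim l f'" g' c 1] L L2_const by simp
  finally have 1: "L2_inner l f g' = c * prim l g' l + L2_inner l (prim l f') g'"
    by (simp add: L2_inner_def prim_l)
  have "L2_inner l f' g = L2_inner l f' (\<lambda>y. d * 1 + 1 * prim l g' y)"
    using assms H1_L2 by (intro L2_inner_ae_eq) (auto simp: H1_def ae_eq_refl)
  also have "\<dots> = d * L2_inner l f' (\<lambda>_. 1) + L2_inner l f' (prim l g')"
    using L2_inner_lincomb_right[of "\<lambda>_. 1" l "prim l g'" f' d 1] L L2_const by simp
  finally have 2: "L2_inner l f' g = d * prim l f' l + L2_inner l f' (prim l g')"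
    by (simp add: L2_inner_def prim_l)
  show ?thesis
    using 1 2 prim_by_parts(2)[OF L2_integrable[OF L(1)] L2_integrable[OF L(2)]]
    by (simp add: L2_inner_def algebra_simps)
qed

text \<open>The increments add up to at most the integral of \<open>\<bar>g\<bar>\<close> over the
  union of the intervals. Cauchy-Schwarz bounds it by the norm of \<open>g\<close> times the square
  root of their total length.\<close>

lemma abs_continuous_prim:
  assumes g: "g \<in> L2_space l" and "l > 0"
  shows "abs_continuous l (\<lambda>y. c + prim l g y)"
  unfolding abs_continuous_def
proof (intro allI impI)
  fix \<epsilon> :: real assume "\<epsilon> > 0"
  let ?G = "L2_norm l g"
  \<comment> \<open>The square compensates the square root of the total length; the summand 1 keeps
    the denominator positive when \<open>g\<close> has norm 0.\<close>
  define \<delta> where "\<delta> = (\<epsilon> / (?G + 1))\<^sup>2"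
  have "?G + 1 > 0" using L2_norm_nonneg[of l g] by linarith
  then have "\<delta> > 0" using \<open>\<epsilon> > 0\<close> by (simp add: \<delta>_def)
  have main: "(\<Sum>i<n. \<bar>c + prim l g (b i) - (c + prim l g (a i))\<bar>) < \<epsilon>"
    if ab: "\<forall>i<n. 0 \<le> a i \<and> a i \<le> b i \<and> b i \<le> l"
      and disj: "disjoint_family_on (\<lambda>i. {a i<..<b i}) {..<n}"
      and small: "(\<Sum>i<n. b i - a i) < \<delta>" for n :: nat and a b
  proof -
    let ?M = "lebesgue_on {0<..<l}"
    define S where "S y = (\<Sum>i<n. indicator {a i<..<b i} y :: real)" for y
    \<comment> \<open>By disjointness \<open>S\<close> is itself an indicator, so its squared norm
      is its integral, the total length.\<close>
    have S01: "S y * S y = S y" for y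
    proof -
      have "S y = indicator (\<Union>i<n. {a i<..<b i}) y"
        unfolding S_def by (rule indicator_UN_disjoint[symmetric]) (use disj in auto)
      then show ?thesis by (simp only: Int_absorb flip: indicator_inter_arith)
    qed
    have Snn: "0 \<le> S y" for y unfolding S_def by (intro sum_nonneg) simp
    have ind: "integrable ?M (\<lambda>y. indicator {a i<..<b i} y :: real)" for i
      using integrable_indicator_mult[OF integrable_one_interval[of l 1], of "{a i<..<b i}"] by simp
    have Sint: "integrable ?M S" unfolding S_def using ind by simp
    have Sint2: "integrable ?M (\<lambda>y. S y * S y)" by (simp only: S01 Sint)
    have SL2: "S \<in> L2_space l"
      using Sint Sint2 borel_measurable_integrable[OF Sint] by (simp add: L2_space_def power2_eq_square)
    have length: "(LINT y|?M. indicator {a i<..<b i} y :: real) = b i - a i" if "i < n" for i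
    proof -
      have "(LINT y|?M. indicator {a i<..<b i} y :: real) = (LINT y|lebesgue. indicator {0<..<l} y * (indicator {a i<..<b i} y :: real))"
        by (rule lint_lebesgue_on) simp
      also have "(\<lambda>y. indicator {0<..<l} y * (indicator {a i<..<b i} y :: real)) = indicator {a i<..<b i}"
        using ab[rule_format, OF that] by (auto simp: indicator_def fun_eq_iff)
      finally show ?thesis using ab that by simp
    qed
    have "(L2_norm l S)\<^sup>2 = (LINT y|?M. S y)" by (simp only: L2_norm_sq L2_inner_def S01)
    also have "\<dots> = (\<Sum>i<n. b i - a i)"
      unfolding S_def using ind length by (subst Bochner_Integration.integral_sum) auto
    finally have "(L2_norm l S)\<^sup>2 < (\<epsilon> / (?G + 1))\<^sup>2" using small by (simp add: \<delta>_def)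
    then have Sn: "L2_norm l S < \<epsilon> / (?G + 1)"
      by (rule power_less_imp_less_base) (use \<open>\<epsilon> > 0\<close> \<open>?G + 1 > 0\<close> in auto)
    have absg: "(\<lambda>y. \<bar>g y\<bar>) \<in> L2_space l"
      using g by (auto simp: L2_space_def)
    have absn: "L2_norm l (\<lambda>y. \<bar>g y\<bar>) = ?G" by (simp add: L2_norm_def)
    have int: "integrable ?M (\<lambda>y. indicator {a i<..<b i} y * \<bar>g y\<bar>)" for i
      by (rule integrable_indicator_mult[OF L2_integrable[OF absg]]) simp
    have piece: "\<bar>prim l g (b i) - prim l g (a i)\<bar> \<le> (LINT y|?M. indicator {a i<..<b i} y * \<bar>g y\<bar>)" if "i < n" for i
    proof -
      have "prim l g (b i) - prim l g (a i) = (LINT y|?M. indicator {a i..<b i} y * g y)"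
        using ab that by (intro prim_diff L2_integrable g) auto
      also have "\<bar>\<dots>\<bar> \<le> (LINT y|?M. \<bar>indicator {a i..<b i} y * g y\<bar>)"
        by (rule integral_abs_bound)
      also have "\<dots> = (LINT y|?M. indicator {a i<..<b i} y * \<bar>g y\<bar>)"
      proof (rule integral_cong_AE)
        have "AE y in lebesgue. y \<noteq> a i" using AE_not_in[of "{a i}" lebesgue] by simp
        then have "AE y in ?M. y \<noteq> a i" by (auto simp: AE_restrict_space_iff elim: eventually_mono)
        then show "AE y in ?M. \<bar>indicator {a i..<b i} y * g y\<bar> = indicator {a i<..<b i} y * \<bar>g y\<bar>"
          by eventually_elim (auto simp: indicator_def)
        have "integrable ?M (\<lambda>y. indicator {a i..<b i} y * g y)"
          by (intro integrable_indicator_mult L2_integrable g) simp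
        then show "(\<lambda>y. \<bar>indicator {a i..<b i} y * g y\<bar>) \<in> borel_measurable ?M"
          by (intro borel_measurable_integrable) simp
      qed (use int in auto)
      finally show ?thesis .
    qed
    have "(\<Sum>i<n. \<bar>c + prim l g (b i) - (c + prim l g (a i))\<bar>) \<le> (\<Sum>i<n. LINT y|?M. indicator {a i<..<b i} y * \<bar>g y\<bar>)"
      using piece by (intro sum_mono) simp
    also have "\<dots> = L2_inner l S (\<lambda>y. \<bar>g y\<bar>)"
      unfolding L2_inner_def S_def sum_distrib_right
      by (rule Bochner_Integration.integral_sum[symmetric]) (rule int)
    also have "\<dots> \<le> L2_norm l S * ?G"
      using L2_Cauchy_Schwarz[OF SL2 absg] absn by simp
    also have "\<dots> \<le> L2_norm l S * (?G + 1)" by (intro mult_left_mono) (simp_all add: L2_norm_nonneg)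
    also have "\<dots> < \<epsilon>" using Sn \<open>?G + 1 > 0\<close> by (simp add: pos_less_divide_eq)
    finally show ?thesis .
  qed
  show "\<exists>\<delta>>0. \<forall>(n::nat) a b. (\<forall>i<n. 0 \<le> a i \<and> a i \<le> b i \<and> b i \<le> l) \<and>
      disjoint_family_on (\<lambda>i. {a i<..<b i}) {..<n} \<and> (\<Sum>i<n. b i - a i) < \<delta> \<longrightarrow>
      (\<Sum>i<n. \<bar>c + prim l g (b i) - (c + prim l g (a i))\<bar>) < \<epsilon>"
    by (intro exI[of _ \<delta>] conjI \<open>\<delta> > 0\<close> allI impI, elim conjE, rule main)
qed

lemma abs_continuous_imp_continuous:
  assumes "abs_continuous l u" shows "continuous_on {0..l} u"
  unfolding continuous_on_iff
proof (intro ballI allI impI)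
  fix x \<epsilon> :: real assume x: "x \<in> {0..l}" and "\<epsilon> > 0"
  then obtain \<delta> where \<delta>: "\<delta> > 0" and ac: "\<forall>(n::nat) a b.
        (\<forall>i<n. 0 \<le> a i \<and> a i \<le> b i \<and> b i \<le> l) \<and>
        disjoint_family_on (\<lambda>i. {a i<..<b i}) {..<n} \<and>
        (\<Sum>i<n. b i - a i) < \<delta> \<longrightarrow> (\<Sum>i<n. \<bar>u (b i) - u (a i)\<bar>) < \<epsilon>"
    using assms[unfolded abs_continuous_def, rule_format, OF \<open>\<epsilon> > 0\<close>] by (elim exE conjE)
  have "dist (u y) (u x) < \<epsilon>" if "y \<in> {0..l}" "dist y x < \<delta>" for y
    using ac[THEN spec, of 1, THEN spec, of "\<lambda>_. min x y", THEN spec, of "\<lambda>_. max x y"] that x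
    by (cases "x \<le> y") (auto simp: dist_real_def disjoint_family_on_def abs_minus_commute)
  with \<delta> show "\<exists>\<delta>>0. \<forall>y\<in>{0..l}. dist y x < \<delta> \<longrightarrow> dist (u y) (u x) < \<epsilon>" by blast
qed

text \<open>A set of full measure meets every open subinterval, since these have positive
  measure.\<close>

lemma AE_interval_dense:
  assumes ae: "AE y in lebesgue_on {a<..<b::real}. P y" and "a < b"
  shows "{a..b} \<subseteq> closure {y \<in> {a<..<b}. P y}"
proof -
  have "{a<..<b} \<subseteq> closure {y \<in> {a<..<b}. P y}"
  proof
    fix x assume x: "x \<in> {a<..<b}"
    show "x \<in> closure {y \<in> {a<..<b}. P y}"
      unfolding closure_approachable
    proof (intro allI impI)
      fix e :: real assume "e > 0"
      let ?I = "{max a (x - e)<..<min b (x + e)}"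
      have "\<exists>y\<in>?I. P y"
      proof (rule ccontr)
        assume "\<not> (\<exists>y\<in>?I. P y)"
        then have "AE y in lebesgue. y \<notin> ?I"
          using ae by (auto simp: AE_restrict_space_iff elim!: eventually_mono)
        then have "?I \<in> null_sets lebesgue"
          by (subst (asm) AE_iff_null_sets[symmetric]) auto
        then show False using x \<open>e > 0\<close> by (auto simp: null_sets_def max_def min_def split: if_splits)
      qed
      then obtain y where "y \<in> ?I" "P y" by blast
      then show "\<exists>y\<in>{y \<in> {a<..<b}. P y}. dist y x < e"
        by (intro bexI[of _ y]) (auto simp: dist_real_def abs_less_iff)
    qed
  qed
  then have "closure {a<..<b} \<subseteq> closure {y \<in> {a<..<b}. P y}"
    by (simp add: closure_minimal)
  then show ?thesis using \<open>a < b\<close> by simp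
qed

text \<open>Used twice over: for the uniqueness of continuous representatives, and to turn an
  essential supremum into a bound at every point, endpoints included.\<close>

lemma continuous_AE_le:
  fixes f :: "real \<Rightarrow> real"
  assumes "continuous_on {a..b} f" "AE y in lebesgue_on {a<..<b}. f y \<le> c" "a < b" "y \<in> {a..b}"
  shows "f y \<le> c"
proof -
  have sub: "closure {y \<in> {a<..<b}. f y \<le> c} \<subseteq> {a..b}"
    by (rule closure_minimal) auto
  show ?thesis
    by (rule continuous_le_on_closure[OF continuous_on_subset[OF assms(1) sub]])
       (use AE_interval_dense[OF assms(2,3)] assms(4) in auto)
qed

lemma continuous_ae_eq:
  assumes "continuous_on {0..l} u" "continuous_on {0..l} v" "ae_eq l u v" "l > 0" "y \<in> {0..l}"
  shows "u y = v y"
proof (rule antisym)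
  have "u y - v y \<le> 0"
    by (rule continuous_AE_le[of 0 l]) (use assms in \<open>auto intro!: continuous_intros simp: ae_eq_def\<close>)
  then show "u y \<le> v y" by simp
  have "v y - u y \<le> 0"
    by (rule continuous_AE_le[of 0 l]) (use assms in \<open>auto intro!: continuous_intros simp: ae_eq_def\<close>)
  then show "v y \<le> u y" by simp
qed

text \<open>\<open>pt_val\<close> picks some absolutely continuous representative, and the primitive
  is another; being continuous, they agree on all of [0,l].\<close>

lemma H1_pt_val:
  assumes "H1 l c f g" "l > 0" "y \<in> {0..l}"
  shows "pt_val l f y = c + prim l g y"
proof -
  let ?u = "\<lambda>y. c + prim l g y"
  have u: "abs_continuous l ?u \<and> ae_eq l f ?u"
    using assms abs_continuous_prim by (auto simp: H1_def)
  then have v: "abs_continuous l (pt_val l f) \<and> ae_eq l f (pt_val l f)"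
    unfolding pt_val_def by (rule someI[of "\<lambda>u. abs_continuous l u \<and> ae_eq l f u"])
  show ?thesis
    by (rule continuous_ae_eq[of l "pt_val l f" ?u])
       (use u v assms ae_eq_trans[OF ae_eq_sym] abs_continuous_imp_continuous in auto)
qed

text \<open>du Bois-Reymond in terms of \<open>H1\<close>: membership in the Sobolev space turns
  into an explicit formula, and the chosen objects \<open>weak_deriv\<close> and
  \<open>pt_val\<close> appear in the roles of derivative and initial value.\<close>

lemma Sobolev_1_H1:
  assumes f: "f \<in> Sobolev l (Suc 0)" and "l > 0"
  shows "H1 l (pt_val l f 0) f (weak_deriv l f)"
proof -
  obtain g where g: "has_weak_derivative l f g" "g \<in> L2_space l" using f by auto
  obtain c where c: "ae_eq l f (\<lambda>y. c + prim l g y)"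
    using weak_derivative_imp_prim[OF g(1) L2_integrable[OF g(2)] \<open>l > 0\<close>] by blast
  have h: "H1 l c f g" using c g by (simp add: H1_def)
  have "pt_val l f 0 = c" using H1_pt_val[OF h \<open>l > 0\<close>, of 0] \<open>l > 0\<close> by (simp add: prim_0)
  then show ?thesis
    using H1_ae_eq[OF h ae_eq_refl ae_eq_sym[OF H1_weak_deriv[OF h \<open>l > 0\<close>]]] by simp
qed

lemma Sobolev_ae_eq:
  assumes "ae_eq l f g" "f \<in> Sobolev l k" shows "g \<in> Sobolev l k"
  using assms by (cases k) (auto intro: L2_ae_eq has_weak_derivative_ae_eq[OF _ ae_eq_refl])

lemma Sobolev_2_weak_deriv:
  assumes "f \<in> Sobolev l 2" "l > 0"
  shows "f \<in> Sobolev l (Suc 0)" "weak_deriv l f \<in> Sobolev l (Suc 0)"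
proof -
  obtain g where g: "has_weak_derivative l f g" "g \<in> Sobolev l (Suc 0)" and f: "f \<in> L2_space l"
    using assms(1) by (auto simp: numeral_2_eq_2)
  then show "f \<in> Sobolev l (Suc 0)" by auto
  show "weak_deriv l f \<in> Sobolev l (Suc 0)"
    by (rule Sobolev_ae_eq[OF ae_eq_sym[OF weak_deriv_eq[OF g(1) assms(2)]] g(2)])
qed

section \<open>Differentiable curves in \<open>L\<^sup>2(0,l)\<close>\<close>

text \<open>The defect between the difference quotient of a curve, with values \<open>f\<close> at
  time \<open>s\<close> and \<open>g\<close> at time \<open>t\<close>, and the candidate derivative
  \<open>h\<close>. At \<open>s = t\<close> the division by zero gives \<open>- h\<close>, which a
  punctured limit never sees.\<close>

definition quot_err :: "real \<Rightarrow> real \<Rightarrow> (real \<Rightarrow> real) \<Rightarrow> (real \<Rightarrow> real) \<Rightarrow> (real \<Rightarrow> real) \<Rightarrow> real \<Rightarrow> real"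
  where "quot_err s t f g h y = (f y - g y) / (s - t) - h y"

definition L2_deriv :: "real \<Rightarrow> (real \<Rightarrow> real \<Rightarrow> real) \<Rightarrow> (real \<Rightarrow> real \<Rightarrow> real) \<Rightarrow> bool"
  where "L2_deriv l u u' \<longleftrightarrow> (\<forall>t\<ge>0. u t \<in> L2_space l \<and> u' t \<in> L2_space l \<and>
     ((\<lambda>s. L2_norm l (quot_err s t (u s) (u t) (u' t))) \<longlongrightarrow> 0) (at t within {0..}))"

text \<open>Being a linear combination with coefficients independent of \<open>y\<close>, the defect
  commutes with spatial differentiation and inherits the closure properties of
  \<open>L2_space\<close> and \<open>H1\<close>.\<close>

lemma quot_err_lincomb:
  "quot_err s t f g h = (\<lambda>y. 1 * ((1 / (s - t)) * f y + (- 1 / (s - t)) * g y) + (- 1) * h y)"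
  by (simp add: quot_err_def fun_eq_iff diff_divide_distrib)

lemma L2_quot_err:
  "f \<in> L2_space l \<Longrightarrow> g \<in> L2_space l \<Longrightarrow> h \<in> L2_space l \<Longrightarrow> quot_err s t f g h \<in> L2_space l"
  unfolding quot_err_lincomb by (intro L2_lincomb)

lemma H1_quot_err:
  assumes "H1 l 0 f f'" "H1 l 0 g g'" "H1 l 0 h h'"
  shows "H1 l 0 (quot_err s t f g h) (quot_err s t f' g' h')"
  using H1_lincomb[OF H1_lincomb[OF assms(1,2), of "1/(s-t)" "-1/(s-t)"] assms(3), of 1 "-1"]
  by (simp only: quot_err_lincomb mult_zero_right add_0_right)

lemma L2_deriv_inner:
  assumes u: "L2_deriv l u u'" and v: "L2_deriv l v v'" and t: "t \<ge> 0"
  shows "((\<lambda>s. L2_inner l (u s) (v s)) has_real_derivative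
     L2_inner l (u' t) (v t) + L2_inner l (u t) (v' t)) (at t within {0..})"
  unfolding has_field_derivative_iff
proof (rule LIM_zero_cancel, rule Lim_null_comparison)
  let ?U = "\<lambda>s. quot_err s t (u s) (u t) (u' t)" and ?V = "\<lambda>s. quot_err s t (v s) (v t) (v' t)"
  let ?n = "L2_norm l"
  let ?e = "\<lambda>s. ?n (?U s) * ?n (v t) + ?n (u t) * ?n (?V s)
      + \<bar>s - t\<bar> * ((?n (?U s) + ?n (u' t)) * (?n (?V s) + ?n (v' t)))"
  have U0: "((\<lambda>s. ?n (?U s)) \<longlongrightarrow> 0) (at t within {0..})"
    and V0: "((\<lambda>s. ?n (?V s)) \<longlongrightarrow> 0) (at t within {0..})"
    using u v t by (auto simp: L2_deriv_def)
  have "((\<lambda>s. \<bar>s - t\<bar>) \<longlongrightarrow> \<bar>t - t\<bar>) (at t within {0..})"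
    by (intro tendsto_intros)
  then have "(?e \<longlongrightarrow> 0 * ?n (v t) + ?n (u t) * 0 + 0 * ((0 + ?n (u' t)) * (0 + ?n (v' t)))) (at t within {0..})"
    by (intro tendsto_intros U0 V0) auto
  then show "(?e \<longlongrightarrow> 0) (at t within {0..})" by simp
  have "\<forall>\<^sub>F s in at t within {0..}. s \<in> {0..} \<and> s \<noteq> t"
    by (auto simp: eventually_at_filter)
  then show "\<forall>\<^sub>F s in at t within {0..}. norm ((L2_inner l (u s) (v s) - L2_inner l (u t) (v t)) / (s - t)
      - (L2_inner l (u' t) (v t) + L2_inner l (u t) (v' t))) \<le> ?e s"
  proof eventually_elim
    fix s :: real assume s: "s \<in> {0..} \<and> s \<noteq> t"
    then have L: "u s \<in> L2_space l" "u t \<in> L2_space l" "u' t \<in> L2_space l"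
      "v s \<in> L2_space l" "v t \<in> L2_space l" "v' t \<in> L2_space l"
      using u v t by (auto simp: L2_deriv_def)
    \<comment> \<open>\<open>p\<close> and \<open>q\<close> are the difference quotients of
      \<open>u\<close> and \<open>v\<close>. In terms of them the product expands exactly, and after
      division by \<open>s - t\<close> the only quadratic term still carries a factor
      \<open>s - t\<close>.\<close>
    define p where "p y = ?U s y + u' t y" for y
    define q where "q y = ?V s y + v' t y" for y
    have UV: "?U s \<in> L2_space l" "?V s \<in> L2_space l" using L by (simp_all add: L2_quot_err)
    have pq: "p \<in> L2_space l" "q \<in> L2_space l"
      unfolding p_def[abs_def] q_def[abs_def] using L UV by (simp_all add: L2_add)
    have us: "u s = (\<lambda>y. 1 * u t y + (s - t) * p y)" and vs: "v s = (\<lambda>y. 1 * v t y + (s - t) * q y)"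
      using s by (auto simp: p_def q_def quot_err_def fun_eq_iff)
    have "L2_inner l (u s) (v s) = L2_inner l (u t) (v t)
        + (s - t) * (L2_inner l p (v t) + L2_inner l (u t) q + (s - t) * L2_inner l p q)"
      unfolding us vs using L pq
      by (simp only: L2_inner_lincomb_left L2_inner_lincomb_right L2_lincomb) (simp add: algebra_simps)
    moreover have "L2_inner l p (v t) = L2_inner l (?U s) (v t) + L2_inner l (u' t) (v t)"
      using L2_inner_lincomb_left[OF UV(1) L(3) L(5), of 1 1] by (simp add: p_def[abs_def])
    moreover have "L2_inner l (u t) q = L2_inner l (u t) (?V s) + L2_inner l (u t) (v' t)"
      using L2_inner_lincomb_right[OF UV(2) L(6) L(2), of 1 1] by (simp add: q_def[abs_def])
    ultimately have "(L2_inner l (u s) (v s) - L2_inner l (u t) (v t)) / (s - t)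
        - (L2_inner l (u' t) (v t) + L2_inner l (u t) (v' t))
      = L2_inner l (?U s) (v t) + L2_inner l (u t) (?V s) + (s - t) * L2_inner l p q"
      using s by simp
    moreover have "\<bar>L2_inner l (?U s) (v t)\<bar> \<le> ?n (?U s) * ?n (v t)" "\<bar>L2_inner l (u t) (?V s)\<bar> \<le> ?n (u t) * ?n (?V s)"
      using L UV by (simp_all add: L2_Cauchy_Schwarz)
    moreover have "\<bar>(s - t) * L2_inner l p q\<bar> \<le> \<bar>s - t\<bar> * ((?n (?U s) + ?n (u' t)) * (?n (?V s) + ?n (v' t)))"
    proof -
      have "\<bar>L2_inner l p q\<bar> \<le> ?n p * ?n q" by (rule L2_Cauchy_Schwarz[OF pq])
      also have "\<dots> \<le> (?n (?U s) + ?n (u' t)) * (?n (?V s) + ?n (v' t))"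
        unfolding p_def[abs_def] q_def[abs_def]
        by (intro mult_mono L2_norm_triangle UV L add_nonneg_nonneg L2_norm_nonneg)
      finally show ?thesis by (simp add: abs_mult mult_left_mono)
    qed
    ultimately show "norm ((L2_inner l (u s) (v s) - L2_inner l (u t) (v t)) / (s - t)
      - (L2_inner l (u' t) (v t) + L2_inner l (u t) (v' t))) \<le> ?e s"
      by (simp only: real_norm_def)
  qed
qed

lemma C1_curve_L2_deriv:
  assumes "C1_curve (L2_norm l) (L2_space l) d d'" shows "L2_deriv l d d'"
proof -
  have "(d s - d t) /\<^sub>R (s - t) - d' t = quot_err s t (d s) (d t) (d' t)" for s t
    by (simp add: fun_eq_iff quot_err_def scaleR_fun_def divide_inverse mult.commute)
  then show ?thesis
    using assms by (simp add: C1_curve_def C0_curve_def L2_deriv_def)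
qed

lemma L2_deriv_continuous_norm:
  assumes "L2_deriv l d d'" shows "continuous_on {0..} (\<lambda>t. L2_norm l (d t))"
proof -
  have "continuous_on {0..} (\<lambda>t. L2_inner l (d t) (d t))"
    using L2_deriv_inner[OF assms assms] by (intro DERIV_continuous_on) auto
  then have "continuous_on {0..} (\<lambda>t. sqrt (L2_inner l (d t) (d t)))"
    by (intro continuous_intros)
  then show ?thesis by (simp add: L2_norm_nonneg flip: L2_norm_sq)
qed

section \<open>States\<close>

text \<open>The part of membership in the state space that calculations need, in terms of
  primitives. It is applied to a state and also to its velocities, in the form
  \<open>(v, v', \<psi>, \<psi>')\<close>, so that both obey the same Poincare bounds.\<close>

definition regular :: "real \<Rightarrow> state \<Rightarrow> bool"
  where "regular l = (\<lambda>(f, g, h, z). H1 l 0 f (weak_deriv l f) \<and>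
     H1 l 0 (weak_deriv l f) (weak_deriv l (weak_deriv l f)) \<and> g \<in> L2_space l \<and>
     H1 l 0 h (weak_deriv l h) \<and> z \<in> L2_space l)"

lemma Sobolev_1_H1_0:
  "f \<in> Sobolev l (Suc 0) \<Longrightarrow> pt_val l f 0 = 0 \<Longrightarrow> l > 0 \<Longrightarrow> H1 l 0 f (weak_deriv l f)"
  using Sobolev_1_H1[of f l] by simp

lemma state_space_regular:
  assumes "X \<in> state_space l" "l > 0" shows "regular l X"
  using assms unfolding state_space_def regular_def One_nat_def
  by (auto simp del: Sobolev.simps intro: Sobolev_1_H1_0 Sobolev_2_weak_deriv)

lemma state_norm_sq:
  assumes "regular l (f, g, h, z)" "l > 0" "a1 > 0" "a2 > 0"
  shows "(state_norm l a1 a2 (f, g, h, z))\<^sup>2 = a1 * (L2_norm l (weak_deriv l (weak_deriv l f)))\<^sup>2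
      + (L2_norm l g)\<^sup>2 + a2 * (L2_norm l (weak_deriv l h))\<^sup>2 + (L2_norm l z)\<^sup>2"
proof -
  have L: "weak_deriv l (weak_deriv l f) \<in> L2_space l" "g \<in> L2_space l" "weak_deriv l h \<in> L2_space l" "z \<in> L2_space l"
    using assms(1) by (auto simp: regular_def H1_def)
  have "0 \<le> (LINT y|lebesgue_on {0<..<l}. a1 * (weak_deriv l (weak_deriv l f) y)\<^sup>2 + (g y)\<^sup>2
      + a2 * (weak_deriv l h y)\<^sup>2 + (z y)\<^sup>2)"
    using assms by (intro integral_nonneg_AE AE_I2) simp
  moreover have "(LINT y|lebesgue_on {0<..<l}. a1 * (weak_deriv l (weak_deriv l f) y)\<^sup>2 + (g y)\<^sup>2
      + a2 * (weak_deriv l h y)\<^sup>2 + (z y)\<^sup>2) = a1 * (LINT y|lebesgue_on {0<..<l}. (weak_deriv l (weak_deriv l f) y)\<^sup>2)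
      + (LINT y|lebesgue_on {0<..<l}. (g y)\<^sup>2) + a2 * (LINT y|lebesgue_on {0<..<l}. (weak_deriv l h y)\<^sup>2)
      + (LINT y|lebesgue_on {0<..<l}. (z y)\<^sup>2)"
    using L by (simp add: L2_space_def)
  ultimately show ?thesis
    by (simp add: state_norm_def L2_norm_def)
qed

lemma state_norm_nonneg:
  "a1 > 0 \<Longrightarrow> a2 > 0 \<Longrightarrow> 0 \<le> state_norm l a1 a2 X"
  unfolding state_norm_def by (cases X) (auto intro!: integral_nonneg_AE)

lemma state_norm_state_eq:
  assumes "state_eq l X Y" "regular l X" "regular l Y" "l > 0" "a1 > 0" "a2 > 0"
  shows "state_norm l a1 a2 X = state_norm l a1 a2 Y"
proof -
  obtain f g h z f' g' h' z' where X: "X = (f, g, h, z)" "Y = (f', g', h', z')"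
    by (metis prod_cases4)
  have e: "ae_eq l f f'" "ae_eq l g g'" "ae_eq l h h'" "ae_eq l z z'"
    using assms(1) by (auto simp: X state_eq_def)
  have "g \<in> L2_space l" "z \<in> L2_space l" using assms(2) by (auto simp: X regular_def)
  then have "(state_norm l a1 a2 X)\<^sup>2 = (state_norm l a1 a2 Y)\<^sup>2"
    using assms e weak_deriv_ae_eq[OF e(1)] weak_deriv_ae_eq[OF e(3)] L2_norm_ae_eq[OF e(2)] L2_norm_ae_eq[OF e(4)]
    by (simp add: X state_norm_sq)
  then show ?thesis
    using assms by (simp add: power2_eq_iff_nonneg state_norm_nonneg)
qed

text \<open>Weak differentiation commutes with difference quotients almost everywhere, so the state
  norm of the defect splits into the norms of the defects of its four components. This carries
  differentiability of a curve of states over to the components.\<close>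

lemma state_quot_err:
  assumes reg: "regular l (f, g, h, z)" "regular l (f', g', h', z')" "regular l (f'', g'', h'', z'')"
    and l: "l > 0" and Y: "Y = (quot_err s t f f' f'', quot_err s t g g' g'', quot_err s t h h' h'', quot_err s t z z' z'')"
  shows "regular l Y"
    and "a1 > 0 \<Longrightarrow> a2 > 0 \<Longrightarrow> (state_norm l a1 a2 Y)\<^sup>2 =
      a1 * (L2_norm l (quot_err s t (weak_deriv l (weak_deriv l f)) (weak_deriv l (weak_deriv l f'))
              (weak_deriv l (weak_deriv l f''))))\<^sup>2
      + (L2_norm l (quot_err s t g g' g''))\<^sup>2
      + a2 * (L2_norm l (quot_err s t (weak_deriv l h) (weak_deriv l h') (weak_deriv l h'')))\<^sup>2
      + (L2_norm l (quot_err s t z z' z''))\<^sup>2"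
proof -
  let ?D = "weak_deriv l"
  let ?f = "quot_err s t f f' f''" and ?h = "quot_err s t h h' h''"
  let ?f1 = "quot_err s t (?D f) (?D f') (?D f'')" and ?h1 = "quot_err s t (?D h) (?D h') (?D h'')"
  let ?f2 = "quot_err s t (?D (?D f)) (?D (?D f')) (?D (?D f''))"
  have 1: "H1 l 0 ?f ?f1" "H1 l 0 ?f1 ?f2" "H1 l 0 ?h ?h1"
    using reg by (auto simp: regular_def H1_quot_err)
  have e1: "ae_eq l (?D ?f) ?f1" "ae_eq l (?D ?h) ?h1" "ae_eq l (?D ?f1) ?f2"
    using 1 l by (auto intro: H1_weak_deriv)
  have e2: "?D (?D ?f) = ?D ?f1" by (rule weak_deriv_ae_eq[OF e1(1)])
  have "H1 l 0 ?f (?D ?f)" "H1 l 0 (?D ?f) (?D (?D ?f))" "H1 l 0 ?h (?D ?h)"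
    using H1_ae_eq[OF 1(1) ae_eq_refl ae_eq_sym[OF e1(1)]] H1_ae_eq[OF 1(3) ae_eq_refl ae_eq_sym[OF e1(2)]]
      H1_ae_eq[OF 1(2) ae_eq_sym[OF e1(1)] ae_eq_sym[OF e1(3)]] e2 by auto
  then show r: "regular l Y"
    using reg by (auto simp: Y regular_def L2_quot_err)
  have "L2_norm l (?D (?D ?f)) = L2_norm l ?f2" "L2_norm l (?D ?h) = L2_norm l ?h1"
    using L2_norm_ae_eq[OF ae_eq_sym[OF e1(3)]] L2_norm_ae_eq[OF ae_eq_sym[OF e1(2)]] 1 e2
    by (auto simp: H1_def)
  then show "(state_norm l a1 a2 Y)\<^sup>2 = a1 * (L2_norm l ?f2)\<^sup>2 + (L2_norm l (quot_err s t g g' g''))\<^sup>2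
      + a2 * (L2_norm l ?h1)\<^sup>2 + (L2_norm l (quot_err s t z z' z''))\<^sup>2" if "a1 > 0" "a2 > 0"
    using state_norm_sq[OF r[unfolded Y] l that] by (simp add: Y)
qed

text \<open>The state norm sees only \<open>w_yy\<close> and \<open>\<phi>_y\<close>, not
  \<open>w\<close> and \<open>\<phi>\<close>. Differentiability of the latter in L2 follows from
  Poincare's inequality, applied twice to the beam and once to the string.\<close>

lemma state_curve_L2_deriv:
  assumes C: "C1_curve (state_norm l a1 a2) (state_space l) X X'"
    and X: "\<And>t. X t = (w t, v t, \<phi> t, \<psi> t)" and X': "\<And>t. X' t = (w' t, v' t, \<phi>' t, \<psi>' t)"
    and pos: "l > 0" "a1 > 0" "a2 > 0"
  shows "L2_deriv l w w'" "L2_deriv l v v'" "L2_deriv l \<phi> \<phi>'" "L2_deriv l \<psi> \<psi>'"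
    "L2_deriv l (\<lambda>t. weak_deriv l (weak_deriv l (w t))) (\<lambda>t. weak_deriv l (weak_deriv l (w' t)))"
    "L2_deriv l (\<lambda>t. weak_deriv l (\<phi> t)) (\<lambda>t. weak_deriv l (\<phi>' t))"
proof -
  let ?D = "weak_deriv l"
  have reg: "regular l (w t, v t, \<phi> t, \<psi> t)" "regular l (w' t, v' t, \<phi>' t, \<psi>' t)" if "t \<ge> 0" for t
    using C that pos by (auto simp: C1_curve_def C0_curve_def X[symmetric] X'[symmetric] intro!: state_space_regular)
  have L: "w t \<in> L2_space l" "w' t \<in> L2_space l" "v t \<in> L2_space l" "v' t \<in> L2_space l"
    "\<phi> t \<in> L2_space l" "\<phi>' t \<in> L2_space l" "\<psi> t \<in> L2_space l" "\<psi>' t \<in> L2_space l"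
    "?D (?D (w t)) \<in> L2_space l" "?D (?D (w' t)) \<in> L2_space l" "?D (\<phi> t) \<in> L2_space l" "?D (\<phi>' t) \<in> L2_space l"
    if "t \<ge> 0" for t
    using reg[OF that] H1_L2[OF _ pos(1)] H1_L2_deriv unfolding regular_def by blast+
  define Y where "Y s t = (quot_err s t (w s) (w t) (w' t), quot_err s t (v s) (v t) (v' t),
      quot_err s t (\<phi> s) (\<phi> t) (\<phi>' t), quot_err s t (\<psi> s) (\<psi> t) (\<psi>' t))" for s t
  have "(X s - X t) /\<^sub>R (s - t) - X' t = Y s t" for s t
    by (simp add: X X' Y_def fun_eq_iff quot_err_def scaleR_fun_def divide_inverse mult.commute)
  then have lim: "((\<lambda>s. state_norm l a1 a2 (Y s t)) \<longlongrightarrow> 0) (at t within {0..})" if "t \<ge> 0" for t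
    using C that by (simp add: C1_curve_def)
  have *: "((\<lambda>s. L2_norm l (u s)) \<longlongrightarrow> 0) (at t within {0..})"
    if "t \<ge> 0" and b: "\<And>s. s \<ge> 0 \<Longrightarrow> L2_norm l (u s) \<le> k * state_norm l a1 a2 (Y s t)" for u k t
  proof (rule Lim_null_comparison)
    show "\<forall>\<^sub>F s in at t within {0..}. norm (L2_norm l (u s)) \<le> k * state_norm l a1 a2 (Y s t)"
      using b by (auto simp: eventually_at_filter L2_norm_nonneg)
    show "((\<lambda>s. k * state_norm l a1 a2 (Y s t)) \<longlongrightarrow> 0) (at t within {0..})"
      using tendsto_mult_right_zero[OF lim[OF that(1)]] by simp
  qed
  have q: "L2_norm l (quot_err s t (?D (?D (w s))) (?D (?D (w t))) (?D (?D (w' t)))) \<le> 1 / sqrt a1 * state_norm l a1 a2 (Y s t)" (is ?q1)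
    "L2_norm l (quot_err s t (v s) (v t) (v' t)) \<le> 1 * state_norm l a1 a2 (Y s t)" (is ?q2)
    "L2_norm l (quot_err s t (?D (\<phi> s)) (?D (\<phi> t)) (?D (\<phi>' t))) \<le> 1 / sqrt a2 * state_norm l a1 a2 (Y s t)" (is ?q3)
    "L2_norm l (quot_err s t (\<psi> s) (\<psi> t) (\<psi>' t)) \<le> 1 * state_norm l a1 a2 (Y s t)" (is ?q4)
    if "s \<ge> 0" "t \<ge> 0" for s t
  proof -
    have N: "0 \<le> state_norm l a1 a2 (Y s t)" using pos by (intro state_norm_nonneg)
    note sq = state_quot_err(2)[OF reg(1)[OF that(1)] reg(1)[OF that(2)] reg(2)[OF that(2)] pos(1) Y_def pos(2,3)]
    have *: "L2_norm l f \<le> 1 / sqrt a * state_norm l a1 a2 (Y s t)"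
      if "a * (L2_norm l f)\<^sup>2 \<le> (state_norm l a1 a2 (Y s t))\<^sup>2" "a > 0" for a f
    proof -
      have "sqrt a * L2_norm l f \<le> state_norm l a1 a2 (Y s t)"
        by (rule power2_le_imp_le) (use that N in \<open>auto simp: power_mult_distrib\<close>)
      then show ?thesis using \<open>a > 0\<close> by (simp add: field_simps)
    qed
    show ?q1 by (rule *) (use sq pos in auto)
    show ?q3 by (rule *) (use sq pos in auto)
    show ?q2 using *[of 1 "quot_err s t (v s) (v t) (v' t)"] sq pos by simp
    show ?q4 using *[of 1 "quot_err s t (\<psi> s) (\<psi> t) (\<psi>' t)"] sq pos by simp
  qed
  have qw: "L2_norm l (quot_err s t (w s) (w t) (w' t)) \<le> (l * (l * (1 / sqrt a1))) * state_norm l a1 a2 (Y s t)" (is ?A)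
    and qp: "L2_norm l (quot_err s t (\<phi> s) (\<phi> t) (\<phi>' t)) \<le> (l * (1 / sqrt a2)) * state_norm l a1 a2 (Y s t)" (is ?B)
    if "s \<ge> 0" "t \<ge> 0" for s t
  proof -
    note r = reg(1)[OF that(1)] reg(1)[OF that(2)] reg(2)[OF that(2)]
    have "L2_norm l (quot_err s t (w s) (w t) (w' t)) \<le> l * L2_norm l (quot_err s t (?D (w s)) (?D (w t)) (?D (w' t)))"
      using r by (intro H1_0_norm H1_quot_err pos) (auto simp: regular_def)
    also have "\<dots> \<le> l * (l * L2_norm l (quot_err s t (?D (?D (w s))) (?D (?D (w t))) (?D (?D (w' t)))))"
      using r pos by (intro mult_left_mono H1_0_norm H1_quot_err) (auto simp: regular_def)
    also have "\<dots> \<le> l * (l * (1 / sqrt a1 * state_norm l a1 a2 (Y s t)))"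
      using q(1)[OF that] pos by (intro mult_left_mono) auto
    finally show ?A by (simp add: mult.assoc)
    have "L2_norm l (quot_err s t (\<phi> s) (\<phi> t) (\<phi>' t)) \<le> l * L2_norm l (quot_err s t (?D (\<phi> s)) (?D (\<phi> t)) (?D (\<phi>' t)))"
      using r by (intro H1_0_norm H1_quot_err pos) (auto simp: regular_def)
    also have "\<dots> \<le> l * (1 / sqrt a2 * state_norm l a1 a2 (Y s t))"
      using q(3)[OF that] pos by (intro mult_left_mono) auto
    finally show ?B by (simp add: mult.assoc)
  qed
  show "L2_deriv l w w'" "L2_deriv l v v'" "L2_deriv l \<phi> \<phi>'" "L2_deriv l \<psi> \<psi>'"
    "L2_deriv l (\<lambda>t. ?D (?D (w t))) (\<lambda>t. ?D (?D (w' t)))" "L2_deriv l (\<lambda>t. ?D (\<phi> t)) (\<lambda>t. ?D (\<phi>' t))"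
    unfolding L2_deriv_def using L *[OF _ q(1)] *[OF _ q(2)] *[OF _ q(3)] *[OF _ q(4)] *[OF _ qw] *[OF _ qp]
    by auto
qed

text \<open>Two integrations by parts. The clamped end kills the boundary terms at 0 and the
  vanishing moment one of those at \<open>l\<close>; what survives is the value
  \<open>prim l f1 l\<close> of \<open>f\<close> at the tip times the shear force, which is where
  the boundary disturbance enters.\<close>

lemma beam_pairing:
  assumes "H1 l 0 f f1" "H1 l 0 f1 f2" "m \<in> Sobolev l 2" "pt_val l m l = 0" "l > 0"
  shows "L2_inner l f (weak_deriv l (weak_deriv l m)) =
    prim l f1 l * pt_val l (weak_deriv l m) l + L2_inner l f2 m"
proof -
  let ?D = "weak_deriv l"
  have m: "H1 l (pt_val l m 0) m (?D m)" "H1 l (pt_val l (?D m) 0) (?D m) (?D (?D m))"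
    using Sobolev_2_weak_deriv[OF assms(3,5)] Sobolev_1_H1 assms(5) by auto
  have "L2_inner l f (?D (?D m)) + L2_inner l f1 (?D m) = prim l f1 l * pt_val l (?D m) l"
    using H1_by_parts[OF assms(1) m(2) assms(5)] H1_pt_val[OF m(2) assms(5), of l] assms(5) by simp
  moreover have "L2_inner l f1 (?D m) + L2_inner l f2 m = 0"
    using H1_by_parts[OF assms(2) m(1) assms(5)] H1_pt_val[OF m(1) assms(5), of l] assms(4,5) by simp
  ultimately show ?thesis by simp
qed

lemma string_pairing:
  assumes "H1 l 0 h h1" "T \<in> Sobolev l 1" "l > 0"
  shows "L2_inner l h (weak_deriv l T) = prim l h1 l * pt_val l T l - L2_inner l h1 T"
proof -
  have T: "H1 l (pt_val l T 0) T (weak_deriv l T)" using assms by (simp add: Sobolev_1_H1)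
  show ?thesis
    using H1_by_parts[OF assms(1) T assms(3)] H1_pt_val[OF T assms(3), of l] assms(3) by simp
qed

section \<open>The Lyapunov function\<close>

text \<open>Young's inequality by completing the square. The discriminant form allows both weights
  to be prescribed in advance.\<close>

lemma mult_le_weighted_squares:
  fixes k x y A B :: real
  assumes "k\<^sup>2 \<le> 4 * x * y" "x > 0"
  shows "k * A * B \<le> x * A\<^sup>2 + y * B\<^sup>2"
proof -
  have "0 \<le> (2 * x * A - k * B)\<^sup>2 + (4 * x * y - k\<^sup>2) * B\<^sup>2"
    using assms by (intro add_nonneg_nonneg mult_nonneg_nonneg) auto
  also have "\<dots> = 4 * x * (x * A\<^sup>2 + y * B\<^sup>2 - k * A * B)"
    by (simp add: power2_eq_square algebra_simps)
  finally show ?thesis using \<open>x > 0\<close> by (simp add: zero_le_mult_iff)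
qed

text \<open>Here the smallness hypotheses do their work. \<open>A\<close>, \<open>B\<close> and
  \<open>Q\<close> stand for the norms of \<open>w_tyy\<close>, \<open>\<phi>_ty\<close> and
  \<open>\<phi>_y\<close>. The factor \<open>l^3\<close> is the product of the Poincare constants
  \<open>l^2\<close> for the beam velocity and \<open>l\<close> for the string;
  \<open>l\<^sup>2 * B\<^sup>2\<close> and \<open>c2 * l\<^sup>2 * Q\<^sup>2\<close> bound the terms
  \<open>\<phi>_t\<^sup>2\<close> and \<open>c2 * \<phi>\<^sup>2\<close> that the string multiplier
  creates.\<close>

lemma dissipation_form:
  fixes l a2 b1 b2 c1 c2 p1 p2 q1 q2 K n3 n4 :: real
  assumes l: "l > 0" and nn: "c1 \<ge> 0" "c2 \<ge> 0" "p1 \<ge> 0" "p2 \<le> 0" "q1 \<le> 0" "q2 \<ge> 0" "K \<ge> 0" "n3 \<ge> 0" "n4 \<ge> 0"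
    and ha: "sqrt (2 * l) * (1 + l * sqrt l) * (1 + K) * (1 + c1 + c2 - p2 + q2 + n4) < a2"
    and hb1: "l^2 * sqrt (2 * l) * (1 + l^3) * (c1 + p1 - q1 + q2 + n3) < 2 * b1"
    and hb2: "sqrt (2 * l) * (1 + l^3) * (1 + p1 + c2 - p2 + q2 + n4) < b2"
  shows "\<exists>\<delta>>0. \<forall>A B Q. \<delta> * (A\<^sup>2 + B\<^sup>2 + Q\<^sup>2) \<le> b1 * A\<^sup>2 + (b2 - l\<^sup>2) * B\<^sup>2 + (a2 - c2 * l\<^sup>2) * Q\<^sup>2
      - (c1 + q2) * (l^3 * A * Q) - (p1 + q2) * (l^3 * A * B)"
proof -
  define G R where "G = sqrt (2 * l)" and "R = sqrt l"
  \<comment> \<open>The geometric factors of the hypotheses on \<open>b1\<close> (up to the factor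
    4), \<open>a2\<close> and \<open>b2\<close>. They double as the weights in Young's inequality,
    by \<open>xy\<close> and \<open>xz\<close>, and the last two dominate \<open>l\<^sup>2\<close>,
    by \<open>y2\<close> and \<open>z2\<close>.\<close>
  define x where "x = l^2 * G * (1 + l^3) / 4"
  define y where "y = G * (1 + l * R)"
  define z where "z = G * (1 + l^3)"
  have g: "G > 0" "G * G = 2 * l" and r: "R > 0" "R * R = l" and l3: "l^3 > 0"
    using l by (simp_all add: G_def R_def)
  have pos: "x > 0" "y > 0" "z > 0"
    unfolding x_def y_def z_def using g r l l3 by (auto intro!: mult_pos_pos add_pos_pos)
  have "1 \<le> 1 + K" using nn by simp
  have y2: "l\<^sup>2 \<le> y"
  proof (rule power2_le_imp_le)
    have "(l\<^sup>2)\<^sup>2 \<le> 2 * l * (l * R)\<^sup>2"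
      using l r(2) by (simp add: power2_eq_square algebra_simps)
    also have "\<dots> \<le> 2 * l * (1 + l * R)\<^sup>2"
      using l r by (intro mult_left_mono power_mono) auto
    also have "\<dots> = y\<^sup>2" unfolding g(2)[symmetric] by (simp add: y_def power2_eq_square mult_ac)
    finally show "(l\<^sup>2)\<^sup>2 \<le> y\<^sup>2" .
  qed (use pos in simp)
  have z2: "l\<^sup>2 \<le> z"
  proof (rule power2_le_imp_le)
    have "4 * l^3 \<le> (1 + l^3)\<^sup>2" using sum_squares_bound[of 1 "l^3"] by (simp add: power2_sum)
    then have "2 * l * (4 * l^3) \<le> 2 * l * (1 + l^3)\<^sup>2" using l by (intro mult_left_mono) auto
    moreover have "(l\<^sup>2)\<^sup>2 \<le> 2 * l * (4 * l^3)" using l by (simp add: power2_eq_square power3_eq_cube algebra_simps)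
    ultimately have "(l\<^sup>2)\<^sup>2 \<le> 2 * l * (1 + l^3)\<^sup>2" by simp
    also have "\<dots> = z\<^sup>2" unfolding g(2)[symmetric] by (simp add: z_def power2_eq_square mult_ac)
    finally show "(l\<^sup>2)\<^sup>2 \<le> z\<^sup>2" .
  qed (use pos in simp)
  have xy: "(l^3)\<^sup>2 \<le> 4 * x * y"
  proof -
    have "4 * x * y = l\<^sup>2 * (G * G) * ((1 + l^3) * (1 + l * R))" by (simp add: x_def y_def algebra_simps)
    also have "\<dots> = 2 * l^3 * ((1 + l^3) * (1 + l * R))" unfolding g(2) by (simp add: power2_eq_square power3_eq_cube)
    also have "\<dots> \<ge> 2 * l^3 * (l^3 * 1)" using l r l3 by (intro mult_left_mono mult_mono) auto
    finally have "2 * l^3 * (l^3 * 1) \<le> 4 * x * y" .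
    moreover have "(l^3)\<^sup>2 \<le> 2 * l^3 * (l^3 * 1)" using mult_pos_pos[OF l3 l3] unfolding power2_eq_square by linarith
    ultimately show ?thesis by linarith
  qed
  have xz: "(l^3)\<^sup>2 \<le> 4 * x * z"
  proof -
    have "4 * x * z = l\<^sup>2 * (G * G) * ((1 + l^3) * (1 + l^3))" by (simp add: x_def z_def algebra_simps)
    also have "\<dots> = 2 * l^3 * ((1 + l^3) * (1 + l^3))" unfolding g(2) by (simp add: power2_eq_square power3_eq_cube)
    also have "\<dots> \<ge> 2 * l^3 * (l^3 * 1)" using l r l3 by (intro mult_left_mono mult_mono) auto
    finally have "2 * l^3 * (l^3 * 1) \<le> 4 * x * z" .
    moreover have "(l^3)\<^sup>2 \<le> 2 * l^3 * (l^3 * 1)" using mult_pos_pos[OF l3 l3] unfolding power2_eq_square by linarith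
    ultimately show ?thesis by linarith
  qed
  \<comment> \<open>The diagonal coefficients left over once both mixed terms are split. The first
    is charged \<open>q2\<close> twice because \<open>A\<close> occurs in both mixed terms.\<close>
  define \<alpha> where "\<alpha> = b1 - (c1 + p1 + 2 * q2) * x"
  define \<beta> where "\<beta> = b2 - l\<^sup>2 - (p1 + q2) * z"
  define \<gamma> where "\<gamma> = a2 - c2 * l\<^sup>2 - (c1 + q2) * y"
  have "(c1 + p1 + 2 * q2) * x \<le> (2 * (c1 + p1 - q1 + q2 + n3)) * x"
    using nn pos by (intro mult_right_mono) auto
  also have "\<dots> < b1" using hb1 by (simp add: x_def G_def algebra_simps)
  finally have "\<alpha> > 0" by (simp add: \<alpha>_def)
  have "l\<^sup>2 + (p1 + q2) * z \<le> z * (1 + p1 + q2)" using z2 by (simp add: algebra_simps)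
  also have "\<dots> \<le> z * (1 + p1 + c2 - p2 + q2 + n4)" using nn pos by (intro mult_left_mono) auto
  also have "\<dots> < b2" using hb2 by (simp add: z_def G_def)
  finally have "\<beta> > 0" by (simp add: \<beta>_def)
  have "c2 * l\<^sup>2 + (c1 + q2) * y \<le> y * (c1 + c2 + q2)"
    using mult_left_mono[OF y2 nn(2)] by (simp add: algebra_simps)
  also have "\<dots> \<le> y * (1 + c1 + c2 - p2 + q2 + n4)" using nn pos by (intro mult_left_mono) auto
  also have "\<dots> \<le> (1 + K) * (y * (1 + c1 + c2 - p2 + q2 + n4))"
    using mult_right_mono[OF \<open>1 \<le> 1 + K\<close>, of "y * (1 + c1 + c2 - p2 + q2 + n4)"] nn pos by simp
  also have "\<dots> < a2" using ha by (simp add: y_def mult_ac G_def R_def)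
  finally have "\<gamma> > 0" by (simp add: \<gamma>_def)
  define \<delta> where "\<delta> = min \<alpha> (min \<beta> \<gamma>)"
  have "\<delta> > 0" using \<open>\<alpha> > 0\<close> \<open>\<beta> > 0\<close> \<open>\<gamma> > 0\<close> by (simp add: \<delta>_def)
  moreover have "\<delta> * (A\<^sup>2 + B\<^sup>2 + Q\<^sup>2) \<le> b1 * A\<^sup>2 + (b2 - l\<^sup>2) * B\<^sup>2 + (a2 - c2 * l\<^sup>2) * Q\<^sup>2
      - (c1 + q2) * (l^3 * A * Q) - (p1 + q2) * (l^3 * A * B)" for A B Q
  proof -
    have "\<delta> * A\<^sup>2 + \<delta> * B\<^sup>2 + \<delta> * Q\<^sup>2 \<le> \<alpha> * A\<^sup>2 + \<beta> * B\<^sup>2 + \<gamma> * Q\<^sup>2"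
      by (intro add_mono mult_right_mono) (auto simp: \<delta>_def)
    moreover have "(c1 + q2) * (l^3 * A * Q) \<le> (c1 + q2) * (x * A\<^sup>2 + y * Q\<^sup>2)"
      using nn by (intro mult_left_mono mult_le_weighted_squares xy pos) auto
    moreover have "(p1 + q2) * (l^3 * A * B) \<le> (p1 + q2) * (x * A\<^sup>2 + z * B\<^sup>2)"
      using nn by (intro mult_left_mono mult_le_weighted_squares xz pos) auto
    ultimately show ?thesis
      by (simp add: \<alpha>_def \<beta>_def \<gamma>_def algebra_simps)
  qed
  ultimately show ?thesis by blast
qed

text \<open>The multiplier \<open>w\<^sub>t + \<epsilon> w\<close> is used for the beam with a small \<open>\<epsilon>\<close>, which keeps the coupling terms it
  produces negligible, but the multiplier \<open>\<phi>\<^sub>t + \<phi>\<close> for the string, since the term \<open>c1 \<phi>\<close> in the beam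
  equation has to be absorbed by the resulting dissipation of \<open>\<phi>\<^sub>y\<close>. The constant \<open>\<delta>\<close> is that of
  lemma \<open>dissipation_form\<close>.\<close>

locale beam_string =
  fixes l a1 a2 b1 b2 c1 c2 p1 p2 q1 q2 \<delta> \<epsilon> :: real
  assumes pos: "l > 0" "a1 > 0" "a2 > 0" "b1 > 0" "b2 > 0" "\<delta> > 0" "\<epsilon> > 0"
    and signs: "c1 \<ge> 0" "c2 \<ge> 0" "p1 \<ge> 0" "p2 \<le> 0" "q1 \<le> 0" "q2 \<ge> 0"
    and form: "\<And>A B Q. \<delta> * (A\<^sup>2 + B\<^sup>2 + Q\<^sup>2) \<le> b1 * A\<^sup>2 + (b2 - l\<^sup>2) * B\<^sup>2 + (a2 - c2 * l\<^sup>2) * Q\<^sup>2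
      - (c1 + q2) * (l^3 * A * Q) - (p1 + q2) * (l^3 * A * B)"
    and eps: "\<epsilon> \<le> 1" "4 * (\<epsilon> * l^4) \<le> a1" "\<epsilon> * l^4 \<le> \<delta> / 2"
      "\<epsilon> * ((c1 * l^3)\<^sup>2 / a1) \<le> \<delta> / 2" "\<epsilon> * ((p1 * l^3)\<^sup>2 / a1) \<le> \<delta> / 2"
begin

abbreviation D :: "(real \<Rightarrow> real) \<Rightarrow> real \<Rightarrow> real"
  where "D \<equiv> weak_deriv l"

abbreviation nrm :: "(real \<Rightarrow> real) \<Rightarrow> real"
  where "nrm \<equiv> L2_norm l"

abbreviation ip :: "(real \<Rightarrow> real) \<Rightarrow> (real \<Rightarrow> real) \<Rightarrow> real"
  where "ip \<equiv> L2_inner l"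

text \<open>Each correction is chosen so that its time derivative cancels one product of a position
  and a velocity: \<open>- c2 / 2\<close> that of \<open>c2 \<phi>\<close> tested with
  \<open>\<phi>_t\<close>; \<open>b1 / 2\<close> and \<open>- q1 / 2\<close> the damping terms
  tested with \<open>\<epsilon> w\<close>; \<open>b2 / 2\<close> and \<open>- p2 / 2\<close> those
  tested with \<open>\<phi>\<close>. By the signs of \<open>q1\<close> and \<open>p2\<close>, only
  the correction with \<open>c2\<close> can be negative.\<close>

definition V :: "state \<Rightarrow> real"
  where "V = (\<lambda>(f, g, h, z).
     1/2 * (ip g g + a1 * ip (D (D f)) (D (D f)) + ip z z + a2 * ip (D h) (D h) - c2 * ip h h)
     + \<epsilon> * (ip f g + b1 / 2 * ip (D (D f)) (D (D f)) - q1 / 2 * ip f f)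
     + ip h z + b2 / 2 * ip (D h) (D h) - p2 / 2 * ip h h)"

text \<open>The derivative of \<open>V\<close> at the first state in the direction of the second,
  with the symmetric products already merged.\<close>

definition rate :: "state \<Rightarrow> state \<Rightarrow> real"
  where "rate = (\<lambda>(f, g, h, z) (f', g', h', z').
     ip g g' + a1 * ip (D (D f)) (D (D f')) + ip z z' + a2 * ip (D h) (D h') - c2 * ip h h'
     + \<epsilon> * (ip f' g + ip f g' + b1 * ip (D (D f)) (D (D f')) - q1 * ip f f')
     + ip h' z + ip h z' + b2 * ip (D h) (D h') - p2 * ip h h')"

lemma V_DERIV:
  assumes C: "C1_curve (state_norm l a1 a2) (state_space l) X X'" and t: "t \<ge> 0"
  shows "((\<lambda>s. V (X s)) has_real_derivative rate (X t) (X' t)) (at t within {0..})"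
proof -
  define w v \<phi> \<psi> where "w t = fst (X t)" and "v t = fst (snd (X t))"
    and "\<phi> t = fst (snd (snd (X t)))" and "\<psi> t = snd (snd (snd (X t)))" for t
  define w' v' \<phi>' \<psi>' where "w' t = fst (X' t)" and "v' t = fst (snd (X' t))"
    and "\<phi>' t = fst (snd (snd (X' t)))" and "\<psi>' t = snd (snd (snd (X' t)))" for t
  have X: "X t = (w t, v t, \<phi> t, \<psi> t)" "X' t = (w' t, v' t, \<phi>' t, \<psi>' t)" for t
    by (simp_all add: w_def v_def \<phi>_def \<psi>_def w'_def v'_def \<phi>'_def \<psi>'_def)
  note d = state_curve_L2_deriv[OF C X pos(1-3)]
  note i = L2_deriv_inner[OF d(2) d(2) t] L2_deriv_inner[OF d(5) d(5) t] L2_deriv_inner[OF d(4) d(4) t]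
    L2_deriv_inner[OF d(6) d(6) t] L2_deriv_inner[OF d(3) d(3) t] L2_deriv_inner[OF d(1) d(2) t]
    L2_deriv_inner[OF d(1) d(1) t] L2_deriv_inner[OF d(3) d(4) t]
  have "((\<lambda>s. V (X s)) has_real_derivative
    1/2 * ((ip (v' t) (v t) + ip (v t) (v' t)) + a1 * (ip (D (D (w' t))) (D (D (w t))) + ip (D (D (w t))) (D (D (w' t))))
        + (ip (\<psi>' t) (\<psi> t) + ip (\<psi> t) (\<psi>' t)) + a2 * (ip (D (\<phi>' t)) (D (\<phi> t)) + ip (D (\<phi> t)) (D (\<phi>' t)))
        - c2 * (ip (\<phi>' t) (\<phi> t) + ip (\<phi> t) (\<phi>' t)))
     + \<epsilon> * ((ip (w' t) (v t) + ip (w t) (v' t)) + b1 / 2 * (ip (D (D (w' t))) (D (D (w t))) + ip (D (D (w t))) (D (D (w' t))))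
        - q1 / 2 * (ip (w' t) (w t) + ip (w t) (w' t)))
     + (ip (\<phi>' t) (\<psi> t) + ip (\<phi> t) (\<psi>' t)) + b2 / 2 * (ip (D (\<phi>' t)) (D (\<phi> t)) + ip (D (\<phi> t)) (D (\<phi>' t)))
     - p2 / 2 * (ip (\<phi>' t) (\<phi> t) + ip (\<phi> t) (\<phi>' t))) (at t within {0..})"
    unfolding V_def X split by (intro DERIV_add DERIV_diff DERIV_cmult i)
  then show ?thesis
    by (rule DERIV_cong)
       (simp add: rate_def X L2_inner_commute[of l "v' t"] L2_inner_commute[of l "\<psi>' t" "\<psi> t"]
        L2_inner_commute[of l "D (D (w' t))"] L2_inner_commute[of l "D (\<phi>' t)"]
        L2_inner_commute[of l "\<phi>' t" "\<phi> t"] L2_inner_commute[of l "w' t" "w t"] field_simps)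
qed

section \<open>Equivalence of the Lyapunov function with the squared norm\<close>

lemma ip_le: "f \<in> L2_space l \<Longrightarrow> g \<in> L2_space l \<Longrightarrow> nrm f \<le> x \<Longrightarrow> nrm g \<le> y \<Longrightarrow> \<bar>ip f g\<bar> \<le> x * y"
  by (rule order_trans[OF L2_Cauchy_Schwarz mult_mono]) (auto intro: order_trans[OF L2_norm_nonneg])

lemma regular_bounds:
  assumes "regular l (f, g, h, z)"
  shows "f \<in> L2_space l" "g \<in> L2_space l" "h \<in> L2_space l" "z \<in> L2_space l"
    "D (D f) \<in> L2_space l" "D h \<in> L2_space l"
    "nrm f \<le> l\<^sup>2 * nrm (D (D f))" "nrm h \<le> l * nrm (D h)"
proof -
  have h: "H1 l 0 f (D f)" "H1 l 0 (D f) (D (D f))" "H1 l 0 h (D h)"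
    using assms by (auto simp: regular_def)
  show "f \<in> L2_space l" "g \<in> L2_space l" "h \<in> L2_space l" "z \<in> L2_space l" "D (D f) \<in> L2_space l" "D h \<in> L2_space l"
    using assms h H1_L2[OF _ pos(1)] H1_L2_deriv unfolding regular_def by blast+
  show "nrm h \<le> l * nrm (D h)" by (rule H1_0_norm[OF h(3) pos(1)])
  have "nrm f \<le> l * nrm (D f)" by (rule H1_0_norm[OF h(1) pos(1)])
  also have "\<dots> \<le> l * (l * nrm (D (D f)))"
    using H1_0_norm[OF h(2) pos(1)] pos by (intro mult_left_mono) auto
  finally show "nrm f \<le> l\<^sup>2 * nrm (D (D f))" by (simp add: power2_eq_square mult.assoc)
qed

lemma form_diag: "\<delta> \<le> b2 - l\<^sup>2" "\<delta> \<le> a2 - c2 * l\<^sup>2"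
  using form[of 0 1 0] form[of 0 0 1] by simp_all

text \<open>The product \<open>ip h z\<close> carries no small factor. Young's inequality absorbs it
  at the cost of \<open>(l\<^sup>2 + \<delta>) / 2\<close> in front of the square of
  \<open>D h\<close>, which the correction with \<open>b2\<close> pays since
  \<open>b2 \<ge> l\<^sup>2 + \<delta>\<close>; from
  \<open>a2 - c2 * l\<^sup>2 \<ge> \<delta>\<close> a coefficient \<open>\<delta> / 2\<close> is
  left.\<close>

lemma V_lower:
  "\<exists>c>0. \<forall>X. regular l X \<longrightarrow> c * (state_norm l a1 a2 X)\<^sup>2 \<le> V X"
proof -
  \<comment> \<open>\<open>\<theta> * (l\<^sup>2 + \<delta>) = l\<^sup>2\<close> is the equality
    case of the discriminant condition in Young's inequality, and \<open>\<theta> < 1\<close> saves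
    a part of the kinetic energy of the string.\<close>
  define \<theta> where "\<theta> = l\<^sup>2 / (l\<^sup>2 + \<delta>)"
  have l2: "l\<^sup>2 > 0" using pos by simp
  have \<theta>: "\<theta> > 0" "\<theta> < 1" using pos l2 add_pos_pos[OF l2 pos(6)] by (simp_all add: \<theta>_def)
  have "l\<^sup>2 + \<delta> \<noteq> 0" using l2 pos by linarith
  then have \<theta>d: "\<theta> * (l\<^sup>2 + \<delta>) = l\<^sup>2" by (simp add: \<theta>_def)
  define c where "c = min (1/4) (min ((1 - \<theta>) / 2) (\<delta> / (2 * a2)))"
  have "c > 0" using pos \<theta> by (simp add: c_def)
  have cs: "c \<le> 1/4" "c \<le> (1 - \<theta>) / 2" "c \<le> \<delta> / (2 * a2)"
    unfolding c_def by (rule min.coboundedI1 min.coboundedI2 order_refl)+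
  have "c * (state_norm l a1 a2 X)\<^sup>2 \<le> V X" if r: "regular l X" for X
  proof -
    obtain f g h z where X: "X = (f, g, h, z)" by (metis prod_cases4)
    note b = regular_bounds[OF r[unfolded X]]
    let ?P = "nrm (D (D f))" and ?n = "nrm g" and ?Q = "nrm (D h)" and ?m = "nrm z"
    have nn: "?P \<ge> 0" "?n \<ge> 0" "?Q \<ge> 0" "?m \<ge> 0" by (simp_all add: L2_norm_nonneg)
    have "\<bar>\<epsilon> * ip f g\<bar> \<le> \<epsilon> * (l\<^sup>2 * ?P * ?n)"
      using ip_le[OF b(1,2,7) order_refl] pos by (simp add: abs_mult)
    also have "\<dots> = (\<epsilon> * l\<^sup>2) * ?n * ?P" by simp
    also have "\<dots> \<le> 1/4 * ?n\<^sup>2 + (\<epsilon> * l\<^sup>2)\<^sup>2 * ?P\<^sup>2"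
      by (rule mult_le_weighted_squares) auto
    also have "(\<epsilon> * l\<^sup>2)\<^sup>2 * ?P\<^sup>2 \<le> a1 / 4 * ?P\<^sup>2"
    proof (rule mult_right_mono)
      \<comment> \<open>One factor \<open>\<epsilon>\<close> is spent through
        \<open>\<epsilon> \<le> 1\<close>, the other through
        \<open>4 * (\<epsilon> * l^4) \<le> a1\<close>.\<close>
      have "(\<epsilon> * l\<^sup>2)\<^sup>2 = \<epsilon> * (\<epsilon> * l^4)" by (simp add: power2_eq_square power4_eq_xxxx)
      also have "\<dots> \<le> 1 * (\<epsilon> * l^4)" using eps pos by (intro mult_right_mono) auto
      finally show "(\<epsilon> * l\<^sup>2)\<^sup>2 \<le> a1 / 4" using eps by simp
    qed simp
    finally have 1: "- (\<epsilon> * ip f g) \<le> 1/4 * ?n\<^sup>2 + a1 / 4 * ?P\<^sup>2" by simp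
    have "\<bar>ip h z\<bar> \<le> l * ?Q * ?m" by (rule ip_le[OF b(3,4,8) order_refl])
    also have "\<dots> = l * ?m * ?Q" by simp
    also have "\<dots> \<le> \<theta> / 2 * ?m\<^sup>2 + (l\<^sup>2 + \<delta>) / 2 * ?Q\<^sup>2"
      using \<theta>(1) \<theta>d by (intro mult_le_weighted_squares) auto
    finally have 2: "- ip h z \<le> \<theta> / 2 * ?m\<^sup>2 + (l\<^sup>2 + \<delta>) / 2 * ?Q\<^sup>2" by simp
    have "ip h h \<le> (l * ?Q)\<^sup>2" using b(8) by (simp add: power_mono L2_norm_nonneg flip: L2_norm_sq)
    then have 3: "c2 * ip h h \<le> c2 * l\<^sup>2 * ?Q\<^sup>2"
      using mult_left_mono[OF _ signs(2)] by (simp add: power_mult_distrib mult.assoc)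
    have "0 \<le> b1 * ?P\<^sup>2" "q1 * (nrm f)\<^sup>2 \<le> 0" using pos signs by (simp_all add: mult_nonpos_nonneg)
    then have "0 \<le> b1 / 2 * ?P\<^sup>2 - q1 / 2 * (nrm f)\<^sup>2" by simp
    then have 4: "0 \<le> \<epsilon> * (b1 / 2 * ip (D (D f)) (D (D f)) - q1 / 2 * ip f f)" "0 \<le> - (p2 / 2 * ip h h)"
      using pos mult_nonpos_nonneg[OF signs(4), of "(nrm h)\<^sup>2"] unfolding L2_norm_sq[symmetric]
      by (simp_all add: mult_nonpos_nonneg)
    have "V X \<ge> 1/4 * ?n\<^sup>2 + a1 / 4 * ?P\<^sup>2 + (1 - \<theta>) / 2 * ?m\<^sup>2 + (a2 + b2 - c2 * l\<^sup>2 - (l\<^sup>2 + \<delta>)) / 2 * ?Q\<^sup>2"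
      using 1 2 3 4 by (simp add: V_def X L2_norm_sq[symmetric] field_simps)
    moreover have "\<delta> / 2 * ?Q\<^sup>2 \<le> (a2 + b2 - c2 * l\<^sup>2 - (l\<^sup>2 + \<delta>)) / 2 * ?Q\<^sup>2"
      using form_diag by (intro mult_right_mono) auto
    moreover have "c * (state_norm l a1 a2 X)\<^sup>2 = c * (a1 * ?P\<^sup>2) + c * ?n\<^sup>2 + c * (a2 * ?Q\<^sup>2) + c * ?m\<^sup>2"
      using state_norm_sq[OF r[unfolded X] pos(1-3)] by (simp add: X algebra_simps)
    moreover have "c * (a1 * ?P\<^sup>2) \<le> 1/4 * (a1 * ?P\<^sup>2)" "c * ?n\<^sup>2 \<le> 1/4 * ?n\<^sup>2"
      "c * ?m\<^sup>2 \<le> (1 - \<theta>) / 2 * ?m\<^sup>2" "c * (a2 * ?Q\<^sup>2) \<le> \<delta> / (2 * a2) * (a2 * ?Q\<^sup>2)"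
      by (rule mult_right_mono, rule cs, use pos in simp)+
    moreover have "\<delta> / (2 * a2) * (a2 * ?Q\<^sup>2) = \<delta> / 2 * ?Q\<^sup>2" using pos by simp
    ultimately show ?thesis by linarith
  qed
  with \<open>c > 0\<close> show ?thesis by blast
qed

text \<open>A crude bound; it uses the norms without the weights \<open>a1\<close> and
  \<open>a2\<close> because it is to be compared with the dissipation, which comes in this
  form.\<close>

lemma V_upper:
  "\<exists>K>0. \<forall>f g h z. regular l (f, g, h, z) \<longrightarrow>
     V (f, g, h, z) \<le> K * ((nrm (D (D f)))\<^sup>2 + (nrm g)\<^sup>2 + (nrm (D h))\<^sup>2 + (nrm z)\<^sup>2)"
proof -
  define K where "K = 1 + a1 + a2 + b1 + b2 + (l\<^sup>2)\<^sup>2 + l\<^sup>2 - q1 * (l\<^sup>2)\<^sup>2 - p2 * l\<^sup>2"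
  have pieces: "0 \<le> - (q1 * (l\<^sup>2)\<^sup>2)" "0 \<le> - (p2 * l\<^sup>2)"
    using signs by (simp_all add: mult_nonpos_nonneg)
  then have "K > 0" unfolding K_def using pos zero_le_power2[of "l\<^sup>2"] zero_le_power2[of l] by linarith
  moreover have "V (f, g, h, z) \<le> K * ((nrm (D (D f)))\<^sup>2 + (nrm g)\<^sup>2 + (nrm (D h))\<^sup>2 + (nrm z)\<^sup>2)"
    if r: "regular l (f, g, h, z)" for f g h z
  proof -
    note b = regular_bounds[OF r]
    let ?P = "nrm (D (D f))" and ?n = "nrm g" and ?Q = "nrm (D h)" and ?m = "nrm z"
    have nn: "?P \<ge> 0" "?n \<ge> 0" "?Q \<ge> 0" "?m \<ge> 0" by (simp_all add: L2_norm_nonneg)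
    have "ip f g \<le> l\<^sup>2 * ?P * ?n" using ip_le[OF b(1,2,7) order_refl] by simp
    also have "\<dots> \<le> (l\<^sup>2)\<^sup>2 * ?P\<^sup>2 + 1/4 * ?n\<^sup>2" using pos by (intro mult_le_weighted_squares) auto
    finally have fg: "ip f g \<le> (l\<^sup>2)\<^sup>2 * ?P\<^sup>2 + 1/4 * ?n\<^sup>2" .
    have "ip h z \<le> l * ?Q * ?m" using ip_le[OF b(3,4,8) order_refl] by simp
    also have "\<dots> \<le> l\<^sup>2 * ?Q\<^sup>2 + 1/4 * ?m\<^sup>2" using pos by (intro mult_le_weighted_squares) auto
    finally have hz: "ip h z \<le> l\<^sup>2 * ?Q\<^sup>2 + 1/4 * ?m\<^sup>2" .
    have "ip f f \<le> (l\<^sup>2 * ?P)\<^sup>2" using b(7) by (simp add: power_mono L2_norm_nonneg flip: L2_norm_sq)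
    then have ff: "- q1 * ip f f \<le> - q1 * ((l\<^sup>2)\<^sup>2 * ?P\<^sup>2)"
      using signs by (intro mult_left_mono) (auto simp: power_mult_distrib)
    have "ip h h \<le> (l * ?Q)\<^sup>2" using b(8) by (simp add: power_mono L2_norm_nonneg flip: L2_norm_sq)
    then have hh: "- p2 * ip h h \<le> - p2 * (l\<^sup>2 * ?Q\<^sup>2)"
      using signs by (intro mult_left_mono) (auto simp: power_mult_distrib)
    have hh0: "0 \<le> c2 * ip h h" using signs by (simp flip: L2_norm_sq)
    let ?E = "(l\<^sup>2)\<^sup>2 * ?P\<^sup>2 + 1/4 * ?n\<^sup>2 + b1 / 2 * ?P\<^sup>2 + 1/2 * (- q1 * ((l\<^sup>2)\<^sup>2 * ?P\<^sup>2))"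
    have "ip f g + b1 / 2 * ip (D (D f)) (D (D f)) - q1 / 2 * ip f f \<le> ?E"
      using fg ff by (simp add: L2_norm_sq[symmetric])
    moreover have "0 \<le> ?E"
      using pos signs by (intro add_nonneg_nonneg mult_nonneg_nonneg) auto
    ultimately have e: "\<epsilon> * (ip f g + b1 / 2 * ip (D (D f)) (D (D f)) - q1 / 2 * ip f f) \<le> 1 * ?E"
      using eps(1) pos(7) order_trans[OF mult_left_mono mult_right_mono] by (meson less_imp_le)
    have "V (f, g, h, z) \<le> 1/2 * (?n\<^sup>2 + a1 * ?P\<^sup>2 + ?m\<^sup>2 + a2 * ?Q\<^sup>2) + ?E
        + (l\<^sup>2 * ?Q\<^sup>2 + 1/4 * ?m\<^sup>2) + b2 / 2 * ?Q\<^sup>2 + 1/2 * (- p2 * (l\<^sup>2 * ?Q\<^sup>2))"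
      using e hz hh hh0 by (simp add: V_def L2_norm_sq[symmetric] field_simps)
    also have "\<dots> = (a1/2 + (l\<^sup>2)\<^sup>2 + b1/2 - q1 * (l\<^sup>2)\<^sup>2 / 2) * ?P\<^sup>2 + 3/4 * ?n\<^sup>2
        + (a2/2 + l\<^sup>2 + b2/2 - p2 * l\<^sup>2/2) * ?Q\<^sup>2 + 3/4 * ?m\<^sup>2"
      by (simp add: field_simps)
    also have "\<dots> \<le> K * ?P\<^sup>2 + K * ?n\<^sup>2 + K * ?Q\<^sup>2 + K * ?m\<^sup>2"
      using pos pieces zero_le_power2[of "l\<^sup>2"] zero_le_power2[of l] unfolding K_def
      by (intro add_mono mult_right_mono zero_le_power2) linarith+
    finally show ?thesis by (simp add: algebra_simps)
  qed
  ultimately show ?thesis by blast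
qed

text \<open>The equations of motion replace \<open>v'\<close> and \<open>\<psi>'\<close>, and the
  pairings integrate by parts. The elastic energies cancel against the elastic parts of moment and
  tension, the corrections in \<open>V\<close> cancel their counterparts, and what remains is
  dissipation, couplings, disturbances and boundary terms, where for instance
  \<open>prim l (D v) l\<close> is the tip velocity of the beam.\<close>

lemma rate_identity:
  assumes dom: "(w, v, \<phi>, \<psi>) \<in> A_domain l a1 a2 b1 b2"
    and st: "(w', v', \<phi>', \<psi>') \<in> state_space l"
    and bd: "B_op l a1 a2 b1 b2 (w, v, \<phi>, \<psi>) = (e3, e4)"
    and ev: "evolution_eqs l a1 a2 b1 b2 c1 c2 p1 p2 q1 q2 e1 e2 (w, v, \<phi>, \<psi>) (w', v', \<phi>', \<psi>')"
    and e: "e1 \<in> L2_space l" "e2 \<in> L2_space l"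
  shows "regular l (w, v, \<phi>, \<psi>)" "regular l (v, v', \<psi>, \<psi>')"
    and "rate (w, v, \<phi>, \<psi>) (w', v', \<phi>', \<psi>') =
      - prim l (D v) l * e3 - b1 * ip (D (D v)) (D (D v))
      + c1 * ip v \<phi> + p1 * ip v \<psi> + q1 * ip v v + ip v e1
      + prim l (D \<psi>) l * e4 - b2 * ip (D \<psi>) (D \<psi>) + p2 * ip \<psi> \<psi> + q2 * ip \<psi> v + ip \<psi> e2
      + \<epsilon> * (ip v v - prim l (D w) l * e3 - a1 * ip (D (D w)) (D (D w)) + c1 * ip w \<phi> + p1 * ip w \<psi> + ip w e1)
      + ip \<psi> \<psi> + prim l (D \<phi>) l * e4 - a2 * ip (D \<phi>) (D \<phi>) + c2 * ip \<phi> \<phi> + q2 * ip \<phi> v + ip \<phi> e2"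
proof -
  let ?m = "moment l a1 b1 w v" and ?T = "tension l a2 b2 \<phi> \<psi>"
  show r: "regular l (w, v, \<phi>, \<psi>)"
    using dom by (intro state_space_regular pos) (simp add: A_domain_def)
  have r': "regular l (w', v', \<phi>', \<psi>')" by (rule state_space_regular[OF st pos(1)])
  have V: "H1 l 0 v (D v)" "H1 l 0 (D v) (D (D v))" "H1 l 0 \<psi> (D \<psi>)"
    using dom pos unfolding A_domain_def One_nat_def
    by (auto simp del: Sobolev.simps intro: Sobolev_1_H1_0 Sobolev_2_weak_deriv)
  have W: "H1 l 0 w (D w)" "H1 l 0 (D w) (D (D w))" "H1 l 0 \<phi> (D \<phi>)"
    using r by (auto simp: regular_def)
  have L': "v' \<in> L2_space l" "\<psi>' \<in> L2_space l" "w' \<in> L2_space l" "\<phi>' \<in> L2_space l"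
    by (rule regular_bounds[OF r'])+
  show rv: "regular l (v, v', \<psi>, \<psi>')"
    using V L' by (simp add: regular_def)
  note b = regular_bounds[OF r] and bv = regular_bounds[OF rv]
  have ev1: "ae_eq l w' v" "ae_eq l \<phi>' \<psi>"
    and ev2: "ae_eq l (\<lambda>y. v' y + D (D ?m) y) (\<lambda>y. c1 * \<phi> y + p1 * \<psi> y + q1 * v y + e1 y)"
    and ev3: "ae_eq l (\<lambda>y. \<psi>' y - D ?T y) (\<lambda>y. c2 * \<phi> y + p2 * \<psi> y + q2 * v y + e2 y)"
    using ev by (auto simp: evolution_eqs_def)
  \<comment> \<open>The equations give \<open>w' = v\<close> only almost everywhere, but the chosen
    weak derivatives coincide literally.\<close>
  have D': "D w' = D v" "D \<phi>' = D \<psi>" using ev1 weak_deriv_ae_eq by auto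
  have mS: "?m \<in> Sobolev l 2" "pt_val l ?m l = 0" "pt_val l (D ?m) l = e3"
    and TS: "?T \<in> Sobolev l 1" "pt_val l ?T l = e4"
    using dom bd by (auto simp: A_domain_def B_op_def)
  have m2: "D (D ?m) \<in> L2_space l"
    by (rule H1_L2_deriv[OF Sobolev_1_H1[OF Sobolev_2_weak_deriv(2)[OF mS(1) pos(1)] pos(1)]])
  have T1: "D ?T \<in> L2_space l"
    using Sobolev_1_H1[of ?T l] TS(1) pos by (auto intro: H1_L2_deriv)
  \<comment> \<open>The beam equation tested with an arbitrary \<open>u\<close>; it is needed for
    \<open>u = v\<close> (energy) and \<open>u = w\<close> (multiplier). The string is treated
    likewise.\<close>
  have ipv: "ip u v' = c1 * ip u \<phi> + p1 * ip u \<psi> + q1 * ip u v + ip u e1 - ip u (D (D ?m))" if u: "u \<in> L2_space l" for u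
  proof -
    have "ip u v' + ip u (D (D ?m)) = ip u (\<lambda>y. v' y + D (D ?m) y)"
      using u L' m2 by (simp add: L2_inner_add_right)
    also have "\<dots> = ip u (\<lambda>y. c1 * \<phi> y + p1 * \<psi> y + q1 * v y + e1 y)"
      using u L' m2 by (intro L2_inner_ae_eq ae_eq_refl ev2 L2_add)
    also have "\<dots> = c1 * ip u \<phi> + p1 * ip u \<psi> + q1 * ip u v + ip u e1"
      using u b e by (simp add: L2_inner_add_right L2_add L2_scale L2_inner_scale_right)
    finally show ?thesis by simp
  qed
  have ip\<psi>: "ip u \<psi>' = c2 * ip u \<phi> + p2 * ip u \<psi> + q2 * ip u v + ip u e2 + ip u (D ?T)" if u: "u \<in> L2_space l" for u
  proof -
    have "ip u \<psi>' - ip u (D ?T) = ip u (\<lambda>y. \<psi>' y - D ?T y)"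
      using u L' T1 by (simp add: L2_inner_diff_right)
    also have "\<dots> = ip u (\<lambda>y. c2 * \<phi> y + p2 * \<psi> y + q2 * v y + e2 y)"
      using u L' T1 by (intro L2_inner_ae_eq ae_eq_refl ev3 L2_diff)
    also have "\<dots> = c2 * ip u \<phi> + p2 * ip u \<psi> + q2 * ip u v + ip u e2"
      using u b e by (simp add: L2_inner_add_right L2_add L2_scale L2_inner_scale_right)
    finally show ?thesis by simp
  qed
  have ipm: "ip u ?m = a1 * ip u (D (D w)) + b1 * ip u (D (D v))" if "u \<in> L2_space l" for u
    unfolding moment_def using that b bv by (simp add: L2_inner_lincomb_right)
  have ipT: "ip u ?T = a2 * ip u (D \<phi>) + b2 * ip u (D \<psi>)" if "u \<in> L2_space l" for u
    unfolding tension_def using that b bv by (simp add: L2_inner_lincomb_right)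
  have pair: "ip v (D (D ?m)) = prim l (D v) l * e3 + a1 * ip (D (D v)) (D (D w)) + b1 * ip (D (D v)) (D (D v))"
    "ip w (D (D ?m)) = prim l (D w) l * e3 + a1 * ip (D (D w)) (D (D w)) + b1 * ip (D (D w)) (D (D v))"
    "ip \<psi> (D ?T) = prim l (D \<psi>) l * e4 - (a2 * ip (D \<psi>) (D \<phi>) + b2 * ip (D \<psi>) (D \<psi>))"
    "ip \<phi> (D ?T) = prim l (D \<phi>) l * e4 - (a2 * ip (D \<phi>) (D \<phi>) + b2 * ip (D \<phi>) (D \<psi>))"
    using beam_pairing[OF V(1,2) mS(1,2) pos(1)] beam_pairing[OF W(1,2) mS(1,2) pos(1)]
      string_pairing[OF V(3) TS(1) pos(1)] string_pairing[OF W(3) TS(1) pos(1)] mS TS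
      ipm[OF bv(5)] ipm[OF b(5)] ipT[OF bv(6)] ipT[OF b(6)] by simp_all
  have ae: "ip w' v = ip v v" "ip \<phi>' \<psi> = ip \<psi> \<psi>" "ip \<phi> \<phi>' = ip \<phi> \<psi>" "ip w w' = ip w v"
    using L2_inner_ae_eq[OF ev1(1) ae_eq_refl L'(3) b(2)] L2_inner_ae_eq[OF ev1(2) ae_eq_refl L'(4) b(4)]
      L2_inner_ae_eq[OF ae_eq_refl ev1(2) b(3) L'(4)] L2_inner_ae_eq[OF ae_eq_refl ev1(1) b(1) L'(3)] by auto
  show "rate (w, v, \<phi>, \<psi>) (w', v', \<phi>', \<psi>') =
      - prim l (D v) l * e3 - b1 * ip (D (D v)) (D (D v))
      + c1 * ip v \<phi> + p1 * ip v \<psi> + q1 * ip v v + ip v e1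
      + prim l (D \<psi>) l * e4 - b2 * ip (D \<psi>) (D \<psi>) + p2 * ip \<psi> \<psi> + q2 * ip \<psi> v + ip \<psi> e2
      + \<epsilon> * (ip v v - prim l (D w) l * e3 - a1 * ip (D (D w)) (D (D w)) + c1 * ip w \<phi> + p1 * ip w \<psi> + ip w e1)
      + ip \<psi> \<psi> + prim l (D \<phi>) l * e4 - a2 * ip (D \<phi>) (D \<phi>) + c2 * ip \<phi> \<phi> + q2 * ip \<phi> v + ip \<phi> e2"
    unfolding rate_def split ae D' ipv[OF b(1)] ipv[OF b(2)] ip\<psi>[OF b(3)] ip\<psi>[OF b(4)] pair
    using L2_inner_commute[of l "D (D v)" "D (D w)"] L2_inner_commute[of l "D \<psi>" "D \<phi>"]
      L2_inner_commute[of l \<psi> \<phi>]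
    by (simp add: algebra_simps)
qed

text \<open>The quadratic form yields dissipation \<open>\<delta>\<close> in \<open>A\<close>,
  \<open>B\<close> and \<open>Q\<close>, and the beam multiplier yields
  \<open>\<epsilon> * a1\<close> in \<open>P\<close>. Half of each pays for the couplings that carry
  a factor \<open>\<epsilon>\<close>; the disturbances are then absorbed by Young's
  inequality.\<close>

lemma rate_bound:
  "\<exists>\<eta>>0. \<exists>C>0. \<forall>w v \<phi> \<psi> w' v' \<phi>' \<psi>' e1 e2 e3 e4.
     (w, v, \<phi>, \<psi>) \<in> A_domain l a1 a2 b1 b2 \<longrightarrow> (w', v', \<phi>', \<psi>') \<in> state_space l \<longrightarrow>
     B_op l a1 a2 b1 b2 (w, v, \<phi>, \<psi>) = (e3, e4) \<longrightarrow>
     evolution_eqs l a1 a2 b1 b2 c1 c2 p1 p2 q1 q2 e1 e2 (w, v, \<phi>, \<psi>) (w', v', \<phi>', \<psi>') \<longrightarrow>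
     e1 \<in> L2_space l \<longrightarrow> e2 \<in> L2_space l \<longrightarrow>
     rate (w, v, \<phi>, \<psi>) (w', v', \<phi>', \<psi>') \<le>
       - \<eta> * ((nrm (D (D v)))\<^sup>2 + (nrm (D \<psi>))\<^sup>2 + (nrm (D (D w)))\<^sup>2 + (nrm (D \<phi>))\<^sup>2)
       + C * ((nrm e1)\<^sup>2 + (nrm e2)\<^sup>2 + e3\<^sup>2 + e4\<^sup>2)"
proof -
  \<comment> \<open>Each of the four squares meets two disturbance products, each costing
    \<open>\<eta> / 4\<close>. With this choice at least \<open>\<eta> / 2\<close> of the
    dissipation survives in all four.\<close>
  define \<eta> where "\<eta> = min (\<delta> / 4) (\<epsilon> * a1 / 2)"
  \<comment> \<open>A common majorant of the Poincare constants \<open>l\<close> (string) and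
    \<open>l\<^sup>2\<close> (beam) and of the trace constants \<open>sqrt l\<close> and
    \<open>sqrt l * l\<close>.\<close>
  define k where "k = 1 + l + l\<^sup>2 + sqrt l * l + sqrt l"
  have \<eta>: "\<eta> > 0" "\<eta> \<le> \<delta> / 4" "\<eta> \<le> \<epsilon> * a1 / 2" using pos by (simp_all add: \<eta>_def)
  have k: "l \<le> k" "l\<^sup>2 \<le> k" "sqrt l * l \<le> k" "sqrt l \<le> k" "k > 0"
    unfolding k_def using pos by (auto intro!: add_nonneg_nonneg add_pos_nonneg)
  \<comment> \<open>Young's inequality with weight \<open>\<eta> / 4\<close> costs
    \<open>k\<^sup>2 / \<eta> = C / 2\<close> for the disturbance, and each disturbance occurs in
    two products.\<close>
  define C where "C = 4 * (k\<^sup>2 / (2 * \<eta>))"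
  have "C > 0" using k \<eta> by (simp add: C_def)
  have "rate (w, v, \<phi>, \<psi>) (w', v', \<phi>', \<psi>') \<le>
       - (\<eta> / 2) * ((nrm (D (D v)))\<^sup>2 + (nrm (D \<psi>))\<^sup>2 + (nrm (D (D w)))\<^sup>2 + (nrm (D \<phi>))\<^sup>2)
       + C * ((nrm e1)\<^sup>2 + (nrm e2)\<^sup>2 + e3\<^sup>2 + e4\<^sup>2)"
    if "(w, v, \<phi>, \<psi>) \<in> A_domain l a1 a2 b1 b2" "(w', v', \<phi>', \<psi>') \<in> state_space l"
      "B_op l a1 a2 b1 b2 (w, v, \<phi>, \<psi>) = (e3, e4)"
      "evolution_eqs l a1 a2 b1 b2 c1 c2 p1 p2 q1 q2 e1 e2 (w, v, \<phi>, \<psi>) (w', v', \<phi>', \<psi>')"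
      and e: "e1 \<in> L2_space l" "e2 \<in> L2_space l"
    for w v \<phi> \<psi> w' v' \<phi>' \<psi>' e1 e2 e3 e4
  proof -
    note id = rate_identity[OF that]
    note b = regular_bounds[OF id(1)] and bv = regular_bounds[OF id(2)]
    define A B P Q where "A = nrm (D (D v))" and "B = nrm (D \<psi>)" and "P = nrm (D (D w))" and "Q = nrm (D \<phi>)"
    have nn: "A \<ge> 0" "B \<ge> 0" "P \<ge> 0" "Q \<ge> 0"
      by (simp_all add: A_def B_def P_def Q_def L2_norm_nonneg)
    have bd: "nrm w \<le> l\<^sup>2 * P" "nrm \<phi> \<le> l * Q" "nrm v \<le> l\<^sup>2 * A" "nrm \<psi> \<le> l * B"
      using b(7,8) bv(7,8) by (simp_all add: A_def B_def P_def Q_def)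
    have ip1: "ip v \<phi> \<le> l^3 * A * Q" "ip \<phi> v \<le> l^3 * A * Q" "ip v \<psi> \<le> l^3 * A * B" "ip \<psi> v \<le> l^3 * A * B"
      "ip w \<phi> \<le> l^3 * P * Q" "ip w \<psi> \<le> l^3 * P * B"
      using ip_le[OF b(2,3) bd(3,2)] ip_le[OF b(3,2) bd(2,3)] ip_le[OF b(2,4) bd(3,4)] ip_le[OF b(4,2) bd(4,3)]
        ip_le[OF b(1,3) bd(1,2)] ip_le[OF b(1,4) bd(1,4)]
      by (simp_all add: power2_eq_square power3_eq_cube mult_ac)
    have ip2: "ip v v \<le> l^4 * A\<^sup>2" "ip \<psi> \<psi> \<le> l\<^sup>2 * B\<^sup>2" "ip \<phi> \<phi> \<le> l\<^sup>2 * Q\<^sup>2"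
      using ip_le[OF b(2,2) bd(3,3)] ip_le[OF b(4,4) bd(4,4)] ip_le[OF b(3,3) bd(2,2)]
      by (simp_all add: power2_eq_square power4_eq_xxxx mult_ac)
    have eq: "ip (D (D v)) (D (D v)) = A\<^sup>2" "ip (D \<psi>) (D \<psi>) = B\<^sup>2" "ip (D (D w)) (D (D w)) = P\<^sup>2" "ip (D \<phi>) (D \<phi>) = Q\<^sup>2"
      by (simp_all add: A_def B_def P_def Q_def L2_norm_sq)
    have young: "k * x * y \<le> \<eta> / 4 * x\<^sup>2 + C / 4 * y\<^sup>2 * 2" for x y
    proof -
      have "k * x * y \<le> \<eta> / 4 * x\<^sup>2 + (k\<^sup>2 / \<eta>) * y\<^sup>2"
        by (rule mult_le_weighted_squares) (use \<eta> in auto)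
      then show ?thesis by (simp add: C_def)
    qed
    \<comment> \<open>For the string the first derivative is itself measured; for the beam one more
      Poincare inequality leads to the second derivative. The disjunction below covers both
      cases.\<close>
    have trace: "\<bar>prim l (D v) l\<bar> \<le> k * A" "\<bar>prim l (D w) l\<bar> \<le> k * P" "\<bar>prim l (D \<psi>) l\<bar> \<le> k * B" "\<bar>prim l (D \<phi>) l\<bar> \<le> k * Q"
    proof -
      have *: "\<bar>prim l g l\<bar> \<le> k * n" if "g \<in> L2_space l" "nrm g \<le> l * n \<or> nrm g \<le> n" "n \<ge> 0" for g n
      proof -
        have "\<bar>prim l g l\<bar> \<le> sqrt l * nrm g" by (rule prim_L2_deriv_bound[OF that(1) pos(1)])
        also have "\<dots> \<le> max (sqrt l * l) (sqrt l) * n"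
        proof -
          have "sqrt l * nrm g \<le> sqrt l * (l * n) \<or> sqrt l * nrm g \<le> sqrt l * n"
            using that(2) pos by (auto intro: mult_left_mono)
          then show ?thesis
            using mult_right_mono[OF max.cobounded1[of "sqrt l * l" "sqrt l"] that(3)]
              mult_right_mono[OF max.cobounded2[of "sqrt l" "sqrt l * l"] that(3)] by (auto simp: mult.assoc)
        qed
        also have "\<dots> \<le> k * n" using k that(3) by (intro mult_right_mono) auto
        finally show ?thesis .
      qed
      have h: "H1 l 0 (D v) (D (D v))" "H1 l 0 (D w) (D (D w))" using id(1,2) by (auto simp: regular_def)
      show "\<bar>prim l (D v) l\<bar> \<le> k * A" "\<bar>prim l (D w) l\<bar> \<le> k * P" "\<bar>prim l (D \<psi>) l\<bar> \<le> k * B" "\<bar>prim l (D \<phi>) l\<bar> \<le> k * Q"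
        using H1_0_norm[OF h(1) pos(1)] H1_0_norm[OF h(2) pos(1)] H1_L2[OF h(1) pos(1)] H1_L2[OF h(2) pos(1)] b bv nn
        by (auto intro!: * simp: A_def B_def P_def Q_def)
    qed
    have tr: "\<bar>prim l g l * x\<bar> \<le> \<eta> / 4 * n\<^sup>2 + C / 4 * x\<^sup>2 * 2" if "\<bar>prim l g l\<bar> \<le> k * n" for g x n
    proof -
      have "\<bar>prim l g l * x\<bar> \<le> k * n * \<bar>x\<bar>" using that by (simp add: abs_mult mult_right_mono)
      also have "\<dots> \<le> \<eta> / 4 * n\<^sup>2 + C / 4 * x\<^sup>2 * 2" using young[of n "\<bar>x\<bar>"] by simp
      finally show ?thesis .
    qed
    have di: "\<bar>ip u g\<bar> \<le> \<eta> / 4 * n\<^sup>2 + C / 4 * (nrm g)\<^sup>2 * 2"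
      if "u \<in> L2_space l" "g \<in> L2_space l" "nrm u \<le> c * n" "c \<le> k" "n \<ge> 0" for u g n c
    proof -
      have "nrm u \<le> k * n" using that mult_right_mono[of c k n] by linarith
      then have "\<bar>ip u g\<bar> \<le> k * n * nrm g" using that by (intro ip_le) auto
      then show ?thesis using young[of n "nrm g"] by linarith
    qed
    have dist: "- prim l (D v) l * e3 \<le> \<eta> / 4 * A\<^sup>2 + C / 4 * e3\<^sup>2 * 2"
      "prim l (D \<psi>) l * e4 \<le> \<eta> / 4 * B\<^sup>2 + C / 4 * e4\<^sup>2 * 2"
      "prim l (D \<phi>) l * e4 \<le> \<eta> / 4 * Q\<^sup>2 + C / 4 * e4\<^sup>2 * 2"
      "ip v e1 \<le> \<eta> / 4 * A\<^sup>2 + C / 4 * (nrm e1)\<^sup>2 * 2"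
      "ip \<psi> e2 \<le> \<eta> / 4 * B\<^sup>2 + C / 4 * (nrm e2)\<^sup>2 * 2"
      "ip \<phi> e2 \<le> \<eta> / 4 * Q\<^sup>2 + C / 4 * (nrm e2)\<^sup>2 * 2"
      using tr[OF trace(1), of e3] tr[OF trace(3), of e4] tr[OF trace(4), of e4]
        di[OF b(2) e(1) bd(3) k(2) nn(1)] di[OF b(4) e(2) bd(4) k(1) nn(2)] di[OF b(3) e(2) bd(2) k(1) nn(4)]
      by simp_all
    have "\<epsilon> * (- prim l (D w) l * e3 + ip w e1) \<le> 1 * \<bar>- prim l (D w) l * e3 + ip w e1\<bar>"
      using eps(1) pos(7) by (intro order_trans[OF mult_left_mono[OF abs_ge_self] mult_right_mono]) auto
    also have "\<dots> \<le> (\<eta> / 4 * P\<^sup>2 + C / 4 * e3\<^sup>2 * 2) + (\<eta> / 4 * P\<^sup>2 + C / 4 * (nrm e1)\<^sup>2 * 2)"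
      using tr[OF trace(2), of e3] di[OF b(1) e(1) bd(1) k(2) nn(3)] by (simp add: abs_le_iff)
    finally have dist2: "\<epsilon> * (- prim l (D w) l * e3 + ip w e1) \<le> \<eta> / 2 * P\<^sup>2 + C / 2 * e3\<^sup>2 + C / 2 * (nrm e1)\<^sup>2"
      by simp
    have cross: "c1 * ip v \<phi> \<le> c1 * (l^3 * A * Q)" "p1 * ip v \<psi> \<le> p1 * (l^3 * A * B)" "q2 * ip \<psi> v \<le> q2 * (l^3 * A * B)"
      "q2 * ip \<phi> v \<le> q2 * (l^3 * A * Q)" "c2 * ip \<phi> \<phi> \<le> c2 * (l\<^sup>2 * Q\<^sup>2)" "q1 * ip v v \<le> 0" "p2 * ip \<psi> \<psi> \<le> 0"
      using ip1 ip2 signs by (auto intro!: mult_left_mono simp: mult_nonpos_nonneg simp flip: L2_norm_sq)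
    have beam: "c1 * ip w \<phi> \<le> a1 / 4 * P\<^sup>2 + (c1 * l^3)\<^sup>2 / a1 * Q\<^sup>2" "p1 * ip w \<psi> \<le> a1 / 4 * P\<^sup>2 + (p1 * l^3)\<^sup>2 / a1 * B\<^sup>2"
    proof -
      have "c1 * ip w \<phi> \<le> c1 * (l^3 * P * Q)" "p1 * ip w \<psi> \<le> p1 * (l^3 * P * B)"
        using ip1 signs by (auto intro!: mult_left_mono)
      moreover have "(c1 * l^3) * P * Q \<le> a1 / 4 * P\<^sup>2 + (c1 * l^3)\<^sup>2 / a1 * Q\<^sup>2" "(p1 * l^3) * P * B \<le> a1 / 4 * P\<^sup>2 + (p1 * l^3)\<^sup>2 / a1 * B\<^sup>2"
        by (rule mult_le_weighted_squares; use pos in simp)+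
      ultimately show "c1 * ip w \<phi> \<le> a1 / 4 * P\<^sup>2 + (c1 * l^3)\<^sup>2 / a1 * Q\<^sup>2" "p1 * ip w \<psi> \<le> a1 / 4 * P\<^sup>2 + (p1 * l^3)\<^sup>2 / a1 * B\<^sup>2"
        by (simp_all add: mult.assoc)
    qed
    \<comment> \<open>The two couplings of \<open>w\<close> take a quarter of
      \<open>a1 * P\<^sup>2\<close> each. Everything else created by the beam multiplier is made at
      most \<open>\<delta> / 2\<close> by the choice of \<open>\<epsilon>\<close>.\<close>
    have "\<epsilon> * (ip v v - a1 * P\<^sup>2 + c1 * ip w \<phi> + p1 * ip w \<psi>) \<le>
        \<epsilon> * (l^4 * A\<^sup>2 - a1 / 2 * P\<^sup>2 + (c1 * l^3)\<^sup>2 / a1 * Q\<^sup>2 + (p1 * l^3)\<^sup>2 / a1 * B\<^sup>2)"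
      using beam ip2(1) pos by (intro mult_left_mono) auto
    also have "\<dots> = \<epsilon> * l^4 * A\<^sup>2 - \<epsilon> * a1 / 2 * P\<^sup>2 + \<epsilon> * ((c1 * l^3)\<^sup>2 / a1) * Q\<^sup>2 + \<epsilon> * ((p1 * l^3)\<^sup>2 / a1) * B\<^sup>2"
      by (simp add: algebra_simps)
    also have "\<dots> \<le> \<delta> / 2 * A\<^sup>2 - \<epsilon> * a1 / 2 * P\<^sup>2 + \<delta> / 2 * Q\<^sup>2 + \<delta> / 2 * B\<^sup>2"
      by (intro add_mono diff_mono mult_right_mono eps order_refl zero_le_power2)
    finally have beam2: "\<epsilon> * (ip v v - a1 * P\<^sup>2 + c1 * ip w \<phi> + p1 * ip w \<psi>) \<le>
        \<delta> / 2 * A\<^sup>2 - \<epsilon> * a1 / 2 * P\<^sup>2 + \<delta> / 2 * Q\<^sup>2 + \<delta> / 2 * B\<^sup>2" .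
    have eta2: "\<eta> * A\<^sup>2 \<le> \<delta> / 4 * A\<^sup>2" "\<eta> * B\<^sup>2 \<le> \<delta> / 4 * B\<^sup>2" "\<eta> * Q\<^sup>2 \<le> \<delta> / 4 * Q\<^sup>2" "\<eta> * P\<^sup>2 \<le> \<epsilon> * a1 / 2 * P\<^sup>2"
      by (rule mult_right_mono, rule \<eta>, simp)+
    have split: "\<epsilon> * (ip v v - prim l (D w) l * e3 - a1 * P\<^sup>2 + c1 * ip w \<phi> + p1 * ip w \<psi> + ip w e1)
      = \<epsilon> * (ip v v - a1 * P\<^sup>2 + c1 * ip w \<phi> + p1 * ip w \<psi>) + \<epsilon> * (- prim l (D w) l * e3 + ip w e1)"
      by (simp add: algebra_simps)
    have formx: "\<delta> * A\<^sup>2 + \<delta> * B\<^sup>2 + \<delta> * Q\<^sup>2 \<le> b1 * A\<^sup>2 + b2 * B\<^sup>2 - l\<^sup>2 * B\<^sup>2 + a2 * Q\<^sup>2 - c2 * (l\<^sup>2 * Q\<^sup>2)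
       - c1 * (l^3 * A * Q) - q2 * (l^3 * A * Q) - p1 * (l^3 * A * B) - q2 * (l^3 * A * B)"
      using form[of A B Q] by (simp add: algebra_simps)
    have A0: "0 \<le> \<delta> * A\<^sup>2" "0 \<le> \<delta> * B\<^sup>2" "0 \<le> \<delta> * Q\<^sup>2" using pos by simp_all
    have "rate (w, v, \<phi>, \<psi>) (w', v', \<phi>', \<psi>') \<le> - (\<eta> / 2 * A\<^sup>2) - \<eta> / 2 * B\<^sup>2 - \<eta> / 2 * P\<^sup>2 - \<eta> / 2 * Q\<^sup>2
        + C * (nrm e1)\<^sup>2 + C * (nrm e2)\<^sup>2 + C * e3\<^sup>2 + C * e4\<^sup>2"
      unfolding id(3) eq split using dist dist2 cross beam2 eta2 formx ip2(2) A0 by simp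
    then show ?thesis by (simp add: A_def B_def P_def Q_def algebra_simps)
  qed
  with \<open>C > 0\<close> \<eta>(1) show ?thesis
    by (intro exI[of _ "\<eta> / 2"] conjI exI[of _ C] allI impI) auto
qed

end

text \<open>With the integrating factor \<open>exp (\<mu> * s)\<close> the function \<open>G\<close>
  is non-increasing. At 0 only a one-sided derivative is available, so monotonicity is drawn from
  the open interval and continuity.\<close>

lemma gronwall:
  fixes V V' F :: "real \<Rightarrow> real"
  assumes der: "\<And>t. t \<ge> 0 \<Longrightarrow> (V has_real_derivative V' t) (at t within {0..})"
    and ineq: "\<And>t. t \<ge> 0 \<Longrightarrow> V' t \<le> - \<mu> * V t + C * F t"
    and F: "continuous_on {0..} F" and t: "t \<ge> 0"
  shows "V t \<le> exp (- \<mu> * t) * V 0 + C * integral {0..t} (\<lambda>s. exp (- \<mu> * (t - s)) * F s)"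
proof -
  let ?h = "\<lambda>s. exp (\<mu> * s) * F s"
  define G where "G s = exp (\<mu> * s) * V s - C * integral {0..s} ?h" for s
  have conth: "continuous_on {0..t} ?h"
    using F by (intro continuous_intros) (auto intro: continuous_on_subset)
  have derG: "(G has_real_derivative exp (\<mu> * s) * (V' s + \<mu> * V s - C * F s)) (at s within {0..t})"
    if s: "s \<in> {0..t}" for s
  proof -
    have "(V has_real_derivative V' s) (at s within {0..t})"
      by (rule DERIV_subset[OF der]) (use s in auto)
    then have "(G has_real_derivative (exp (\<mu> * s) * \<mu>) * V s + V' s * exp (\<mu> * s) - C * ?h s) (at s within {0..t})"
      unfolding G_def[abs_def]
      by (intro DERIV_diff DERIV_mult DERIV_cmult integral_has_real_derivative[OF conth s])
         (auto intro!: derivative_eq_intros)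
    then show ?thesis by (rule DERIV_cong) (simp add: algebra_simps)
  qed
  have "G t \<le> G 0"
  proof (rule DERIV_nonpos_imp_decreasing_open[OF t])
    fix s assume s: "0 < s" "s < t"
    have "(G has_real_derivative exp (\<mu> * s) * (V' s + \<mu> * V s - C * F s)) (at s)"
      using derG[of s] s at_within_interior[of s "{0..t}"] by simp
    moreover have "exp (\<mu> * s) * (V' s + \<mu> * V s - C * F s) \<le> 0"
      using ineq[of s] s by (intro mult_nonneg_nonpos) auto
    ultimately show "\<exists>y. DERIV G s :> y \<and> y \<le> 0" by blast
  next
    show "continuous_on {0..t} G" by (rule DERIV_continuous_on) (rule derG)
  qed
  then have "exp (\<mu> * t) * V t \<le> V 0 + C * integral {0..t} ?h" by (simp add: G_def)
  then have "exp (- \<mu> * t) * (exp (\<mu> * t) * V t) \<le> exp (- \<mu> * t) * (V 0 + C * integral {0..t} ?h)"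
    by (intro mult_left_mono) auto
  also have "exp (- \<mu> * t) * (exp (\<mu> * t) * V t) = V t"
    by (simp flip: mult.assoc exp_add)
  also have "exp (- \<mu> * t) * (V 0 + C * integral {0..t} ?h)
      = exp (- \<mu> * t) * V 0 + C * (exp (- \<mu> * t) * integral {0..t} ?h)"
    by (simp add: algebra_simps)
  also have "exp (- \<mu> * t) * integral {0..t} ?h = integral {0..t} (\<lambda>s. exp (- \<mu> * t) * ?h s)"
    by simp
  also have "\<dots> = integral {0..t} (\<lambda>s. exp (- \<mu> * (t - s)) * F s)"
    by (rule integral_cong) (simp add: algebra_simps flip: mult.assoc exp_add)
  finally show ?thesis .
qed

context beam_string
begin

text \<open>The constants are chosen before the disturbances and thus hold for all inputs at once;
  boundedness of \<open>d3\<close> and \<open>d4\<close> is not involved yet.\<close>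

theorem state_norm_estimate:
  "\<exists>\<mu>>0. \<exists>C>0. \<forall>d1 d2 d3 d4 X0 X t. t \<ge> 0 \<longrightarrow> X0 \<in> A_domain l a1 a2 b1 b2 \<longrightarrow>
     is_solution l a1 a2 b1 b2 c1 c2 p1 p2 q1 q2 d1 d2 d3 d4 X0 X \<longrightarrow>
     (\<forall>s\<ge>0. d1 s \<in> L2_space l) \<longrightarrow> (\<forall>s\<ge>0. d2 s \<in> L2_space l) \<longrightarrow>
     continuous_on {0..} (\<lambda>s. nrm (d1 s)) \<longrightarrow> continuous_on {0..} (\<lambda>s. nrm (d2 s)) \<longrightarrow>
     continuous_on {0..} d3 \<longrightarrow> continuous_on {0..} d4 \<longrightarrow>
     (state_norm l a1 a2 (X t))\<^sup>2 \<le> C * (exp (- \<mu> * t) * (state_norm l a1 a2 X0)\<^sup>2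
       + integral {0..t} (\<lambda>s. exp (- \<mu> * (t - s)) * ((nrm (d1 s))\<^sup>2 + (nrm (d2 s))\<^sup>2 + (d3 s)\<^sup>2 + (d4 s)\<^sup>2)))"
proof -
  obtain c where c: "c > 0" "\<And>X. regular l X \<Longrightarrow> c * (state_norm l a1 a2 X)\<^sup>2 \<le> V X"
    using V_lower by blast
  obtain K where K: "K > 0" "\<And>f g h z. regular l (f, g, h, z) \<Longrightarrow>
     V (f, g, h, z) \<le> K * ((nrm (D (D f)))\<^sup>2 + (nrm g)\<^sup>2 + (nrm (D h))\<^sup>2 + (nrm z)\<^sup>2)"
    using V_upper by blast
  obtain \<eta> E where \<eta>: "\<eta> > 0" and E: "E > 0"
    and rb: "\<And>w v \<phi> \<psi> w' v' \<phi>' \<psi>' e1 e2 e3 e4.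
     (w, v, \<phi>, \<psi>) \<in> A_domain l a1 a2 b1 b2 \<Longrightarrow> (w', v', \<phi>', \<psi>') \<in> state_space l \<Longrightarrow>
     B_op l a1 a2 b1 b2 (w, v, \<phi>, \<psi>) = (e3, e4) \<Longrightarrow>
     evolution_eqs l a1 a2 b1 b2 c1 c2 p1 p2 q1 q2 e1 e2 (w, v, \<phi>, \<psi>) (w', v', \<phi>', \<psi>') \<Longrightarrow>
     e1 \<in> L2_space l \<Longrightarrow> e2 \<in> L2_space l \<Longrightarrow>
     rate (w, v, \<phi>, \<psi>) (w', v', \<phi>', \<psi>') \<le>
       - \<eta> * ((nrm (D (D v)))\<^sup>2 + (nrm (D \<psi>))\<^sup>2 + (nrm (D (D w)))\<^sup>2 + (nrm (D \<phi>))\<^sup>2)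
       + E * ((nrm e1)\<^sup>2 + (nrm e2)\<^sup>2 + e3\<^sup>2 + e4\<^sup>2)"
    using rate_bound by metis
  \<comment> \<open>The dissipation contains no velocities, only their spatial derivatives; the
    factor \<open>L\<close> recovers the velocities by Poincare's inequality.\<close>
  define L where "L = 1 + l^4 + l\<^sup>2"
  have L: "L > 0" "1 \<le> L" "l^4 \<le> L" "l\<^sup>2 \<le> L" by (simp_all add: L_def add_pos_nonneg)
  \<comment> \<open>\<open>V\<close> is at most \<open>K * L\<close> times the sum of squares that
    is dissipated at rate \<open>\<eta>\<close>.\<close>
  define \<mu> where "\<mu> = \<eta> / (K * L)"
  have "\<mu> > 0" using \<eta> K L by (simp add: \<mu>_def)
  \<comment> \<open>Converts the unweighted norms of \<open>V_upper\<close> into the state norm of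
    the initial datum.\<close>
  define M where "M = 1 + 1 / a1 + 1 / a2"
  have M: "M > 0" "1 \<le> M" "1 \<le> M * a1" "1 \<le> M * a2"
    using pos by (simp_all add: M_def add_pos_pos distrib_right)
  define C where "C = max (K * M / c) (E / c)"
  have "C > 0" using K M c E by (simp add: C_def less_max_iff_disj)
  have est: "(state_norm l a1 a2 (X t))\<^sup>2 \<le> C * (exp (- \<mu> * t) * (state_norm l a1 a2 X0)\<^sup>2
       + integral {0..t} (\<lambda>s. exp (- \<mu> * (t - s)) * ((nrm (d1 s))\<^sup>2 + (nrm (d2 s))\<^sup>2 + (d3 s)\<^sup>2 + (d4 s)\<^sup>2)))"
    if t: "t \<ge> 0" and X0: "X0 \<in> A_domain l a1 a2 b1 b2"
      and sol: "is_solution l a1 a2 b1 b2 c1 c2 p1 p2 q1 q2 d1 d2 d3 d4 X0 X"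
      and dL: "\<forall>s\<ge>0. d1 s \<in> L2_space l" "\<forall>s\<ge>0. d2 s \<in> L2_space l"
      and dc: "continuous_on {0..} (\<lambda>s. nrm (d1 s))" "continuous_on {0..} (\<lambda>s. nrm (d2 s))"
        "continuous_on {0..} d3" "continuous_on {0..} d4"
    for t X0 X d1 d2 d3 d4
  proof -
    obtain X' where X': "C1_curve (state_norm l a1 a2) (state_space l) X X'"
      and ev: "\<And>t. t \<ge> 0 \<Longrightarrow> evolution_eqs l a1 a2 b1 b2 c1 c2 p1 p2 q1 q2 (d1 t) (d2 t) (X t) (X' t)"
      and dom: "\<And>t. t \<ge> 0 \<Longrightarrow> X t \<in> A_domain l a1 a2 b1 b2" and init: "state_eq l (X 0) X0"
      and bd: "\<And>t. t \<ge> 0 \<Longrightarrow> B_op l a1 a2 b1 b2 (X t) = (d3 t, d4 t)"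
      using sol by (auto simp: is_solution_def C0_curve_def)
    have st: "X t \<in> state_space l" "X' t \<in> state_space l" if "t \<ge> 0" for t
      using X' that by (auto simp: C1_curve_def C0_curve_def)
    let ?F = "\<lambda>s. (nrm (d1 s))\<^sup>2 + (nrm (d2 s))\<^sup>2 + (d3 s)\<^sup>2 + (d4 s)\<^sup>2"
    let ?J = "integral {0..t} (\<lambda>s. exp (- \<mu> * (t - s)) * ?F s)"
    have vt: "V (X t) \<le> exp (- \<mu> * t) * V (X 0) + E * ?J"
    proof (rule gronwall[OF V_DERIV[OF X'] _ _ t])
      fix s :: real assume s: "s \<ge> 0"
      obtain w v \<phi> \<psi> w' v' \<phi>' \<psi>' where X: "X s = (w, v, \<phi>, \<psi>)" "X' s = (w', v', \<phi>', \<psi>')"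
        by (metis prod_cases4)
      note facts = dom[OF s, unfolded X] st(2)[OF s, unfolded X] bd[OF s, unfolded X] ev[OF s, unfolded X]
        dL(1)[rule_format, OF s] dL(2)[rule_format, OF s]
      note r = rate_identity(1,2)[OF facts]
      let ?S = "(nrm (D (D v)))\<^sup>2 + (nrm (D \<psi>))\<^sup>2 + (nrm (D (D w)))\<^sup>2 + (nrm (D \<phi>))\<^sup>2"
      have "(nrm v)\<^sup>2 \<le> (l\<^sup>2 * nrm (D (D v)))\<^sup>2" "(nrm \<psi>)\<^sup>2 \<le> (l * nrm (D \<psi>))\<^sup>2"
        using regular_bounds(7,8)[OF r(2)] by (simp_all add: power_mono L2_norm_nonneg)
      then have "(nrm v)\<^sup>2 \<le> l^4 * (nrm (D (D v)))\<^sup>2" "(nrm \<psi>)\<^sup>2 \<le> l\<^sup>2 * (nrm (D \<psi>))\<^sup>2"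
        by (simp_all add: power_mult_distrib)
      then have "(nrm v)\<^sup>2 \<le> L * (nrm (D (D v)))\<^sup>2" "(nrm \<psi>)\<^sup>2 \<le> L * (nrm (D \<psi>))\<^sup>2"
        using mult_right_mono[OF L(3), of "(nrm (D (D v)))\<^sup>2"] mult_right_mono[OF L(4), of "(nrm (D \<psi>))\<^sup>2"] by auto
      moreover have "(nrm (D (D w)))\<^sup>2 \<le> L * (nrm (D (D w)))\<^sup>2" "(nrm (D \<phi>))\<^sup>2 \<le> L * (nrm (D \<phi>))\<^sup>2"
        using mult_right_mono[OF L(2), of "(nrm (D (D w)))\<^sup>2"] mult_right_mono[OF L(2), of "(nrm (D \<phi>))\<^sup>2"] by auto
      ultimately have "(nrm (D (D w)))\<^sup>2 + (nrm v)\<^sup>2 + (nrm (D \<phi>))\<^sup>2 + (nrm \<psi>)\<^sup>2 \<le> L * ?S"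
        by (simp add: algebra_simps)
      then have "V (X s) \<le> K * (L * ?S)"
        using order_trans[OF K(2)[OF r(1)] mult_left_mono] K(1) by (auto simp: X)
      then have "\<mu> * V (X s) \<le> \<mu> * (K * (L * ?S))" using \<open>\<mu> > 0\<close> by (intro mult_left_mono) auto
      also have "\<dots> = \<eta> * ?S" using K L by (simp add: \<mu>_def)
      finally show "rate (X s) (X' s) \<le> - \<mu> * V (X s) + E * ?F s"
        using rb[OF facts] by (simp add: X)
    next
      show "continuous_on {0..} ?F" using dc by (intro continuous_intros)
    qed
    have v0: "V (X 0) \<le> K * (M * (state_norm l a1 a2 X0)\<^sup>2)"
    proof -
      obtain f g h z where X: "X 0 = (f, g, h, z)" by (metis prod_cases4)
      have r: "regular l (f, g, h, z)" using state_space_regular[OF st(1)[of 0] pos(1)] by (simp add: X)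
      have r0: "regular l X0" using X0 by (intro state_space_regular pos) (auto simp: A_domain_def)
      \<comment> \<open>The solution starts at \<open>X0\<close> only up to null sets, which the
        state norm ignores.\<close>
      have N: "state_norm l a1 a2 X0 = state_norm l a1 a2 (f, g, h, z)"
        using state_norm_state_eq[OF init[unfolded X] r r0 pos(1-3)] by simp
      have "(nrm (D (D f)))\<^sup>2 + (nrm g)\<^sup>2 + (nrm (D h))\<^sup>2 + (nrm z)\<^sup>2
         \<le> (M * a1) * (nrm (D (D f)))\<^sup>2 + M * (nrm g)\<^sup>2 + (M * a2) * (nrm (D h))\<^sup>2 + M * (nrm z)\<^sup>2"
        using M by (intro add_mono; simp add: mult_le_cancel_right1)
      also have "\<dots> = M * (state_norm l a1 a2 X0)\<^sup>2"
        unfolding N state_norm_sq[OF r pos(1-3)] by (simp add: algebra_simps)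
      finally show ?thesis
        using order_trans[OF K(2)[OF r] mult_left_mono] K(1) by (auto simp: X)
    qed
    have "exp (- \<mu> * t) * V (X 0) \<le> exp (- \<mu> * t) * (K * (M * (state_norm l a1 a2 X0)\<^sup>2))"
      using v0 by (intro mult_left_mono) auto
    also have "\<dots> = K * M * (exp (- \<mu> * t) * (state_norm l a1 a2 X0)\<^sup>2)" by (simp only: mult_ac)
    finally have "exp (- \<mu> * t) * V (X 0) \<le> K * M * (exp (- \<mu> * t) * (state_norm l a1 a2 X0)\<^sup>2)" .
    with vt have "c * (state_norm l a1 a2 (X t))\<^sup>2 \<le> K * M * (exp (- \<mu> * t) * (state_norm l a1 a2 X0)\<^sup>2) + E * ?J"
      using c(2)[OF state_space_regular[OF st(1)[OF t] pos(1)]] by linarith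
    then have "(state_norm l a1 a2 (X t))\<^sup>2 \<le> K * M / c * (exp (- \<mu> * t) * (state_norm l a1 a2 X0)\<^sup>2) + E / c * ?J"
      using c(1) by (simp add: field_simps)
    also have "\<dots> \<le> C * (exp (- \<mu> * t) * (state_norm l a1 a2 X0)\<^sup>2) + C * ?J"
      by (intro add_mono mult_right_mono Henstock_Kurzweil_Integration.integral_nonneg
          integrable_continuous_real continuous_intros continuous_on_subset[OF dc(1)]
          continuous_on_subset[OF dc(2)] continuous_on_subset[OF dc(3)] continuous_on_subset[OF dc(4)])
         (auto simp: C_def)
    finally show ?thesis by (simp add: algebra_simps)
  qed
  show ?thesis
    by (rule exI[of _ \<mu>], rule conjI[OF \<open>\<mu> > 0\<close>], rule exI[of _ C], rule conjI[OF \<open>C > 0\<close>],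
        intro allI impI, rule est)
qed

end

section \<open>Input-to-state stability\<close>

lemma Linf_norm_nonneg: "0 \<le> Linf_norm I f"
  by (simp add: Linf_norm_def)

text \<open>Finiteness of the essential supremum has to be established first, from boundedness on
  the compact interval, because \<open>enn2real\<close> sends infinity to 0.\<close>

lemma abs_le_Linf_norm:
  assumes f: "continuous_on {0..t} f" and t: "t > 0" and s: "s \<in> {0..t}"
  shows "\<bar>f s\<bar> \<le> Linf_norm {0<..<t} f"
proof -
  let ?M = "lebesgue_on {0<..<t}"
  have c: "continuous_on {0<..<t} f" by (rule continuous_on_subset[OF f]) auto
  have m: "f \<in> borel_measurable ?M"
    by (rule continuous_imp_measurable_on_sets_lebesgue[OF c]) simp
  have "compact (f ` {0..t})" by (intro compact_continuous_image f) simp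
  then obtain B where B: "\<And>y. y \<in> {0..t} \<Longrightarrow> \<bar>f y\<bar> \<le> B"
    using compact_imp_bounded bounded_real by (metis (no_types, lifting) imageI)
  let ?E = "esssup ?M (\<lambda>s. ennreal \<bar>f s\<bar>)"
  have "?E \<le> ennreal B"
  proof (rule esssup_I)
    show "(\<lambda>s. ennreal \<bar>f s\<bar>) \<in> borel_measurable ?M" using m by measurable
    show "AE s in ?M. ennreal \<bar>f s\<bar> \<le> ennreal B"
      using B by (intro AE_I2 ennreal_leI) (auto simp: space_restrict_space)
  qed
  then have "?E < \<infinity>" by (rule le_less_trans) simp
  then have E: "ennreal (Linf_norm {0<..<t} f) = ?E" by (simp add: Linf_norm_def)
  have "AE s in ?M. ennreal \<bar>f s\<bar> \<le> ?E" by (rule esssup_AE)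
  then have "AE s in ?M. \<bar>f s\<bar> \<le> Linf_norm {0<..<t} f"
    unfolding E[symmetric] by eventually_elim (simp add: Linf_norm_nonneg)
  then show ?thesis
    by (rule continuous_AE_le[of 0 t "\<lambda>s. \<bar>f s\<bar>", rotated]) (use f t s in \<open>auto intro!: continuous_intros\<close>)
qed

lemma Linf_space_abs_bound:
  assumes f: "continuous_on {0..} f" and L: "f \<in> Linf_space {0..}"
  obtains M where "M \<ge> 0" "\<And>s. s \<ge> 0 \<Longrightarrow> \<bar>f s\<bar> \<le> M"
proof -
  have E: "ennreal (Linf_norm {0..} f) = esssup (lebesgue_on {0..}) (\<lambda>s. ennreal \<bar>f s\<bar>)"
    using L by (simp add: Linf_norm_def Linf_space_def)
  have "AE s in lebesgue_on {0..}. ennreal \<bar>f s\<bar> \<le> ennreal (Linf_norm {0..} f)"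
    unfolding E by (rule esssup_AE)
  then have *: "AE s in lebesgue. s \<in> {0..} \<longrightarrow> \<bar>f s\<bar> \<le> Linf_norm {0..} f"
    by (auto simp: AE_restrict_space_iff Linf_norm_nonneg elim: eventually_mono)
  have "\<bar>f s\<bar> \<le> Linf_norm {0..} f" if "s \<ge> 0" for s
  proof (rule continuous_AE_le[of 0 "s + 1" "\<lambda>s. \<bar>f s\<bar>"])
    show "continuous_on {0..s + 1} (\<lambda>s. \<bar>f s\<bar>)"
      by (intro continuous_intros continuous_on_subset[OF f]) auto
    show "AE y in lebesgue_on {0<..<s + 1}. \<bar>f y\<bar> \<le> Linf_norm {0..} f"
      using * by (auto simp: AE_restrict_space_iff elim: eventually_mono)
  qed (use that in auto)
  then show ?thesis by (rule that[OF Linf_norm_nonneg])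
qed

lemma exp_weight_integrable:
  fixes F :: "real \<Rightarrow> real"
  assumes "continuous_on {0..} F"
  shows "F integrable_on {0..t}" "(\<lambda>s. exp (- \<mu> * (t - s)) * F s) integrable_on {0..t}"
  by (intro integrable_continuous_real continuous_intros continuous_on_subset[OF assms]; force)+

text \<open>The exponential weight has integral at most \<open>1 / \<mu>\<close>, uniformly in
  \<open>t\<close>. The bound on \<open>F\<close> is asked for only when \<open>t > 0\<close>: at
  \<open>t = 0\<close> the sup norm over the empty interval says nothing about the value of
  \<open>F\<close>.\<close>

lemma exp_weight_integral_le_sup:
  fixes F :: "real \<Rightarrow> real"
  assumes F: "continuous_on {0..} F" and "\<mu> > 0" "t \<ge> 0" "S \<ge> 0"
    and S: "\<And>s. t > 0 \<Longrightarrow> s \<in> {0..t} \<Longrightarrow> F s \<le> S"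
  shows "integral {0..t} (\<lambda>s. exp (- \<mu> * (t - s)) * F s) \<le> S / \<mu>"
proof (cases "t = 0")
  case False
  have hi: "((\<lambda>s. exp (- \<mu> * (t - s)) * S) has_integral
      (exp (- \<mu> * (t - t)) * S / \<mu> - exp (- \<mu> * (t - 0)) * S / \<mu>)) {0..t}"
    using \<open>\<mu> > 0\<close> \<open>t \<ge> 0\<close>
    by (intro fundamental_theorem_of_calculus)
       (auto intro!: derivative_eq_intros simp flip: has_real_derivative_iff_has_vector_derivative)
  have "integral {0..t} (\<lambda>s. exp (- \<mu> * (t - s)) * F s) \<le> integral {0..t} (\<lambda>s. exp (- \<mu> * (t - s)) * S)"
    by (rule integral_le[OF exp_weight_integrable(2)[OF F] has_integral_integrable[OF hi]])
       (use False \<open>t \<ge> 0\<close> S in auto)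
  also have "\<dots> \<le> S / \<mu>"
    using integral_unique[OF hi] assms by simp
  finally show ?thesis .
qed (use assms in auto)

lemma exp_weight_integral_le_integral:
  fixes F :: "real \<Rightarrow> real"
  assumes F: "continuous_on {0..} F" and "\<mu> > 0" and nn: "\<And>s. s \<ge> 0 \<Longrightarrow> 0 \<le> F s"
  shows "integral {0..t} (\<lambda>s. exp (- \<mu> * (t - s)) * F s) \<le> (LINT s|lebesgue_on {0..t}. F s)"
proof -
  have "integral {0..t} (\<lambda>s. exp (- \<mu> * (t - s)) * F s) \<le> integral {0..t} F"
  proof (rule integral_le[OF exp_weight_integrable(2)[OF F] exp_weight_integrable(1)[OF F]])
    fix s assume s: "s \<in> {0..t}"
    then have "exp (- \<mu> * (t - s)) \<le> 1" using \<open>\<mu> > 0\<close> by simp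
    from mult_right_mono[OF this, of "F s"] show "exp (- \<mu> * (t - s)) * F s \<le> F s"
      using nn s by simp
  qed
  also have "\<dots> = (LINT s|lebesgue_on {0..t}. F s)"
    by (rule lebesgue_integral_eq_integral[symmetric])
       (auto intro!: continuous_imp_integrable_real continuous_on_subset[OF F])
  finally show ?thesis .
qed

lemma sqrt_sum5_le:
  assumes "0 \<le> a" "0 \<le> b" "0 \<le> c" "0 \<le> d" "0 \<le> e"
  shows "sqrt (a + b + c + d + e) \<le> sqrt a + sqrt b + sqrt c + sqrt d + sqrt e"
  using assms by (intro order_trans[OF sqrt_add_le_add_sqrt add_mono] add_nonneg_nonneg order_refl)

lemma class_K_inf_linear: "C > 0 \<Longrightarrow> class_K_inf (\<lambda>r. C * r)"
  unfolding class_K_inf_def class_K_def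
  by (auto intro!: continuous_intros strict_mono_onI filterlim_tendsto_pos_mult_at_top[OF tendsto_const _ filterlim_ident])

lemma class_K_inf_sqrt: "C > 0 \<Longrightarrow> class_K_inf (\<lambda>r. C * sqrt r)"
  unfolding class_K_inf_def class_K_def
  by (auto intro!: continuous_intros strict_mono_onI filterlim_tendsto_pos_mult_at_top[OF tendsto_const _ sqrt_at_top])

lemma class_K_square: "class_K (\<lambda>r. r\<^sup>2)"
  unfolding class_K_def by (auto intro!: continuous_intros strict_mono_onI power_strict_mono)

lemma C2_halfline_continuous: "C2_halfline d \<Longrightarrow> continuous_on {0..} d"
  unfolding C2_halfline_def by (blast intro: DERIV_continuous_on atLeast_iff[THEN iffD1])

context beam_string
begin

text \<open>The constant depends on the inputs \<open>d3\<close> and \<open>d4\<close> through their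
  sup bounds, but not on \<open>t\<close> or on the initial state.\<close>

theorem ISS_estimates:
  assumes d1: "L2_deriv l d1 d1'" and d2: "L2_deriv l d2 d2'"
    and d3: "continuous_on {0..} d3" "d3 \<in> Linf_space {0..}"
    and d4: "continuous_on {0..} d4" "d4 \<in> Linf_space {0..}"
  shows "\<exists>C \<mu>\<^sub>m. C > 0 \<and> \<mu>\<^sub>m > 0 \<and>
       (\<forall>X0 X. admissible_init l a1 a2 b1 b2 d3 d4 X0 \<longrightarrow>
          is_solution l a1 a2 b1 b2 c1 c2 p1 p2 q1 q2 d1 d2 d3 d4 X0 X \<longrightarrow>
          (\<forall>t\<ge>0.
             state_norm l a1 a2 (X t) \<le>
               C * exp (- (\<mu>\<^sub>m / 4) * t) * state_norm l a1 a2 X0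
               + C * (Linf_norm {0<..<t} (\<lambda>s. L2_norm l (d1 s))
                      + Linf_norm {0<..<t} (\<lambda>s. L2_norm l (d2 s))
                      + sqrt (Linf_norm {0<..<t} d3)
                      + sqrt (Linf_norm {0<..<t} d4)) \<and>
             state_norm l a1 a2 (X t) \<le>
               C * exp (- (\<mu>\<^sub>m / 4) * t) * state_norm l a1 a2 X0
               + C * sqrt (LINT s|lebesgue_on {0..t}. (L2_norm l (d1 s))\<^sup>2)
               + C * sqrt (LINT s|lebesgue_on {0..t}. (L2_norm l (d2 s))\<^sup>2)
               + C * sqrt (LINT s|lebesgue_on {0..t}. \<bar>d3 s\<bar>)
               + C * sqrt (LINT s|lebesgue_on {0..t}. \<bar>d4 s\<bar>)))"
proof -
  obtain \<mu> C where \<mu>: "\<mu> > 0" and C: "C > 0" and est: "\<forall>d1 d2 d3 d4 X0 X t. t \<ge> 0 \<longrightarrow> X0 \<in> A_domain l a1 a2 b1 b2 \<longrightarrow>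
     is_solution l a1 a2 b1 b2 c1 c2 p1 p2 q1 q2 d1 d2 d3 d4 X0 X \<longrightarrow>
     (\<forall>s\<ge>0. d1 s \<in> L2_space l) \<longrightarrow> (\<forall>s\<ge>0. d2 s \<in> L2_space l) \<longrightarrow>
     continuous_on {0..} (\<lambda>s. nrm (d1 s)) \<longrightarrow> continuous_on {0..} (\<lambda>s. nrm (d2 s)) \<longrightarrow>
     continuous_on {0..} d3 \<longrightarrow> continuous_on {0..} d4 \<longrightarrow>
     (state_norm l a1 a2 (X t))\<^sup>2 \<le> C * (exp (- \<mu> * t) * (state_norm l a1 a2 X0)\<^sup>2
       + integral {0..t} (\<lambda>s. exp (- \<mu> * (t - s)) * ((nrm (d1 s))\<^sup>2 + (nrm (d2 s))\<^sup>2 + (d3 s)\<^sup>2 + (d4 s)\<^sup>2)))"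
    using state_norm_estimate by (elim exE conjE)
  have n1: "continuous_on {0..} (\<lambda>s. nrm (d1 s))" and n2: "continuous_on {0..} (\<lambda>s. nrm (d2 s))"
    using d1 d2 by (auto intro: L2_deriv_continuous_norm)
  obtain M3 where M3: "M3 \<ge> 0" "\<And>s. s \<ge> 0 \<Longrightarrow> \<bar>d3 s\<bar> \<le> M3" using Linf_space_abs_bound[OF d3] by blast
  obtain M4 where M4: "M4 \<ge> 0" "\<And>s. s \<ge> 0 \<Longrightarrow> \<bar>d4 s\<bar> \<le> M4" using Linf_space_abs_bound[OF d4] by blast
  \<comment> \<open>Majorises every factor that arises: those with \<open>\<mu>\<close> come from
    the sup estimate, the others from the integral estimate.\<close>
  define k where "k = 1 + 1 / sqrt \<mu> + sqrt (M3 / \<mu>) + sqrt (M4 / \<mu>) + sqrt M3 + sqrt M4"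
  have k: "1 \<le> k" "1 / sqrt \<mu> \<le> k" "sqrt (M3 / \<mu>) \<le> k" "sqrt (M4 / \<mu>) \<le> k" "sqrt M3 \<le> k" "sqrt M4 \<le> k"
    unfolding k_def using \<mu> M3(1) M4(1) by (simp_all add: add_increasing add_increasing2)
  define C' where "C' = sqrt C * k"
  have "C' > 0" using C k by (simp add: C'_def)
  let ?J = "\<lambda>t F. integral {0..t} (\<lambda>s. exp (- \<mu> * (t - s)) * F s)"
  let ?N = "state_norm l a1 a2"
  \<comment> \<open>Both claims are instances of this one; they differ only in how the four weighted
    integrals are bounded.\<close>
  have main: "?N (X t) \<le> C' * exp (- (2 * \<mu> / 4) * t) * ?N X0 + C' * (x1 + x2 + x3 + x4)"
    if t: "t \<ge> 0" and X0: "admissible_init l a1 a2 b1 b2 d3 d4 X0"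
      and sol: "is_solution l a1 a2 b1 b2 c1 c2 p1 p2 q1 q2 d1 d2 d3 d4 X0 X"
      and x: "sqrt (?J t (\<lambda>s. (nrm (d1 s))\<^sup>2)) \<le> k * x1" "sqrt (?J t (\<lambda>s. (nrm (d2 s))\<^sup>2)) \<le> k * x2"
        "sqrt (?J t (\<lambda>s. (d3 s)\<^sup>2)) \<le> k * x3" "sqrt (?J t (\<lambda>s. (d4 s)\<^sup>2)) \<le> k * x4"
    for X X0 t x1 x2 x3 x4
  proof -
    have cont: "continuous_on {0..} (\<lambda>s. (nrm (d1 s))\<^sup>2)" "continuous_on {0..} (\<lambda>s. (nrm (d2 s))\<^sup>2)"
      "continuous_on {0..} (\<lambda>s. (d3 s)\<^sup>2)" "continuous_on {0..} (\<lambda>s. (d4 s)\<^sup>2)"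
      using n1 n2 d3 d4 by (auto intro!: continuous_intros)
    note int = cont[THEN exp_weight_integrable(2), of \<mu> t]
    have nn: "0 \<le> ?J t F" if "(\<lambda>s. exp (- \<mu> * (t - s)) * F s) integrable_on {0..t}" "\<And>s. 0 \<le> F s" for F
      using that by (intro Henstock_Kurzweil_Integration.integral_nonneg) auto
    have N0: "0 \<le> ?N Y" for Y using pos by (intro state_norm_nonneg)
    have "(?N (X t))\<^sup>2 \<le> C * (exp (- \<mu> * t) * (?N X0)\<^sup>2
       + ?J t (\<lambda>s. (nrm (d1 s))\<^sup>2 + (nrm (d2 s))\<^sup>2 + (d3 s)\<^sup>2 + (d4 s)\<^sup>2))"
      using est[rule_format, OF t _ sol _ _ n1 n2 d3(1) d4(1)] X0 d1 d2
      by (auto simp: admissible_init_def L2_deriv_def)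
    also have "?J t (\<lambda>s. (nrm (d1 s))\<^sup>2 + (nrm (d2 s))\<^sup>2 + (d3 s)\<^sup>2 + (d4 s)\<^sup>2)
      = ?J t (\<lambda>s. (nrm (d1 s))\<^sup>2) + ?J t (\<lambda>s. (nrm (d2 s))\<^sup>2) + ?J t (\<lambda>s. (d3 s)\<^sup>2) + ?J t (\<lambda>s. (d4 s)\<^sup>2)"
      unfolding distrib_left
      by (simp only: Henstock_Kurzweil_Integration.integral_add integrable_add int)
    finally have "(?N (X t))\<^sup>2 \<le> C * (exp (- \<mu> * t) * (?N X0)\<^sup>2 + ?J t (\<lambda>s. (nrm (d1 s))\<^sup>2)
        + ?J t (\<lambda>s. (nrm (d2 s))\<^sup>2) + ?J t (\<lambda>s. (d3 s)\<^sup>2) + ?J t (\<lambda>s. (d4 s)\<^sup>2))"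
      by (simp only: add.assoc)
    then have "?N (X t) \<le> sqrt (C * (exp (- \<mu> * t) * (?N X0)\<^sup>2 + ?J t (\<lambda>s. (nrm (d1 s))\<^sup>2)
        + ?J t (\<lambda>s. (nrm (d2 s))\<^sup>2) + ?J t (\<lambda>s. (d3 s)\<^sup>2) + ?J t (\<lambda>s. (d4 s)\<^sup>2)))"
      by (rule real_le_rsqrt)
    also have "\<dots> \<le> sqrt C * (sqrt (exp (- \<mu> * t) * (?N X0)\<^sup>2) + sqrt (?J t (\<lambda>s. (nrm (d1 s))\<^sup>2))
        + sqrt (?J t (\<lambda>s. (nrm (d2 s))\<^sup>2)) + sqrt (?J t (\<lambda>s. (d3 s)\<^sup>2)) + sqrt (?J t (\<lambda>s. (d4 s)\<^sup>2)))"
      unfolding real_sqrt_mult[of C]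
      by (intro mult_left_mono sqrt_sum5_le nn int mult_nonneg_nonneg) (use C in auto)
    \<comment> \<open>The square root halves the decay rate of the squared norm, so the required
      rate \<open>\<mu>\<^sub>m / 4\<close> is met by \<open>2 * \<mu>\<close> in the place of
      \<open>\<mu>\<^sub>m\<close>.\<close>
    also have "sqrt (exp (- \<mu> * t) * (?N X0)\<^sup>2) = exp (- (2 * \<mu> / 4) * t) * ?N X0"
    proof -
      have "exp (- \<mu> * t) = (exp (- (2 * \<mu> / 4) * t))\<^sup>2" by (simp flip: exp_double)
      then show ?thesis by (simp add: real_sqrt_mult N0 del: exp_eq_one_iff)
    qed
    also have "exp (- (2 * \<mu> / 4) * t) * ?N X0 \<le> k * (exp (- (2 * \<mu> / 4) * t) * ?N X0)"
      using mult_right_mono[OF k(1), of "exp (- (2 * \<mu> / 4) * t) * ?N X0"] N0 by simp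
    finally have "?N (X t) \<le> sqrt C * (k * (exp (- (2 * \<mu> / 4) * t) * ?N X0) + k * x1 + k * x2 + k * x3 + k * x4)"
      using x C by (smt (verit) mult_left_mono real_sqrt_ge_zero)
    then show ?thesis by (simp add: C'_def algebra_simps)
  qed
  have s1: "sqrt (?J t (\<lambda>s. (f s)\<^sup>2)) \<le> k * Linf_norm {0<..<t} f"
    and i1: "sqrt (?J t (\<lambda>s. (f s)\<^sup>2)) \<le> k * sqrt (LINT s|lebesgue_on {0..t}. (f s)\<^sup>2)"
    if f: "continuous_on {0..} f" and t: "t \<ge> 0" for f t
  proof -
    have f2: "continuous_on {0..} (\<lambda>s. (f s)\<^sup>2)" using f by (intro continuous_intros)
    have "?J t (\<lambda>s. (f s)\<^sup>2) \<le> (Linf_norm {0<..<t} f)\<^sup>2 / \<mu>"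
    proof (rule exp_weight_integral_le_sup[OF f2 \<mu> t])
      fix s assume "t > 0" "s \<in> {0..t}"
      then have "\<bar>f s\<bar> \<le> Linf_norm {0<..<t} f"
        by (intro abs_le_Linf_norm continuous_on_subset[OF f]) auto
      then show "(f s)\<^sup>2 \<le> (Linf_norm {0<..<t} f)\<^sup>2" by (simp add: abs_le_square_iff[symmetric])
    qed simp
    then have "sqrt (?J t (\<lambda>s. (f s)\<^sup>2)) \<le> sqrt ((Linf_norm {0<..<t} f)\<^sup>2 / \<mu>)" by (rule real_sqrt_le_mono)
    also have "\<dots> = 1 / sqrt \<mu> * Linf_norm {0<..<t} f" by (simp add: real_sqrt_divide Linf_norm_nonneg)
    also have "\<dots> \<le> k * Linf_norm {0<..<t} f" by (intro mult_right_mono k Linf_norm_nonneg)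
    finally show "sqrt (?J t (\<lambda>s. (f s)\<^sup>2)) \<le> k * Linf_norm {0<..<t} f" .
    have "?J t (\<lambda>s. (f s)\<^sup>2) \<le> (LINT s|lebesgue_on {0..t}. (f s)\<^sup>2)"
      by (rule exp_weight_integral_le_integral[OF f2 \<mu>]) simp
    then have "sqrt (?J t (\<lambda>s. (f s)\<^sup>2)) \<le> 1 * sqrt (LINT s|lebesgue_on {0..t}. (f s)\<^sup>2)"
      by (simp add: real_sqrt_le_mono)
    also have "\<dots> \<le> k * sqrt (LINT s|lebesgue_on {0..t}. (f s)\<^sup>2)"
      by (intro mult_right_mono k) simp
    finally show "sqrt (?J t (\<lambda>s. (f s)\<^sup>2)) \<le> k * sqrt (LINT s|lebesgue_on {0..t}. (f s)\<^sup>2)" .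
  qed
  have s2: "sqrt (?J t (\<lambda>s. (f s)\<^sup>2)) \<le> k * sqrt (Linf_norm {0<..<t} f)"
    and i2: "sqrt (?J t (\<lambda>s. (f s)\<^sup>2)) \<le> k * sqrt (LINT s|lebesgue_on {0..t}. \<bar>f s\<bar>)"
    if f: "continuous_on {0..} f" and t: "t \<ge> 0" and M: "M \<ge> 0" "\<And>s. s \<ge> 0 \<Longrightarrow> \<bar>f s\<bar> \<le> M"
      and kM: "sqrt (M / \<mu>) \<le> k" "sqrt M \<le> k" for f t M
  proof -
    have fa: "continuous_on {0..} (\<lambda>s. M * \<bar>f s\<bar>)" and f2: "continuous_on {0..} (\<lambda>s. (f s)\<^sup>2)"
      using f by (auto intro!: continuous_intros)
    have sq: "(f s)\<^sup>2 \<le> M * \<bar>f s\<bar>" if "s \<ge> 0" for s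
      using mult_right_mono[OF M(2)[OF that], of "\<bar>f s\<bar>"] by (simp add: power2_eq_square flip: abs_mult)
    have J: "?J t (\<lambda>s. (f s)\<^sup>2) \<le> ?J t (\<lambda>s. M * \<bar>f s\<bar>)"
      by (rule integral_le[OF exp_weight_integrable(2)[OF f2] exp_weight_integrable(2)[OF fa]]) (use sq in auto)
    also have "?J t (\<lambda>s. M * \<bar>f s\<bar>) \<le> M * Linf_norm {0<..<t} f / \<mu>"
      by (rule exp_weight_integral_le_sup[OF fa \<mu> t])
         (use M t in \<open>auto intro!: mult_left_mono abs_le_Linf_norm continuous_on_subset[OF f] mult_nonneg_nonneg Linf_norm_nonneg\<close>)
    finally have "sqrt (?J t (\<lambda>s. (f s)\<^sup>2)) \<le> sqrt (M / \<mu> * Linf_norm {0<..<t} f)"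
      by (simp add: real_sqrt_le_mono)
    also have "\<dots> \<le> k * sqrt (Linf_norm {0<..<t} f)"
      unfolding real_sqrt_mult using kM Linf_norm_nonneg[of "{0<..<t}" f] by (intro mult_right_mono) auto
    finally show "sqrt (?J t (\<lambda>s. (f s)\<^sup>2)) \<le> k * sqrt (Linf_norm {0<..<t} f)" .
    have "?J t (\<lambda>s. M * \<bar>f s\<bar>) \<le> (LINT s|lebesgue_on {0..t}. M * \<bar>f s\<bar>)"
      by (rule exp_weight_integral_le_integral[OF fa \<mu>]) (use M in simp)
    with J have "sqrt (?J t (\<lambda>s. (f s)\<^sup>2)) \<le> sqrt (M * (LINT s|lebesgue_on {0..t}. \<bar>f s\<bar>))"
      by (simp add: real_sqrt_le_mono)
    also have "\<dots> \<le> k * sqrt (LINT s|lebesgue_on {0..t}. \<bar>f s\<bar>)"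
      unfolding real_sqrt_mult using kM by (intro mult_right_mono) (auto intro!: integral_nonneg_AE)
    finally show "sqrt (?J t (\<lambda>s. (f s)\<^sup>2)) \<le> k * sqrt (LINT s|lebesgue_on {0..t}. \<bar>f s\<bar>)" .
  qed
  show ?thesis
  proof (rule exI[of _ C'], rule exI[of _ "2 * \<mu>"], intro conjI allI impI)
    fix X0 X and t :: real
    assume adm: "admissible_init l a1 a2 b1 b2 d3 d4 X0"
      and sol: "is_solution l a1 a2 b1 b2 c1 c2 p1 p2 q1 q2 d1 d2 d3 d4 X0 X" and t: "t \<ge> 0"
    show "?N (X t) \<le> C' * exp (- (2 * \<mu> / 4) * t) * ?N X0
               + C' * (Linf_norm {0<..<t} (\<lambda>s. L2_norm l (d1 s)) + Linf_norm {0<..<t} (\<lambda>s. L2_norm l (d2 s))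
                      + sqrt (Linf_norm {0<..<t} d3) + sqrt (Linf_norm {0<..<t} d4))"
      by (rule main[OF t adm sol s1[OF n1 t] s1[OF n2 t] s2[OF d3(1) t M3 k(3,5)] s2[OF d4(1) t M4 k(4,6)]])
    show "?N (X t) \<le> C' * exp (- (2 * \<mu> / 4) * t) * ?N X0
               + C' * sqrt (LINT s|lebesgue_on {0..t}. (L2_norm l (d1 s))\<^sup>2)
               + C' * sqrt (LINT s|lebesgue_on {0..t}. (L2_norm l (d2 s))\<^sup>2)
               + C' * sqrt (LINT s|lebesgue_on {0..t}. \<bar>d3 s\<bar>) + C' * sqrt (LINT s|lebesgue_on {0..t}. \<bar>d4 s\<bar>)"
      using main[OF t adm sol i1[OF n1 t] i1[OF n2 t] i2[OF d3(1) t M3 k(3,5)] i2[OF d4(1) t M4 k(4,6)]]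
      by (simp only: distrib_left add.assoc)
  qed (use \<open>C' > 0\<close> \<mu> in auto)
qed

end

theorem theorem2:
  fixes l a1 a2 b1 b2 c1 c2 p1 p2 q1 q2 K\<^sub>m :: real
    and d1 d2 :: "real \<Rightarrow> real \<Rightarrow> real"
    and d3 d4 :: "real \<Rightarrow> real"
  assumes "l > 0"
    and "a1 > 0" and "a2 > 0" and "b1 > 0" and "b2 > 0"
    and "c1 \<ge> 0" and "c2 \<ge> 0" and "p1 \<ge> 0" and "p2 \<le> 0" and "q1 \<le> 0" and "q2 \<ge> 0"
    and "\<exists>d1'. C1_curve (L2_norm l) (L2_space l) d1 d1'"
    and "\<exists>d2'. C1_curve (L2_norm l) (L2_space l) d2 d2'"
    and "C2_halfline d3" and "d3 \<in> Linf_space {0..}"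
    and "C2_halfline d4" and "d4 \<in> Linf_space {0..}"
    and "K\<^sub>m = Max {1 / sqrt a1, 1 / sqrt a2, l^2 / (2 * sqrt a2), l^4 / (4 * sqrt a1)}"
    and "l^2 * sqrt (2 * l) * Linf_norm {0..} d3 < 2 * a1"
    and "sqrt (2 * l) * (1 + l * sqrt l) * (1 + K\<^sub>m)
           * (1 + c1 + c2 - p2 + q2 + Linf_norm {0..} d4) < a2"
    and "l^2 * sqrt (2 * l) * (1 + l^3)
           * (c1 + p1 - q1 + q2 + Linf_norm {0..} d3) < 2 * b1"
    and "sqrt (2 * l) * (1 + l^3)
           * (1 + p1 + c2 - p2 + q2 + Linf_norm {0..} d4) < b2"
  shows "EISS l a1 a2 b1 b2 c1 c2 p1 p2 q1 q2 d1 d2 d3 d4 \<and>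
    EiISS l a1 a2 b1 b2 c1 c2 p1 p2 q1 q2 d1 d2 d3 d4 \<and>
    (\<exists>C \<mu>\<^sub>m. C > 0 \<and> \<mu>\<^sub>m > 0 \<and>
       (\<forall>X0 X. admissible_init l a1 a2 b1 b2 d3 d4 X0 \<longrightarrow>
          is_solution l a1 a2 b1 b2 c1 c2 p1 p2 q1 q2 d1 d2 d3 d4 X0 X \<longrightarrow>
          (\<forall>t\<ge>0.
             state_norm l a1 a2 (X t) \<le>
               C * exp (- (\<mu>\<^sub>m / 4) * t) * state_norm l a1 a2 X0
               + C * (Linf_norm {0<..<t} (\<lambda>s. L2_norm l (d1 s))
                      + Linf_norm {0<..<t} (\<lambda>s. L2_norm l (d2 s))
                      + sqrt (Linf_norm {0<..<t} d3)
                      + sqrt (Linf_norm {0<..<t} d4)) \<and>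
             state_norm l a1 a2 (X t) \<le>
               C * exp (- (\<mu>\<^sub>m / 4) * t) * state_norm l a1 a2 X0
               + C * sqrt (LINT s|lebesgue_on {0..t}. (L2_norm l (d1 s))\<^sup>2)
               + C * sqrt (LINT s|lebesgue_on {0..t}. (L2_norm l (d2 s))\<^sup>2)
               + C * sqrt (LINT s|lebesgue_on {0..t}. \<bar>d3 s\<bar>)
               + C * sqrt (LINT s|lebesgue_on {0..t}. \<bar>d4 s\<bar>))))"
proof -
  have "1 / sqrt a1 \<le> K\<^sub>m" unfolding assms(18) by (rule Max_ge) auto
  then have Km: "K\<^sub>m \<ge> 0" using \<open>a1 > 0\<close> by (meson less_le_trans not_le zero_le_divide_1_iff real_sqrt_ge_zero less_imp_le order_trans)
  obtain \<delta> where \<delta>: "\<delta> > 0" and form: "\<And>A B Q. \<delta> * (A\<^sup>2 + B\<^sup>2 + Q\<^sup>2) \<le> b1 * A\<^sup>2 + (b2 - l\<^sup>2) * B\<^sup>2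
      + (a2 - c2 * l\<^sup>2) * Q\<^sup>2 - (c1 + q2) * (l^3 * A * Q) - (p1 + q2) * (l^3 * A * B)"
    using dissipation_form[OF \<open>l > 0\<close> assms(6-11) Km Linf_norm_nonneg Linf_norm_nonneg assms(20-22)] by blast
  \<comment> \<open>Majorises all quantities that the locale assumptions multiply by
    \<open>\<epsilon>\<close>, so that two inequalities for \<open>\<epsilon> * Z\<close> imply them
    all.\<close>
  define Z where "Z = 1 + l^4 + (c1 * l^3)\<^sup>2 / a1 + (p1 * l^3)\<^sup>2 / a1"
  have Z: "Z > 0" "l^4 \<le> Z" "(c1 * l^3)\<^sup>2 / a1 \<le> Z" "(p1 * l^3)\<^sup>2 / a1 \<le> Z"
    using \<open>a1 > 0\<close> by (simp_all add: Z_def add_pos_nonneg add_increasing add_increasing2)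
  define \<epsilon> where "\<epsilon> = min 1 (min (a1 / (4 * Z)) (\<delta> / (2 * Z)))"
  have "\<epsilon> > 0" using Z \<delta> \<open>a1 > 0\<close> by (simp add: \<epsilon>_def)
  have "\<epsilon> \<le> a1 / (4 * Z)" "\<epsilon> \<le> \<delta> / (2 * Z)" by (simp_all add: \<epsilon>_def)
  from this[THEN mult_right_mono, of Z] have \<epsilon>Z: "4 * (\<epsilon> * Z) \<le> a1" "\<epsilon> * Z \<le> \<delta> / 2" using Z by auto
  have le: "\<epsilon> * x \<le> \<epsilon> * Z" if "x \<le> Z" for x using that \<open>\<epsilon> > 0\<close> by simp
  interpret beam_string l a1 a2 b1 b2 c1 c2 p1 p2 q1 q2 \<delta> \<epsilon>
  proof
    show "\<epsilon> \<le> 1" by (simp add: \<epsilon>_def)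
    show "4 * (\<epsilon> * l^4) \<le> a1" using le[OF Z(2)] \<epsilon>Z by linarith
    show "\<epsilon> * l^4 \<le> \<delta> / 2" using le[OF Z(2)] \<epsilon>Z by linarith
    show "\<epsilon> * ((c1 * l^3)\<^sup>2 / a1) \<le> \<delta> / 2" using le[OF Z(3)] \<epsilon>Z by linarith
    show "\<epsilon> * ((p1 * l^3)\<^sup>2 / a1) \<le> \<delta> / 2" using le[OF Z(4)] \<epsilon>Z by linarith
  qed (fact assms \<delta> \<open>\<epsilon> > 0\<close> form)+
  obtain d1' d2' where d: "L2_deriv l d1 d1'" "L2_deriv l d2 d2'"
    using assms(12,13) C1_curve_L2_deriv by blast
  note est = ISS_estimates[OF d C2_halfline_continuous[OF assms(14)] assms(15) C2_halfline_continuous[OF assms(16)] assms(17)]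
  then obtain C \<mu> where C: "C > 0" and \<mu>: "\<mu> > 0"
    and E: "\<forall>X0 X. admissible_init l a1 a2 b1 b2 d3 d4 X0 \<longrightarrow>
          is_solution l a1 a2 b1 b2 c1 c2 p1 p2 q1 q2 d1 d2 d3 d4 X0 X \<longrightarrow> (\<forall>t\<ge>0.
             state_norm l a1 a2 (X t) \<le>
               C * exp (- (\<mu> / 4) * t) * state_norm l a1 a2 X0
               + C * (Linf_norm {0<..<t} (\<lambda>s. L2_norm l (d1 s))
                      + Linf_norm {0<..<t} (\<lambda>s. L2_norm l (d2 s))
                      + sqrt (Linf_norm {0<..<t} d3)
                      + sqrt (Linf_norm {0<..<t} d4)) \<and>
             state_norm l a1 a2 (X t) \<le>
               C * exp (- (\<mu> / 4) * t) * state_norm l a1 a2 X0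
               + C * sqrt (LINT s|lebesgue_on {0..t}. (L2_norm l (d1 s))\<^sup>2)
               + C * sqrt (LINT s|lebesgue_on {0..t}. (L2_norm l (d2 s))\<^sup>2)
               + C * sqrt (LINT s|lebesgue_on {0..t}. \<bar>d3 s\<bar>)
               + C * sqrt (LINT s|lebesgue_on {0..t}. \<bar>d4 s\<bar>))"
    by (elim exE conjE) (rule that)
  have K: "class_K_inf (\<lambda>r. C * r)" "class_K_inf (\<lambda>r. C * sqrt r)" "class_K (\<lambda>r. C * r)" "class_K (\<lambda>r. C * sqrt r)"
    "class_K (\<lambda>r. r)"
    using class_K_inf_linear[OF C] class_K_inf_sqrt[OF C] class_K_inf_linear[of 1] by (auto simp: class_K_inf_def)
  have "EISS l a1 a2 b1 b2 c1 c2 p1 p2 q1 q2 d1 d2 d3 d4"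
    unfolding EISS_def
  \<comment> \<open>Linear gains for the distributed disturbances, square root gains for the
    boundary disturbances.\<close>
  proof (rule exI[of _ "\<lambda>r. C * r"], rule exI[of _ "\<mu> / 4"], rule exI[of _ "\<lambda>r. C * r"], rule exI[of _ "\<lambda>r. C * r"],
      rule exI[of _ "\<lambda>r. C * sqrt r"], rule exI[of _ "\<lambda>r. C * sqrt r"], intro conjI allI impI K)
    fix X0 X and t :: real
    assume "admissible_init l a1 a2 b1 b2 d3 d4 X0"
      "is_solution l a1 a2 b1 b2 c1 c2 p1 p2 q1 q2 d1 d2 d3 d4 X0 X" "t \<ge> 0"
    from E[rule_format, OF this, THEN conjunct1]
    show "state_norm l a1 a2 (X t) \<le> C * state_norm l a1 a2 X0 * exp (- (\<mu> / 4) * t)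
        + C * Linf_norm {0<..<t} (\<lambda>s. L2_norm l (d1 s)) + C * Linf_norm {0<..<t} (\<lambda>s. L2_norm l (d2 s))
        + C * sqrt (Linf_norm {0<..<t} d3) + C * sqrt (Linf_norm {0<..<t} d4)"
      by (simp only: distrib_left add.assoc mult_ac)
  qed (use \<mu> in simp)
  moreover have "EiISS l a1 a2 b1 b2 c1 c2 p1 p2 q1 q2 d1 d2 d3 d4"
    unfolding EiISS_def
  \<comment> \<open>All outer gains are square roots; the integrands are squared norms for
    \<open>d1\<close> and \<open>d2\<close> and absolute values for \<open>d3\<close> and
    \<open>d4\<close>.\<close>
  proof (rule exI[of _ "\<lambda>r. C * r"], rule exI[of _ "\<mu> / 4"], rule exI[of _ "\<lambda>r. C * sqrt r"], rule exI[of _ "\<lambda>r. C * sqrt r"],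
      rule exI[of _ "\<lambda>r. C * sqrt r"], rule exI[of _ "\<lambda>r. C * sqrt r"], rule exI[of _ "\<lambda>r. r\<^sup>2"], rule exI[of _ "\<lambda>r. r\<^sup>2"],
      rule exI[of _ "\<lambda>r. r"], rule exI[of _ "\<lambda>r. r"], intro conjI allI impI K class_K_square)
    fix X0 X and t :: real
    assume "admissible_init l a1 a2 b1 b2 d3 d4 X0"
      "is_solution l a1 a2 b1 b2 c1 c2 p1 p2 q1 q2 d1 d2 d3 d4 X0 X" "t \<ge> 0"
    from E[rule_format, OF this, THEN conjunct2]
    show "state_norm l a1 a2 (X t) \<le> C * state_norm l a1 a2 X0 * exp (- (\<mu> / 4) * t)
        + C * sqrt (LINT s|lebesgue_on {0..t}. (L2_norm l (d1 s))\<^sup>2)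
        + C * sqrt (LINT s|lebesgue_on {0..t}. (L2_norm l (d2 s))\<^sup>2)
        + C * sqrt (LINT s|lebesgue_on {0..t}. \<bar>d3 s\<bar>)
        + C * sqrt (LINT s|lebesgue_on {0..t}. \<bar>d4 s\<bar>)"
      by (simp only: mult_ac)
  qed (use \<mu> in simp)
  ultimately show ?thesis using est by (intro conjI)
qed

end
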